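(* Let $n\in\{2,3\}$ and $r\geq 2$. The action of $\mathrm{Out}(\mathbb{Z}^r)$ on the $\mathbb{F}_q$-points $\mathfrak{X}_{\mathbb{Z}^r}(\mathrm{SL}_n(\mathbb{F}_q))$ of the $\mathrm{SL}_n$-character variety of $\mathbb{Z}^r$ is not asymptotically transitive. Furthermore, the asymptotic ratio of the orbits of elements in the character variety is bounded above by $\frac{1}{2}$.
   Context: Throughout, $q=p^k$ is a prime power, $\mathbb{F}_q$ is the field with $q$ elements, and $\overline{\mathbb{F}}_q$ is its algebraic closure. Points of the character variety. A homomorphism $\rho:\mathbb{Z}^r\to \mathrm{SL}_n(\mathbb{F}_q)$ is identified with the pairwise commuting $r$-tuple $(A_1,\dots,A_r)=(\rho(\gamma_1),\dots,\rho(\gamma_r))$, where $\gamma_1,\dots,\gamma_r$ is the standard basis of $\mathbb{Z}^r$. The points of $\mathfrak{X}_{\mathbb{Z}^r}(\mathrm{SL}_n(\mathbb{F}_q))$ are the closed conjugation orbits, i.e. the classes $[\rho]$ of those commuting $r$-tuples in $\mathrm{SL}_n(\mathbb{F}_q)^r$ which are simultaneously diagonalizable over $\overline{\mathbb{F}}_q$, two tuples being identified when they are simultaneously conjugate over $\overline{\mathbb{F}}_q$ (equivalently, when their simultaneous diagonalizations agree up to a simultaneous permutation of the diagonal entries). Action. $\mathrm{Aut}(\mathbb{Z}^r)=\mathrm{GL}_r(\mathbb{Z})$ acts on $\mathrm{Hom}(\mathbb{Z}^r,\mathrm{SL}_n(\mathbb{F}_q))$ by $\alpha\cdot\rho=\rho\circ\alpha^{-1}$.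 This induces an action of $\mathrm{Out}(\mathbb{Z}^r)$ $(=\mathrm{GL}_r(\mathbb{Z}))$ on $\mathfrak{X}_{\mathbb{Z}^r}(\mathrm{SL}_n(\mathbb{F}_q))$. Asymptotic ratio. For a group acting on the finite sets $X(\mathbb{F}_q)$ of $\mathbb{F}_q$-points of a variety $X$ for every $q$, the asymptotic ratio is $$\lim_{q\to\infty}\frac{\max_{v\in X(\mathbb{F}_q)}|\mathrm{Orb}(v)|}{|X(\mathbb{F}_q)|}$$ whenever this limit exists, where $q$ ranges over prime powers and the limit is required to exist regardless of how $q=p^k\to\infty$; the sizes need only be considered for all but finitely many primes $p$. The action is asymptotically transitive if the asymptotic ratio is $1$ (that is, the limit exists and equals $1$). *)

theory Defs
  imports
    "Jordan_Normal_Form.Matrix"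
    "HOL-Algebra.Algebraic_Closure"
    "HOL-Algebra.Bij"
    "HOL-Algebra.Elementary_Groups"
    "HOL-Algebra.Group_Action"
    "HOL-Algebra.Product_Groups"
    "HOL-Combinatorics.Permutations"
    "HOL-Library.Extended_Real"
    "HOL-Library.Liminf_Limsup"
    "HOL-Number_Theory.Prime_Powers"
begin

section \<open>Matrices over a ring record\<close>

text \<open>The fields below vary with the prime power \<open>q\<close>, so they are ring records and not types of
  class \<open>field\<close>. Hence \<open>'a mat\<close> is used only as a container of entries, and product and determinant
  are taken with respect to the record.\<close>

definition mat_monoid :: "('a, 'b) ring_scheme \<Rightarrow> nat \<Rightarrow> 'a mat monoid" where
  "mat_monoid R n =
    \<lparr>carrier = {A \<in> carrier_mat n n. \<forall>i<n. \<forall>j<n. A $$ (i, j) \<in> carrier R},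
     monoid.mult = (\<lambda>A B. mat n n
       (\<lambda>(i, j). \<Oplus>\<^bsub>R\<^esub>k\<in>{..<n}. A $$ (i, k) \<otimes>\<^bsub>R\<^esub> B $$ (k, j))),
     one = mat n n (\<lambda>(i, j). if i = j then \<one>\<^bsub>R\<^esub> else \<zero>\<^bsub>R\<^esub>)\<rparr>"

definition mat_det :: "('a, 'b) ring_scheme \<Rightarrow> nat \<Rightarrow> 'a mat \<Rightarrow> 'a" where
  "mat_det R n A =
    (\<Oplus>\<^bsub>R\<^esub>p\<in>{p. p permutes {..<n}}. [sign p] \<cdot>\<^bsub>R\<^esub> (\<Otimes>\<^bsub>R\<^esub>i\<in>{..<n}. A $$ (i, p i)))"

definition SL :: "('a, 'b) ring_scheme \<Rightarrow> nat \<Rightarrow> 'a mat monoid" where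
  "SL R n = (mat_monoid R n)
    \<lparr>carrier := {A \<in> carrier (mat_monoid R n). mat_det R n A = \<one>\<^bsub>R\<^esub>}\<rparr>"

text \<open>Conjugation by \<open>g \<in> GL\<^sub>n(R)\<close>, the latter being \<open>Units (mat_monoid R n)\<close>.\<close>

definition mat_conj :: "('a, 'b) ring_scheme \<Rightarrow> nat \<Rightarrow> 'a mat \<Rightarrow> 'a mat \<Rightarrow> 'a mat" where
  "mat_conj R n g A =
    g \<otimes>\<^bsub>mat_monoid R n\<^esub> A \<otimes>\<^bsub>mat_monoid R n\<^esub> inv\<^bsub>mat_monoid R n\<^esub> g"

definition is_diagonal :: "('a, 'b) ring_scheme \<Rightarrow> nat \<Rightarrow> 'a mat \<Rightarrow> bool" where
  "is_diagonal R n A \<longleftrightarrow> (\<forall>i<n. \<forall>j<n. i \<noteq> j \<longrightarrow> A $$ (i, j) = \<zero>\<^bsub>R\<^esub>)"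


section \<open>Points of the character variety\<close>

definition Z_pow :: "nat \<Rightarrow> (nat \<Rightarrow> int) monoid" where
  "Z_pow r = product_group {..<r} (\<lambda>_. integer_group)"

definition std_basis :: "nat \<Rightarrow> nat \<Rightarrow> (nat \<Rightarrow> int)" where
  "std_basis r i = (\<lambda>j\<in>{..<r}. if j = i then 1 else 0)"

text \<open>\<open>hom\<close> does not constrain functions outside the carrier; extensionality makes homomorphisms
  with equal values equal.\<close>

definition Hom_SL :: "('a, 'b) ring_scheme \<Rightarrow> nat \<Rightarrow> nat \<Rightarrow> ((nat \<Rightarrow> int) \<Rightarrow> 'a mat) set" where
  "Hom_SL R n r = hom (Z_pow r) (SL R n) \<inter> extensional (carrier (Z_pow r))"

text \<open>In the following, \<open>L\<close> is an algebraic closure of its subfield \<open>K\<close>, and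
  \<open>L\<lparr>carrier := K\<rparr>\<close> is \<open>K\<close> as a field.\<close>

definition diag_Hom_SL ::
    "('a, 'b) ring_scheme \<Rightarrow> 'a set \<Rightarrow> nat \<Rightarrow> nat \<Rightarrow> ((nat \<Rightarrow> int) \<Rightarrow> 'a mat) set" where
  "diag_Hom_SL L K n r = {\<rho> \<in> Hom_SL (L\<lparr>carrier := K\<rparr>) n r.
     \<exists>g \<in> Units (mat_monoid L n). \<forall>i<r. is_diagonal L n (mat_conj L n g (\<rho> (std_basis r i)))}"

definition conj_rel ::
    "('a, 'b) ring_scheme \<Rightarrow> 'a set \<Rightarrow> nat \<Rightarrow> nat \<Rightarrow> ((nat \<Rightarrow> int) \<Rightarrow> 'a mat) rel" where
  "conj_rel L K n r = {(\<rho>, \<rho>'). \<rho> \<in> diag_Hom_SL L K n r \<and> \<rho>' \<in> diag_Hom_SL L K n r \<and>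
     (\<exists>g \<in> Units (mat_monoid L n).
        \<forall>i<r. \<rho>' (std_basis r i) = mat_conj L n g (\<rho> (std_basis r i)))}"

definition char_variety ::
    "('a, 'b) ring_scheme \<Rightarrow> 'a set \<Rightarrow> nat \<Rightarrow> nat \<Rightarrow> ((nat \<Rightarrow> int) \<Rightarrow> 'a mat) set set" where
  "char_variety L K n r = diag_Hom_SL L K n r // conj_rel L K n r"


section \<open>The action of the outer automorphism group\<close>

definition Inn :: "('a, 'b) monoid_scheme \<Rightarrow> ('a \<Rightarrow> 'a) set" where
  "Inn G = (\<lambda>g. \<lambda>x\<in>carrier G. g \<otimes>\<^bsub>G\<^esub> x \<otimes>\<^bsub>G\<^esub> inv\<^bsub>G\<^esub> g) ` carrier G"

definition Out :: "('a, 'b) monoid_scheme \<Rightarrow> ('a \<Rightarrow> 'a) set monoid" where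
  "Out G = AutoGroup G Mod Inn G"

definition aut_act :: "('a, 'b) monoid_scheme \<Rightarrow> ('a \<Rightarrow> 'a) \<Rightarrow> ('a \<Rightarrow> 'c) \<Rightarrow> ('a \<Rightarrow> 'c)" where
  "aut_act G \<alpha> \<rho> = compose (carrier G) \<rho> (inv\<^bsub>AutoGroup G\<^esub> \<alpha>)"

text \<open>The induced action of a coset \<open>c\<close> of inner automorphisms on a conjugacy class \<open>v\<close>:
  for all \<open>\<alpha> \<in> c\<close> the set \<open>{\<alpha> \<cdot> \<rho> | \<rho> \<in> v}\<close> is the same conjugacy class, and the union is that class.\<close>

definition out_act ::
    "('a, 'b) monoid_scheme \<Rightarrow> ('a \<Rightarrow> 'a) set \<Rightarrow> ('a \<Rightarrow> 'c) set \<Rightarrow> ('a \<Rightarrow> 'c) set" where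
  "out_act G c v = (\<Union>\<alpha>\<in>c. aut_act G \<alpha> ` v)"


section \<open>Asymptotic ratio\<close>

definition max_orbit_ratio ::
    "('g, 'b) monoid_scheme \<Rightarrow> ('g \<Rightarrow> 'x \<Rightarrow> 'x) \<Rightarrow> 'x set \<Rightarrow> real" where
  "max_orbit_ratio G act V = real (Max ((\<lambda>v. card (orbit G act v)) ` V)) / real (card V)"

text \<open>The filter of \<open>q \<rightarrow> \<infinity>\<close> along all powers \<open>q = p\<^sup>k\<close>, \<open>k \<ge> 1\<close>, of primes \<open>p \<notin> S\<close>.\<close>

definition prime_powers_at_top :: "nat set \<Rightarrow> nat filter" where
  "prime_powers_at_top S = inf at_top (principal {p ^ k | p k. Factorial_Ring.prime p \<and> p \<notin> S \<and> k > 0})"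

text \<open>A ratio \<open>f q\<close> given for every prime power \<open>q\<close> has asymptotic ratio \<open>c\<close> if it tends to \<open>c\<close>
  after finitely many primes have been discarded.\<close>

definition has_asymptotic_ratio :: "(nat \<Rightarrow> real) \<Rightarrow> real \<Rightarrow> bool" where
  "has_asymptotic_ratio f c \<longleftrightarrow> (\<exists>S. finite S \<and> (f \<longlongrightarrow> c) (prime_powers_at_top S))"

definition asymptotically_transitive :: "(nat \<Rightarrow> real) \<Rightarrow> bool" where
  "asymptotically_transitive f \<longleftrightarrow> has_asymptotic_ratio f 1"

text \<open>An upper bound that is meaningful even if the limit does not exist; if it does exist,
  the limit is at most \<open>c\<close>.\<close>

definition asymptotic_ratio_bounded_by :: "(nat \<Rightarrow> real) \<Rightarrow> real \<Rightarrow> bool" where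
  "asymptotic_ratio_bounded_by f c \<longleftrightarrow>
    (\<exists>S. finite S \<and> Limsup (prime_powers_at_top S) (\<lambda>q. ereal (f q)) \<le> ereal c)"

text \<open>The family \<open>F\<close> of finite fields and the family \<open>L\<close> of their algebraic closures are indexed
  by \<open>q\<close>.\<close>

definition char_variety_ratio ::
    "(nat \<Rightarrow> ('a, 'b) ring_scheme) \<Rightarrow> (nat \<Rightarrow> 'a set) \<Rightarrow> nat \<Rightarrow> nat \<Rightarrow> nat \<Rightarrow> real" where
  "char_variety_ratio L F n r q =
    max_orbit_ratio (Out (Z_pow r)) (out_act (Z_pow r)) (char_variety (L q) (F q) n r)"

end

theory Submission
  imports Defs "HOL-Decision_Procs.Commutative_Ring" "HOL-Real_Asymp.Real_Asymp"
begin

text \<open>A diagonalizable representation is determined up to conjugation by its set of eigencharacters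
  \<open>\<int>\<^sup>r \<rightarrow> L\<^sup>\<times>\<close>, which has trivial product and is stable under \<open>\<chi> \<mapsto> \<chi>\<^sup>q\<close>. These sets fall into types
  according to the cycle type of Frobenius on them: for \<open>n = 2\<close>, \<open>{\<chi>, \<chi>\<^sup>-\<^sup>1}\<close> with values of \<open>\<chi>\<close> in the roots
  of unity of order \<open>q - 1\<close> or \<open>q + 1\<close>; for \<open>n = 3\<close>, three characters of order dividing \<open>q - 1\<close>,
  a pair \<open>\<chi>, \<chi>\<^sup>q\<close> of order dividing \<open>q\<^sup>2 - 1\<close>, or a triple \<open>\<chi>, \<chi>\<^sup>q, \<chi>\<^sup>q\<^sup>2\<close> of order dividing \<open>q\<^sup>2 + q + 1\<close>.
  Precomposition with automorphisms preserves the type. Up to lower order terms the types make up \<open>1/2\<close>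
  and \<open>1/2\<close>, respectively \<open>1/6\<close>, \<open>1/2\<close> and \<open>1/3\<close>, of all points, so no orbit exceeds half of them
  asymptotically.\<close>

section \<open>Roots of unity over a finite field\<close>

text \<open>Orbits are never computed. Each type is a family of spectra stable under precomposition
  with every endomorphism of Z^r, so its cardinality bounds the orbit of each of its members, and
  the ratio is at most \<open>U / T\<close> with \<open>U\<close> an upper bound for every type and
  \<open>T\<close> a lower bound for the number of points. The obstacle is \<open>T\<close>: all
  Frobenius-stable sets of characters must be realized by matrices over the finite field, a descent
  problem solved by Vandermonde-like matrices whose rows Frobenius permutes. The types overlap and
  the maps from torsion characters to sets have degenerate fibres, so exact counts would depend on
  congruences of \<open>q\<close>; inequalities with errors of lower degree in \<open>q\<close>
  avoid this. The fractions are reciprocals of the generic fibre sizes of those maps, that is of the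
  centralizer orders of the Frobenius permutation in the symmetric group (for three characters:
  identity 6, transposition 2, 3-cycle 3). The lower bounds need them exactly, since they have to
  add up to 1; for the upper bounds fibres with two elements suffice for each type, because only 1/2
  is claimed.\<close>

lemma (in cring) binomial_power:
  assumes x: "x \<in> carrier R" and y: "y \<in> carrier R"
  shows "(x \<oplus> y) [^] (n::nat) = (\<Oplus>k\<in>{..n}. [(n choose k)] \<cdot> (x [^] k \<otimes> y [^] (n - k)))"
proof (induction n)
  case 0
  show ?case using assms by (simp add: add.nat_pow_eone)
next
  case (Suc n)
  define a where "a m k = [(m choose k)] \<cdot> (x [^] k \<otimes> y [^] (m - k))" for m k :: nat
  have a_closed [simp]: "a m k \<in> carrier R" for m k using assms by (simp add: a_def)
  \<comment> \<open>The coefficient \<open>n choose Suc n\<close> is zero, so the sum multiplied by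
    \<open>y\<close> may be extended to \<open>Suc n\<close>. Shifting its index then aligns it with
    the sum multiplied by \<open>x\<close>, and Pascal's rule combines the terms.\<close>
  have top: "a n (Suc n) = \<zero>" using assms by (simp add: a_def binomial_eq_0)
  have bot: "a (Suc n) 0 = y \<otimes> a n 0"
    using assms by (simp add: a_def m_comm add.nat_pow_eone)
  have step: "a (Suc n) (Suc k) = x \<otimes> a n k \<oplus> y \<otimes> a n (Suc k)" if "k \<le> n" for k
  proof -
    have 1: "x \<otimes> a n k = [(n choose k)] \<cdot> (x [^] Suc k \<otimes> y [^] (n - k))"
      using assms by (simp add: a_def add_pow_rdistr m_ac nat_pow_Suc2)
    have 2: "y \<otimes> a n (Suc k) = [(n choose Suc k)] \<cdot> (x [^] Suc k \<otimes> y [^] (n - k))"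
    proof (cases "k < n")
      case True
      then have "n - k = Suc (n - Suc k)" by simp
      then show ?thesis using assms by (simp add: a_def add_pow_rdistr m_ac nat_pow_Suc2)
    next
      case False
      then show ?thesis using that assms by (simp add: a_def binomial_eq_0)
    qed
    show ?thesis unfolding 1 2 using assms
      by (simp add: a_def add.nat_pow_mult)
  qed
  have "(x \<oplus> y) [^] Suc n = (x \<oplus> y) \<otimes> (\<Oplus>k\<in>{..n}. a n k)"
    using Suc assms by (simp add: a_def nat_pow_Suc2 m_comm)
  also have "\<dots> = x \<otimes> (\<Oplus>k\<in>{..n}. a n k) \<oplus> y \<otimes> (\<Oplus>k\<in>{..Suc n}. a n k)"
    using assms by (simp add: top l_distr finsum_closed)
  also have "(\<Oplus>k\<in>{..Suc n}. a n k) = (\<Oplus>k\<in>{..n}. a n (Suc k)) \<oplus> a n 0"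
    by (rule finsum_Suc2) simp
  also have "x \<otimes> (\<Oplus>k\<in>{..n}. a n k) \<oplus> y \<otimes> ((\<Oplus>k\<in>{..n}. a n (Suc k)) \<oplus> a n 0)
      = (\<Oplus>k\<in>{..n}. x \<otimes> a n k \<oplus> y \<otimes> a n (Suc k)) \<oplus> y \<otimes> a n 0"
    using assms by (simp add: finsum_rdistr finsum_addf r_distr finsum_closed a_assoc)
  also have "\<dots> = (\<Oplus>k\<in>{..n}. a (Suc n) (Suc k)) \<oplus> a (Suc n) 0"
    unfolding bot using assms
    by (intro arg_cong2[where f = "(\<oplus>)"] finsum_cong') (auto simp: step)
  also have "\<dots> = (\<Oplus>k\<in>{..Suc n}. a (Suc n) k)"
    by (rule finsum_Suc2[symmetric]) simp
  finally show ?case by (simp add: a_def)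
qed

text \<open>For exponent \<open>p\<close> the inner binomial coefficients are multiples of
  \<open>p\<close> and vanish in characteristic \<open>p\<close>; induction on \<open>k\<close>
  passes to powers of \<open>p\<close>.\<close>

lemma (in cring) prime_power_add:
  assumes p: "Factorial_Ring.prime (p::nat)" and char: "[p] \<cdot> \<one> = \<zero>"
    and x: "x \<in> carrier R" and y: "y \<in> carrier R"
  shows "(x \<oplus> y) [^] (p ^ k) = x [^] (p ^ k) \<oplus> y [^] (p ^ k)"
  using x y
proof (induction k arbitrary: x y)
  case (Suc k)
  have kill: "[m] \<cdot> z = \<zero>" if "p dvd m" "z \<in> carrier R" for m :: nat and z
  proof -
    obtain j where "m = p * j" using \<open>p dvd m\<close> by blast
    then have "[m] \<cdot> z = [j] \<cdot> ([p] \<cdot> (\<one> \<otimes> z))"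
      using that by (simp add: add.nat_pow_pow)
    also have "\<dots> = \<zero>"
      using that char by (subst add_pow_ldistr[symmetric]) auto
    finally show ?thesis .
  qed
  have one: "(u \<oplus> v) [^] p = u [^] p \<oplus> v [^] p" if "u \<in> carrier R" "v \<in> carrier R" for u v
  proof -
    \<comment> \<open>As \<open>p\<close> is at least 2, both extreme terms split off and the middle
      ones are indexed by \<open>{..m}\<close>.\<close>
    obtain m where m: "p = Suc (Suc m)"
      using prime_ge_2_nat[OF p] by (metis add_2_eq_Suc le_Suc_ex)
    let ?t = "\<lambda>k. [(p choose k)] \<cdot> (u [^] k \<otimes> v [^] (p - k))"
    have "(u \<oplus> v) [^] p = finsum R ?t {..Suc (Suc m)}"
      using binomial_power[OF that, of p] m by simp
    also have "\<dots> = ?t (Suc (Suc m)) \<oplus> (finsum R (\<lambda>k. ?t (Suc k)) {..m} \<oplus> ?t 0)"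
      using that by (subst finsum_Suc, simp, subst finsum_Suc2) auto
    also have "finsum R (\<lambda>k. ?t (Suc k)) {..m} = \<zero>"
    proof (rule add.finprod_one_eqI)
      fix k assume "k \<in> {..m}"
      then have "p dvd (p choose Suc k)"
        using p m by (intro dvd_choose_prime) auto
      then show "?t (Suc k) = \<zero>" using that by (intro kill) auto
    qed
    finally show ?thesis using that m by simp
  qed
  show ?case
    using Suc by (simp add: nat_pow_pow[symmetric] one mult.commute[of p])
qed simp

text \<open>Polynomial identities are proved by reflection: the rules below reify a ring expression, whose
  normal form is then computed by rewriting.\<close>

lemma (in cring) eq_zero_by_normalization:
  "in_carrier l \<Longrightarrow> x = Ipolex l P \<Longrightarrow> norm P = Pc 0 \<Longrightarrow> x = \<zero>"
  using norm_ci[of l P] by simp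

lemma (in cring) Ipolex_intros:
  "\<zero> = Ipolex l (Const 0)"
  "\<one> = Ipolex l (Const 1)"
  "x = Ipolex l P \<Longrightarrow> y = Ipolex l Q \<Longrightarrow> x \<oplus> y = Ipolex l (Add P Q)"
  "x = Ipolex l P \<Longrightarrow> y = Ipolex l Q \<Longrightarrow> x \<ominus> y = Ipolex l (Sub P Q)"
  "x = Ipolex l P \<Longrightarrow> y = Ipolex l Q \<Longrightarrow> x \<otimes> y = Ipolex l (Mul P Q)"
  "x = Ipolex (x # l) (Var 0)"
  "x = Ipolex l (Var n) \<Longrightarrow> x = Ipolex (y # l) (Var (Suc n))"
  by simp_all

text \<open>When \<open>x\<close> and \<open>y\<close> specialize to the same element, the cofactor
  becomes \<open>n\<close> times its power \<open>n - 1\<close>. It thus plays the role of the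
  derivative when the roots of X^m - 1 are shown to be simple.\<close>

lemma (in cring) pow_minus_pow_factor:
  assumes x: "x \<in> carrier R" and y: "y \<in> carrier R"
  shows "x [^] (n::nat) \<ominus> y [^] n = (x \<ominus> y) \<otimes> (\<Oplus>k\<in>{..<n}. x [^] k \<otimes> y [^] (n - Suc k))"
proof (induction n)
  case 0
  then show ?case using assms by (simp add: minus_eq r_neg)
next
  case (Suc n)
  let ?s = "\<Oplus>k\<in>{..<n}. x [^] k \<otimes> y [^] (n - Suc k)"
  have s: "?s \<in> carrier R" using assms by (intro finsum_closed) auto
  have "(\<Oplus>k\<in>{..<Suc n}. x [^] k \<otimes> y [^] (Suc n - Suc k))
      = x [^] n \<oplus> (\<Oplus>k\<in>{..<n}. y \<otimes> (x [^] k \<otimes> y [^] (n - Suc k)))"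
  proof -
    have "(\<Oplus>k\<in>{..<n}. x [^] k \<otimes> y [^] (Suc n - Suc k))
        = (\<Oplus>k\<in>{..<n}. y \<otimes> (x [^] k \<otimes> y [^] (n - Suc k)))"
    proof (rule finsum_cong')
      fix k assume "k \<in> {..<n}"
      then have "n - k = Suc (n - Suc k)" by auto
      then show "x [^] k \<otimes> y [^] (Suc n - Suc k) = y \<otimes> (x [^] k \<otimes> y [^] (n - Suc k))"
        using assms by (simp add: m_ac)
    qed (use assms in auto)
    then show ?thesis using assms unfolding lessThan_Suc by (subst finsum_insert) auto
  qed
  also have "\<dots> = x [^] n \<oplus> y \<otimes> ?s"
    using assms by (simp add: finsum_rdistr)
  finally have *: "(x \<ominus> y) \<otimes> (\<Oplus>k\<in>{..<Suc n}. x [^] k \<otimes> y [^] (Suc n - Suc k))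
      = (x \<ominus> y) \<otimes> x [^] n \<oplus> y \<otimes> ((x \<ominus> y) \<otimes> ?s)"
    using assms s by (simp add: r_distr m_lcomm)
  have "x [^] Suc n \<ominus> y [^] Suc n \<ominus> ((x \<ominus> y) \<otimes> x [^] n \<oplus> y \<otimes> (x [^] n \<ominus> y [^] n)) = \<zero>"
  proof -
    define u where "u = x [^] n"
    define w where "w = y [^] n"
    have uw: "u \<in> carrier R" "w \<in> carrier R" using x y by (simp_all add: u_def w_def)
    show ?thesis
      unfolding nat_pow_Suc u_def[symmetric] w_def[symmetric]
      by (rule eq_zero_by_normalization[of "[x, y, u, w]"], simp add: in_carrier_def x y uw,
          (rule Ipolex_intros)+, code_simp)
  qed
  then show ?case unfolding * Suc.IH[symmetric] using assms eq_diff0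
    by simp
qed

definition roots_of_unity :: "('a, 'b) ring_scheme \<Rightarrow> nat \<Rightarrow> 'a set" where
  "roots_of_unity R m = {x \<in> carrier R. x [^]\<^bsub>R\<^esub> m = \<one>\<^bsub>R\<^esub>}"

locale finite_field_closure = algebraic_closure L K for L (structure) and K +
  fixes q :: nat
  assumes primepow_q: "primepow q" and card_K: "card K = q"
begin

abbreviation KF where "KF \<equiv> L\<lparr>carrier := K\<rparr>"

abbreviation LX where "LX \<equiv> poly_ring L"

lemma q_gt_1: "q > 1"
  using primepow_q by (simp add: primepow_gt_Suc_0)

lemma finite_K: "finite K"
  using card_K q_gt_1 card.infinite by fastforce

lemma K_subset: "K \<subseteq> carrier L"
  using subfieldE(3)[OF subfield_axioms] .

text \<open>Lagrange's theorem in the additive group of \<open>K\<close>, which has order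
  \<open>q\<close>.\<close>

lemma add_pow_q: "[q] \<cdot> \<one> = \<zero>"
proof -
  interpret KF: field "KF" using subfield_iff(2)[OF subfield_axioms] .
  have "[order (add_monoid (KF))] \<cdot>\<^bsub>KF\<^esub> \<one> = \<zero>"
    using KF.add.pow_order_eq_1[of "\<one>"] KF.one_closed by simp
  then show ?thesis by (simp add: order_def card_K add_pow_def nat_pow_def)
qed

lemma add_pow_one_mult: "[(a * b)] \<cdot> \<one> = ([a] \<cdot> \<one>) \<otimes> ([b] \<cdot> \<one>)" for a b :: nat
proof -
  have "[(a * b)] \<cdot> \<one> = [a] \<cdot> (\<one> \<otimes> ([b] \<cdot> \<one>))"
    by (simp add: add.nat_pow_pow mult.commute)
  also have "\<dots> = ([a] \<cdot> \<one>) \<otimes> ([b] \<cdot> \<one>)"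
    by (subst add_pow_ldistr) auto
  finally show ?thesis .
qed

text \<open>The element \<open>[q] \<cdot> \<one>\<close> is a power of
  \<open>[p] \<cdot> \<one>\<close>, and \<open>L\<close> has no zero divisors.\<close>

lemma characteristic: obtains p k where "Factorial_Ring.prime p" "q = p ^ k" "[p] \<cdot> \<one> = \<zero>"
proof -
  obtain p k where p: "Factorial_Ring.prime p" "q = p ^ k"
    using primepow_q by (auto simp: primepow_def)
  have "[(p ^ j)] \<cdot> \<one> = ([p] \<cdot> \<one>) [^] j" for j :: nat
    by (induction j) (simp_all add: add_pow_one_mult m_comm)
  from this[of k] have "[p] \<cdot> \<one> = \<zero>"
    using add_pow_q p by (simp add: add.nat_pow_closed)
  with p that show ?thesis by blast
qed

lemma frob_add:
  "x \<in> carrier L \<Longrightarrow> y \<in> carrier L \<Longrightarrow> (x \<oplus> y) [^] q = x [^] q \<oplus> y [^] q"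
  by (rule characteristic) (use prime_power_add in blast)

lemma frob_zero: "\<zero> [^] q = \<zero>"
  using q_gt_1 by (simp add: nat_pow_zero)

text \<open>By Bezout some multiple of \<open>m\<close> exceeds a multiple of \<open>q\<close> by 1,
  so \<open>m\<close> and \<open>q\<close> cannot both vanish in the field.\<close>

lemma add_pow_one_neq_zero:
  assumes "coprime m q" shows "[m] \<cdot> \<one> \<noteq> \<zero>"
proof
  assume m: "[m] \<cdot> \<one> = \<zero>"
  obtain a b where ab: "a * m = b * q + 1"
    by (metis assms coprime_bezout_strong mult.commute nat_neq_iff q_gt_1)
  have "\<one> = [(b * q + 1)] \<cdot> \<one>"
    using add.nat_pow_mult[of "\<one>" "b * q" 1] by (simp add: add_pow_one_mult add_pow_q)
  also have "\<dots> = \<zero>"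
    unfolding ab[symmetric] add_pow_one_mult by (simp add: m)
  finally show False by simp
qed

definition unity_poly :: "nat \<Rightarrow> 'a list" where
  "unity_poly m = X\<^bsub>L\<^esub> [^]\<^bsub>LX\<^esub> m \<ominus>\<^bsub>LX\<^esub> \<one>\<^bsub>LX\<^esub>"

lemma unity_poly_closed: "unity_poly m \<in> carrier (LX)"
proof -
  interpret UP: domain "LX"
    using univ_poly_is_domain[OF carrier_is_subring] .
  show ?thesis unfolding unity_poly_def using var_closed(1)[OF carrier_is_subring] by auto
qed

lemma eval_unity_poly: "x \<in> carrier L \<Longrightarrow> eval (unity_poly m) x = x [^] m \<ominus> \<one>"
proof -
  assume x: "x \<in> carrier L"
  interpret UP: domain "LX"
    using univ_poly_is_domain[OF carrier_is_subring] .
  interpret ev: ring_hom_cring "LX" L "\<lambda>p. eval p x"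
    using eval_cring_hom[OF carrier_is_subring x] .
  show ?thesis
    unfolding unity_poly_def using var_closed(1)[OF carrier_is_subring] x
    by (simp add: a_minus_def ring_hom_ring.hom_nat_pow[OF eval_ring_hom[OF carrier_is_subring x]] eval_var)
qed

lemma degree_unity_poly: assumes "m > 0" shows "degree (unity_poly m) = m"
proof -
  interpret UP: domain "LX"
    using univ_poly_is_domain[OF carrier_is_subring] .
  have 1: "X\<^bsub>L\<^esub> [^]\<^bsub>LX\<^esub> m = monom \<one> m"
    using unitary_monom_eq_var_pow[OF carrier_is_subring] by simp
  have 2: "\<ominus>\<^bsub>LX\<^esub> \<one>\<^bsub>LX\<^esub> = [\<ominus> \<one>]"
    using univ_poly_a_inv_def'[OF carrier_is_subring UP.one_closed] by (simp add: univ_poly_one)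
  show ?thesis
    unfolding unity_poly_def a_minus_def 1 2 univ_poly_add
    using assms by (subst poly_add_degree_eq[OF carrier_is_subring]) (auto simp: monom_def polynomial_def)
qed

text \<open>The upper bound is the degree of X^m - 1. It is attained for \<open>m\<close> prime to
  \<open>q\<close> because the polynomial splits over the algebraically closed \<open>L\<close> and
  has only simple roots.\<close>

lemma finite_roots_of_unity: "m > 0 \<Longrightarrow> finite (roots_of_unity L m)"
  and card_roots_of_unity_le: "m > 0 \<Longrightarrow> card (roots_of_unity L m) \<le> m"
  and card_roots_of_unity: "coprime m q \<Longrightarrow> card (roots_of_unity L m) = m"
proof -
  have eq: "roots_of_unity L m = set_mset (roots (unity_poly m))" if "m > 0"
  proof -
    have "unity_poly m \<noteq> []" using degree_unity_poly[OF that] that by auto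
    then show ?thesis
      using roots_mem_iff_is_root[OF unity_poly_closed] 
      by (auto simp: roots_of_unity_def is_root_def eval_unity_poly)
  qed
  then show "m > 0 \<Longrightarrow> finite (roots_of_unity L m)" by simp
  have "card (set_mset M) \<le> size M" for M :: "'a multiset"
    by (induction M) (auto simp: card_insert_if)
  then show "m > 0 \<Longrightarrow> card (roots_of_unity L m) \<le> m"
    using size_roots_le_degree[OF unity_poly_closed, of m] eq degree_unity_poly
    by (metis order_trans)
  assume cop: "coprime m q"
  then have m: "m > 0" using q_gt_1 by (cases m) auto
  interpret UP: domain "LX"
    using univ_poly_is_domain[OF carrier_is_subring] .
  \<comment> \<open>A double root \<open>a\<close> would also annihilate the cofactor of X - a; but
    the value of that cofactor at \<open>a\<close> is m a^(m-1), which is nonzero.\<close>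
  have "count (roots (unity_poly m)) a \<le> 1" for a
  proof (rule ccontr)
    assume "\<not> ?thesis"
    then have two: "2 \<le> alg_mult (unity_poly m) a"
      using alg_mult_eq_count_roots[OF unity_poly_closed] by simp
    then have "a \<in># roots (unity_poly m)"
      using alg_mult_eq_count_roots[OF unity_poly_closed] by (metis count_greater_zero_iff gr_zeroI not_numeral_le_zero)
    then have a: "a \<in> carrier L" "a [^] m = \<one>"
      using eq[OF m] by (auto simp: roots_of_unity_def)
    define A where "A = [\<one>, \<ominus> a]"
    have A: "A \<in> carrier (LX)"
      using a unfolding A_def univ_poly_carrier[symmetric] polynomial_def by auto
    have X: "X\<^bsub>L\<^esub> \<in> carrier (LX)" using var_closed(1)[OF carrier_is_subring] .
    interpret em: ring_hom_ring L "LX" poly_of_const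
      using canonical_embedding_ring_hom[OF carrier_is_subring] by simp
    interpret ev: ring_hom_cring "LX" L "\<lambda>p. eval p a"
      using eval_cring_hom[OF carrier_is_subring a(1)] .
    note ev_pow = ring_hom_ring.hom_nat_pow[OF eval_ring_hom[OF carrier_is_subring a(1)]]
    define c where "c = poly_of_const a"
    have c: "c \<in> carrier (LX)"
      unfolding c_def using a by simp
    \<comment> \<open>Because a^m = 1, X^m - 1 equals X^m - c^m for the constant polynomial
      \<open>c\<close>, and the factorization of a difference of powers applies.\<close>
    have cm: "c [^]\<^bsub>LX\<^esub> m = \<one>\<^bsub>LX\<^esub>"
      unfolding c_def using a em.hom_nat_pow[OF a(1), of m] by simp
    have eval_c: "eval c a = a"
      using a by (simp add: c_def poly_of_const_def)
    have Ac: "A = X\<^bsub>L\<^esub> \<ominus>\<^bsub>LX\<^esub> c"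
      using univ_poly_a_inv_def'[OF carrier_is_subring c] a
      by (auto simp: c_def poly_of_const_def A_def a_minus_def univ_poly_add var_def)
    define t where "t = (\<Oplus>\<^bsub>LX\<^esub>k\<in>{..<m}. X\<^bsub>L\<^esub> [^]\<^bsub>LX\<^esub> k \<otimes>\<^bsub>LX\<^esub> c [^]\<^bsub>LX\<^esub> (m - Suc k))"
    have t: "t \<in> carrier (LX)"
      unfolding t_def using X c by (intro UP.finsum_closed) auto
    have At: "unity_poly m = A \<otimes>\<^bsub>LX\<^esub> t"
      unfolding Ac t_def unity_poly_def cm[symmetric] using UP.pow_minus_pow_factor[OF X c] .
    have "(A [^]\<^bsub>LX\<^esub> (2::nat)) pdivides unity_poly m"
      using le_alg_mult_imp_pdivides[OF a(1) unity_poly_closed two] unfolding A_def .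
    then obtain s where s: "s \<in> carrier (LX)"
        "unity_poly m = A [^]\<^bsub>LX\<^esub> (2::nat) \<otimes>\<^bsub>LX\<^esub> s"
      unfolding pdivides_def by (elim dividesE)
    have "A \<noteq> \<zero>\<^bsub>LX\<^esub>" by (simp add: A_def univ_poly_zero)
    moreover have "A \<otimes>\<^bsub>LX\<^esub> t = A \<otimes>\<^bsub>LX\<^esub> (A \<otimes>\<^bsub>LX\<^esub> s)"
      using s(2) A s(1) unfolding At by (simp add: numeral_2_eq_2 UP.m_assoc)
    ultimately have "t = A \<otimes>\<^bsub>LX\<^esub> s"
      using A s(1) t by (subst (asm) UP.m_lcancel) auto
    then have "eval t a = eval A a \<otimes> eval s a" using A s(1) by simp
    also have "eval A a = \<zero>"
      using a by (simp add: A_def r_neg)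
    finally have "eval t a = \<zero>" using ev.hom_closed[OF s(1)] by simp
    \<comment> \<open>Each of the \<open>m\<close> summands of the cofactor takes the value a^(m-1)
      at \<open>a\<close>.\<close>
    also have "eval t a = (\<Oplus>k\<in>{..<m}. a [^] (m - 1))"
      unfolding t_def using X c a 
      by (subst ev.hom_finsum)
         (auto simp: ev_pow eval_var eval_c comp_def nat_pow_mult intro!: finsum_cong')
    also have "\<dots> = [m] \<cdot> (\<one> \<otimes> a [^] (m - 1))"
      using a by (simp add: add.finprod_const)
    also have "\<dots> = ([m] \<cdot> \<one>) \<otimes> a [^] (m - 1)"
      using a by (subst add_pow_ldistr) auto
    finally have "a [^] (m - 1) = \<zero>"
      using add_pow_one_neq_zero[OF cop] a integral[of "[m] \<cdot> \<one>" "a [^] (m - 1)"] by simp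
    then have "a [^] m = \<zero>"
      using m a by (cases m) auto
    then show False using a by simp
  qed
  then have "count (roots (unity_poly m)) a = (if a \<in># roots (unity_poly m) then 1 else 0)" for a
    by (metis One_nat_def count_eq_zero_iff le_SucE le_zero_eq)
  then have "mset_set (set_mset (roots (unity_poly m))) = roots (unity_poly m)"
    by (intro multiset_eqI) (simp add: count_mset_set')
  then have "card (set_mset (roots (unity_poly m))) = size (roots (unity_poly m))"
    by (metis size_mset_set)
  then show "card (roots_of_unity L m) = m"
    using roots_over_carrier[OF unity_poly_closed] degree_unity_poly[OF m] eq[OF m]
    unfolding splitted_def by simp
qed

text \<open>One inclusion is Lagrange's theorem in the multiplicative group of \<open>K\<close>;
  equality follows because X^(q-1) - 1 has at most \<open>q - 1\<close> roots.\<close>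

lemma K_eq_roots_of_unity: "K - {\<zero>} = roots_of_unity L (q - 1)"
proof (rule card_seteq)
  interpret KF: field "KF" using subfield_iff(2)[OF subfield_axioms] .
  interpret KG: group "Multiplicative_Group.mult_of (KF)" using KF.field_mult_group .
  have o: "order (Multiplicative_Group.mult_of (KF)) = q - 1"
    using KF.order_mult_of finite_K by (simp add: order_def card_K)
  show "K - {\<zero>} \<subseteq> roots_of_unity L (q - 1)"
  proof
    fix x assume x: "x \<in> K - {\<zero>}"
    then have "x [^]\<^bsub>Multiplicative_Group.mult_of (KF)\<^esub> (q - 1) = \<one>"
      using KG.pow_order_eq_1[of x] o by simp
    then have "x [^] (q - 1) = \<one>"
      by (simp add: nat_pow_mult_of nat_pow_def)
    then show "x \<in> roots_of_unity L (q - 1)"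
      using x K_subset by (auto simp: roots_of_unity_def)
  qed
  show "finite (roots_of_unity L (q - 1))" using finite_roots_of_unity q_gt_1 by simp
  have "card (K - {\<zero>}) = q - 1"
    using card_K finite_K subringE(2)[OF subfieldE(1)[OF subfield_axioms]] by (simp add: card_Diff_singleton)
  then show "card (roots_of_unity L (q - 1)) \<le> card (K - {\<zero>})"
    using card_roots_of_unity_le q_gt_1 by simp
qed

text \<open>The fixed-point form of membership in \<open>K\<close> turns rationality of a matrix
  into the equation \<open>frob_mat B = B\<close>, which is what descent verifies.\<close>

lemma mem_K_iff: "x \<in> K \<longleftrightarrow> x \<in> carrier L \<and> x [^] q = x"
proof (cases "x \<in> carrier L")
  case True
  have q: "x [^] q = x [^] (q - 1) \<otimes> x"
    using nat_pow_Suc[of x "q - 1"] q_gt_1 by simp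
  show ?thesis
  proof (cases "x = \<zero>")
    case True
    then show ?thesis using subringE(2)[OF subfieldE(1)[OF subfield_axioms]] frob_zero by simp
  next
    case False
    have "\<one> \<in> carrier L" by simp
    with False have "x [^] q = x \<longleftrightarrow> x [^] (q - 1) = \<one>"
      unfolding q using True m_rcancel[of x "x [^] (q - 1)" "\<one>"] by simp
    also have "\<dots> \<longleftrightarrow> x \<in> K - {\<zero>}"
      unfolding K_eq_roots_of_unity using True by (simp add: roots_of_unity_def)
    finally show ?thesis using True False by simp
  qed
qed (use K_subset in auto)

text \<open>X^(q^d - 1) - 1 has \<open>q ^ d - 1\<close> roots in \<open>L\<close>, but X^(q-1) - 1
  has at most \<open>q - 1\<close>. For \<open>d\<close> equal to 2 or 3 the resulting element
  outside \<open>K\<close> supplies the entries of the matrices that realize the non-split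
  types.\<close>

lemma ex_generic_element:
  assumes "d > 1"
  obtains t where "t \<in> carrier L" "t [^] (q ^ d) = t" "t [^] q \<noteq> t" "t \<noteq> \<zero>"
proof -
  have qd: "q ^ d > q" using q_gt_1 assms by (metis power_one_right power_strict_increasing)
  have "coprime (q ^ d - 1) (q ^ d)" using q_gt_1 by (intro coprime_diff_one_left_nat) simp
  then have "coprime (q ^ d - 1) q"
    using assms q_gt_1 by (subst (asm) coprime_power_right_iff) simp
  then have "card (roots_of_unity L (q ^ d - 1)) = q ^ d - 1"
    by (rule card_roots_of_unity)
  moreover have "card (roots_of_unity L (q - 1)) \<le> q - 1"
    using card_roots_of_unity_le q_gt_1 by simp
  ultimately have "card (roots_of_unity L (q - 1)) < card (roots_of_unity L (q ^ d - 1))"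
    using qd q_gt_1 by simp
  then have "\<not> roots_of_unity L (q ^ d - 1) \<subseteq> roots_of_unity L (q - 1)"
    using card_mono[OF finite_roots_of_unity] q_gt_1 by (metis leD zero_less_diff)
  then obtain t where t: "t \<in> roots_of_unity L (q ^ d - 1)" "t \<notin> roots_of_unity L (q - 1)" by auto
  then have tc: "t \<in> carrier L" by (simp add: roots_of_unity_def)
  have nz: "t \<noteq> \<zero>" using t qd q_gt_1 by (auto simp: roots_of_unity_def nat_pow_zero)
  have "t [^] (q ^ d) = t [^] (q ^ d - 1) \<otimes> t"
    using nat_pow_Suc[of t "q ^ d - 1"] qd q_gt_1 by simp
  then have "t [^] (q ^ d) = t" using t by (simp add: roots_of_unity_def)
  moreover have "t [^] q \<noteq> t"
    using t(2) tc nz mem_K_iff[of t] unfolding K_eq_roots_of_unity[symmetric] by auto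
  ultimately show ?thesis using that tc nz by blast
qed

end

section \<open>Matrices of size two and three\<close>

lemma mat_carrier:
  "A \<in> carrier (mat_monoid R n) \<longleftrightarrow>
    A \<in> carrier_mat n n \<and> (\<forall>i<n. \<forall>j<n. A $$ (i, j) \<in> carrier R)"
  by (simp add: mat_monoid_def)

lemma mat_entry:
  "A \<in> carrier (mat_monoid R n) \<Longrightarrow> i < n \<Longrightarrow> j < n \<Longrightarrow> A $$ (i, j) \<in> carrier R"
  by (simp add: mat_monoid_def)

lemma mat_eqI:
  assumes "A \<in> carrier (mat_monoid R n)" "B \<in> carrier (mat_monoid R n)"
    and "\<And>i j. i < n \<Longrightarrow> j < n \<Longrightarrow> A $$ (i, j) = B $$ (i, j)"
  shows "A = B"
  using assms by (intro eq_matI) (auto simp: mat_monoid_def)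

lemma mat_mult_entry:
  "i < n \<Longrightarrow> j < n \<Longrightarrow>
    (A \<otimes>\<^bsub>mat_monoid R n\<^esub> B) $$ (i, j) = (\<Oplus>\<^bsub>R\<^esub>k\<in>{..<n}. A $$ (i, k) \<otimes>\<^bsub>R\<^esub> B $$ (k, j))"
  by (simp add: mat_monoid_def)

lemma mat_one_entry:
  "i < n \<Longrightarrow> j < n \<Longrightarrow> \<one>\<^bsub>mat_monoid R n\<^esub> $$ (i, j) = (if i = j then \<one>\<^bsub>R\<^esub> else \<zero>\<^bsub>R\<^esub>)"
  by (simp add: mat_monoid_def)

context cring
begin

abbreviation Mat where "Mat n \<equiv> mat_monoid R n"

lemma mat_mult_closed:
  assumes "A \<in> carrier (Mat n)" "B \<in> carrier (Mat n)"
  shows "A \<otimes>\<^bsub>Mat n\<^esub> B \<in> carrier (Mat n)"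
proof -
  have "A \<otimes>\<^bsub>Mat n\<^esub> B \<in> carrier_mat n n" by (simp add: mat_monoid_def)
  then show ?thesis unfolding mat_carrier
    using assms by (auto simp: mat_mult_entry mat_entry intro!: finsum_closed)
qed

lemma monoid_mat_monoid: "monoid (Mat n)"
proof (rule monoidI)
  show one: "\<one>\<^bsub>Mat n\<^esub> \<in> carrier (Mat n)" by (simp add: mat_monoid_def)
  fix A B C assume A: "A \<in> carrier (Mat n)" and B: "B \<in> carrier (Mat n)"
    and C: "C \<in> carrier (Mat n)"
  note closed = mat_mult_closed
  show "A \<otimes>\<^bsub>Mat n\<^esub> B \<in> carrier (Mat n)" by (rule closed[OF A B])
  show "A \<otimes>\<^bsub>Mat n\<^esub> B \<otimes>\<^bsub>Mat n\<^esub> C =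
        A \<otimes>\<^bsub>Mat n\<^esub> (B \<otimes>\<^bsub>Mat n\<^esub> C)"
  proof (rule mat_eqI[OF closed[OF closed[OF A B] C] closed[OF A closed[OF B C]]])
    fix i j assume ij: "i < n" "j < n"
    note en = mat_entry[OF A] mat_entry[OF B] mat_entry[OF C]
    have "(\<Oplus>k\<in>{..<n}. (\<Oplus>l\<in>{..<n}. A $$ (i, l) \<otimes> B $$ (l, k)) \<otimes> C $$ (k, j))
        = (\<Oplus>k\<in>{..<n}. \<Oplus>l\<in>{..<n}. A $$ (i, l) \<otimes> (B $$ (l, k) \<otimes> C $$ (k, j)))"
      using en ij by (auto simp: finsum_ldistr m_assoc intro!: finsum_cong' finsum_closed)
    also have "\<dots> = (\<Oplus>l\<in>{..<n}. \<Oplus>k\<in>{..<n}. A $$ (i, l) \<otimes> (B $$ (l, k) \<otimes> C $$ (k, j)))"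
      using en ij by (intro finsum_finsum_swap) auto
    also have "\<dots> = (\<Oplus>l\<in>{..<n}. A $$ (i, l) \<otimes> (\<Oplus>k\<in>{..<n}. B $$ (l, k) \<otimes> C $$ (k, j)))"
      using en ij by (auto simp: finsum_rdistr intro!: finsum_cong' finsum_closed)
    finally show "(A \<otimes>\<^bsub>Mat n\<^esub> B \<otimes>\<^bsub>Mat n\<^esub> C) $$ (i, j) =
        (A \<otimes>\<^bsub>Mat n\<^esub> (B \<otimes>\<^bsub>Mat n\<^esub> C)) $$ (i, j)"
      using ij en by (simp add: mat_mult_entry cong: finsum_cong)
  qed
  have delta: "(\<Oplus>k\<in>{..<n}. (if i = k then \<one> else \<zero>) \<otimes> f k) = f i"
      "(\<Oplus>k\<in>{..<n}. f k \<otimes> (if k = i then \<one> else \<zero>)) = f i"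
    if "i < n" "f \<in> {..<n} \<rightarrow> carrier R" for i f
  proof -
    have "(\<Oplus>k\<in>{..<n}. (if i = k then \<one> else \<zero>) \<otimes> f k) = (\<Oplus>k\<in>{..<n}. if i = k then f k else \<zero>)"
      "(\<Oplus>k\<in>{..<n}. f k \<otimes> (if k = i then \<one> else \<zero>)) = (\<Oplus>k\<in>{..<n}. if i = k then f k else \<zero>)"
      using that by (auto simp: Pi_def intro!: finsum_cong')
    then show "(\<Oplus>k\<in>{..<n}. (if i = k then \<one> else \<zero>) \<otimes> f k) = f i"
      "(\<Oplus>k\<in>{..<n}. f k \<otimes> (if k = i then \<one> else \<zero>)) = f i"
      using that add.finprod_singleton[of i "{..<n}" f] by auto
  qed
  show "\<one>\<^bsub>Mat n\<^esub> \<otimes>\<^bsub>Mat n\<^esub> A = A"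
  proof (rule mat_eqI[OF closed[OF one A] A])
    fix i j assume ij: "i < n" "j < n"
    have "(\<one>\<^bsub>Mat n\<^esub> \<otimes>\<^bsub>Mat n\<^esub> A) $$ (i, j) =
        (\<Oplus>k\<in>{..<n}. (if i = k then \<one> else \<zero>) \<otimes> A $$ (k, j))"
      using ij mat_entry[OF A]
      by (auto simp: mat_mult_entry mat_one_entry intro!: finsum_cong')
    also have "\<dots> = A $$ (i, j)" by (rule delta) (use ij mat_entry[OF A] in auto)
    finally show "(\<one>\<^bsub>Mat n\<^esub> \<otimes>\<^bsub>Mat n\<^esub> A) $$ (i, j) = A $$ (i, j)" .
  qed
  show "A \<otimes>\<^bsub>Mat n\<^esub> \<one>\<^bsub>Mat n\<^esub> = A"
  proof (rule mat_eqI[OF closed[OF A one] A])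
    fix i j assume ij: "i < n" "j < n"
    have "(A \<otimes>\<^bsub>Mat n\<^esub> \<one>\<^bsub>Mat n\<^esub>) $$ (i, j) =
        (\<Oplus>k\<in>{..<n}. A $$ (i, k) \<otimes> (if k = j then \<one> else \<zero>))"
      using ij mat_entry[OF A]
      by (auto simp: mat_mult_entry mat_one_entry intro!: finsum_cong')
    also have "\<dots> = A $$ (i, j)" by (rule delta) (use ij mat_entry[OF A] in auto)
    finally show "(A \<otimes>\<^bsub>Mat n\<^esub> \<one>\<^bsub>Mat n\<^esub>) $$ (i, j) = A $$ (i, j)" .
  qed
qed

end

section \<open>Diagonal and permutation matrices\<close>

definition diag_matrix :: "('a, 'b) ring_scheme \<Rightarrow> nat \<Rightarrow> (nat \<Rightarrow> 'a) \<Rightarrow> 'a mat" where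
  "diag_matrix R n d = mat n n (\<lambda>(i, j). if i = j then d i else \<zero>\<^bsub>R\<^esub>)"

text \<open>With this convention left multiplication puts row \<open>p i\<close> in place
  \<open>i\<close>, and conjugation turns the diagonal \<open>d\<close> into
  \<open>\<lambda>i. d (p i)\<close>.\<close>

definition perm_matrix :: "('a, 'b) ring_scheme \<Rightarrow> nat \<Rightarrow> (nat \<Rightarrow> nat) \<Rightarrow> 'a mat" where
  "perm_matrix R n p = mat n n (\<lambda>(i, j). if j = p i then \<one>\<^bsub>R\<^esub> else \<zero>\<^bsub>R\<^esub>)"

lemma diag_matrix_entry:
  "i < n \<Longrightarrow> j < n \<Longrightarrow> diag_matrix R n d $$ (i, j) = (if i = j then d i else \<zero>\<^bsub>R\<^esub>)"
  by (simp add: diag_matrix_def)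

lemma perm_matrix_entry:
  "i < n \<Longrightarrow> j < n \<Longrightarrow> perm_matrix R n p $$ (i, j) = (if j = p i then \<one>\<^bsub>R\<^esub> else \<zero>\<^bsub>R\<^esub>)"
  by (simp add: perm_matrix_def)

lemma is_diagonal_diag_matrix: "is_diagonal R n (diag_matrix R n d)"
  by (simp add: is_diagonal_def diag_matrix_entry)

lemma (in ring) diag_matrix_closed:
  "(\<And>i. i < n \<Longrightarrow> d i \<in> carrier R) \<Longrightarrow> diag_matrix R n d \<in> carrier (mat_monoid R n)"
  by (auto simp: mat_carrier diag_matrix_def)

lemma (in ring) perm_matrix_closed: "perm_matrix R n p \<in> carrier (mat_monoid R n)"
  by (auto simp: mat_carrier perm_matrix_def)

context cring
begin

lemma finsum_delta:
  assumes "finite A" "i \<in> A" "f \<in> A \<rightarrow> carrier R" "\<And>k. k \<in> A \<Longrightarrow> k \<noteq> i \<Longrightarrow> f k = \<zero>"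
  shows "finsum R f A = f i"
proof -
  have "finsum R f A = (\<Oplus>k\<in>A. if i = k then f k else \<zero>)"
    using assms by (intro finsum_cong') auto
  then show ?thesis using assms add.finprod_singleton[of i A f] by simp
qed

lemma mult_diag_matrix_entry:
  assumes "A \<in> carrier (Mat n)" "\<And>i. i < n \<Longrightarrow> d i \<in> carrier R" "i < n" "j < n"
  shows "(A \<otimes>\<^bsub>Mat n\<^esub> diag_matrix R n d) $$ (i, j) = A $$ (i, j) \<otimes> d j"
  unfolding mat_mult_entry[OF assms(3,4)]
  by (subst finsum_delta[where i = j])
     (use assms mat_entry[OF assms(1)] in \<open>auto simp: diag_matrix_entry\<close>)

lemma diag_matrix_mult_entry:
  assumes "A \<in> carrier (Mat n)" "\<And>i. i < n \<Longrightarrow> d i \<in> carrier R" "i < n" "j < n"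
  shows "(diag_matrix R n d \<otimes>\<^bsub>Mat n\<^esub> A) $$ (i, j) = d i \<otimes> A $$ (i, j)"
  unfolding mat_mult_entry[OF assms(3,4)]
  by (subst finsum_delta[where i = i])
     (use assms mat_entry[OF assms(1)] in \<open>auto simp: diag_matrix_entry\<close>)

lemma perm_matrix_mult_entry:
  assumes "A \<in> carrier (Mat n)" "p permutes {..<n}" "i < n" "j < n"
  shows "(perm_matrix R n p \<otimes>\<^bsub>Mat n\<^esub> A) $$ (i, j) = A $$ (p i, j)"
proof -
  have "p i < n" using assms(2,3) permutes_in_image[of p "{..<n}"] by auto
  then show ?thesis
    unfolding mat_mult_entry[OF assms(3,4)]
    by (subst finsum_delta[where i = "p i"])
       (use assms mat_entry[OF assms(1)] in \<open>auto simp: perm_matrix_entry\<close>)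
qed

lemma diag_matrix_mult:
  assumes "\<And>i. i < n \<Longrightarrow> d i \<in> carrier R" "\<And>i. i < n \<Longrightarrow> e i \<in> carrier R"
  shows "diag_matrix R n d \<otimes>\<^bsub>Mat n\<^esub> diag_matrix R n e = diag_matrix R n (\<lambda>i. d i \<otimes> e i)"
  by (rule mat_eqI[of _ R n])
     (use assms in \<open>auto simp: diag_matrix_mult_entry diag_matrix_closed mat_mult_closed diag_matrix_entry\<close>)

lemma diag_matrix_one: "\<one>\<^bsub>Mat n\<^esub> = diag_matrix R n (\<lambda>_. \<one>)"
  by (simp add: mat_monoid_def diag_matrix_def)

lemma perm_matrix_Units:
  assumes "p permutes {..<n}"
  shows "perm_matrix R n p \<in> Units (Mat n)"
proof -
  have *: "perm_matrix R n p \<otimes>\<^bsub>Mat n\<^esub> perm_matrix R n p' = \<one>\<^bsub>Mat n\<^esub>"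
    if "p permutes {..<n}" "p' = inv_into UNIV p" for p p'
  proof (rule mat_eqI[of _ R n])
    fix i j assume "i < n" "j < n"
    moreover have "p i < n" using that \<open>i < n\<close> permutes_in_image[of p "{..<n}"] by auto
    ultimately show "(perm_matrix R n p \<otimes>\<^bsub>Mat n\<^esub> perm_matrix R n p') $$ (i, j) = \<one>\<^bsub>Mat n\<^esub> $$ (i, j)"
      using that by (auto simp: perm_matrix_mult_entry perm_matrix_closed perm_matrix_entry
          mat_one_entry permutes_inverses)
  qed (auto simp: perm_matrix_closed mat_mult_closed monoid.one_closed[OF monoid_mat_monoid])
  have "perm_matrix R n (inv_into UNIV p) \<otimes>\<^bsub>Mat n\<^esub> perm_matrix R n p = \<one>\<^bsub>Mat n\<^esub>"
    using assms by (intro *) (auto simp: permutes_inv permutes_inv_inv)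
  then show ?thesis using *[OF assms refl] perm_matrix_closed unfolding Units_def by blast
qed

lemma perm_matrix_diag_matrix:
  assumes "p permutes {..<n}" "\<And>i. i < n \<Longrightarrow> d i \<in> carrier R"
  shows "perm_matrix R n p \<otimes>\<^bsub>Mat n\<^esub> diag_matrix R n d
    = diag_matrix R n (\<lambda>i. d (p i)) \<otimes>\<^bsub>Mat n\<^esub> perm_matrix R n p"
proof (rule mat_eqI[of _ R n])
  have pin: "p i < n" if "i < n" for i using assms that permutes_in_image[of p "{..<n}"] by auto
  show "perm_matrix R n p \<otimes>\<^bsub>Mat n\<^esub> diag_matrix R n d \<in> carrier (Mat n)"
    "diag_matrix R n (\<lambda>i. d (p i)) \<otimes>\<^bsub>Mat n\<^esub> perm_matrix R n p \<in> carrier (Mat n)"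
    using assms pin by (auto intro!: mat_mult_closed perm_matrix_closed diag_matrix_closed)
  fix i j assume "i < n" "j < n"
  then show "(perm_matrix R n p \<otimes>\<^bsub>Mat n\<^esub> diag_matrix R n d) $$ (i, j)
    = (diag_matrix R n (\<lambda>i. d (p i)) \<otimes>\<^bsub>Mat n\<^esub> perm_matrix R n p) $$ (i, j)"
    using assms pin by (subst mult_diag_matrix_entry, simp_all add: perm_matrix_closed,
      subst diag_matrix_mult_entry) (auto simp: perm_matrix_closed perm_matrix_entry)
qed

lemma finsum_lessThan_2:
  "f \<in> {..<2} \<rightarrow> carrier R \<Longrightarrow> finsum R f {..<2::nat} = f 0 \<oplus> f 1"
  by (simp add: numeral_2_eq_2 lessThan_Suc a_comm Pi_def)

lemma finsum_lessThan_3: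
  "f \<in> {..<3} \<rightarrow> carrier R \<Longrightarrow> finsum R f {..<3::nat} = f 0 \<oplus> f 1 \<oplus> f 2"
  by (simp add: numeral_3_eq_3 numeral_2_eq_2 lessThan_Suc a_comm a_ac Pi_def)

lemma finprod_lessThan_2:
  "f \<in> {..<2} \<rightarrow> carrier R \<Longrightarrow> finprod R f {..<2::nat} = f 0 \<otimes> f 1"
  by (simp add: numeral_2_eq_2 lessThan_Suc m_comm Pi_def)

lemma finprod_lessThan_3:
  "f \<in> {..<3} \<rightarrow> carrier R \<Longrightarrow> finprod R f {..<3::nat} = f 0 \<otimes> f 1 \<otimes> f 2"
  by (simp add: numeral_3_eq_3 numeral_2_eq_2 lessThan_Suc m_comm m_ac Pi_def)

end

section \<open>Determinants, conjugation and invertibility in dimensions two and three\<close>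

lemma permutes_doubleton: "{p. p permutes {a, b}} = {id, Transposition.transpose a b}"
proof -
  have 1: "{p. p permutes {b}} = {id}" by auto
  have 2: "{(c, p). c \<in> {a, b} \<and> p \<in> {id}} = {(a, id), (b, id)}" by auto
  show ?thesis unfolding permutes_insert[of a] 1 2 by simp
qed

lemma permutes_tripleton:
  "{p. p permutes {a, b, c}} = {id, Transposition.transpose a b, Transposition.transpose a c,
    Transposition.transpose b c, Transposition.transpose a b \<circ> Transposition.transpose b c,
    Transposition.transpose a c \<circ> Transposition.transpose b c}"
proof -
  have "{(d, p). d \<in> {a, b, c} \<and> p \<in> {id, Transposition.transpose b c}} =
    {(a, id), (b, id), (c, id), (a, Transposition.transpose b c),
     (b, Transposition.transpose b c), (c, Transposition.transpose b c)}" by auto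
  then show ?thesis by (subst permutes_insert) (simp only: permutes_doubleton, auto)
qed

context cring
begin

lemma mat_det_2:
  assumes "A \<in> carrier (mat_monoid R 2)"
  shows "mat_det R 2 A = A $$ (0, 0) \<otimes> A $$ (1, 1) \<ominus> A $$ (0, 1) \<otimes> A $$ (1, 0)"
proof -
  note [simp] = mat_entry[OF assms]
  have "id \<noteq> Transposition.transpose 0 (1::nat)"
    by (metis id_apply transpose_apply_first zero_neq_one)
  moreover have "{..<2::nat} = {0, 1}" by auto
  ultimately show ?thesis unfolding mat_det_def
    by (simp add: permutes_doubleton finprod_insert sign_swap_id add.int_pow_neg minus_eq Pi_def
        m_comm del: One_nat_def)
qed

lemma mat_det_3:
  assumes "A \<in> carrier (mat_monoid R 3)"
  shows "mat_det R 3 A =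
    A $$ (0, 0) \<otimes> A $$ (1, 1) \<otimes> A $$ (2, 2) \<oplus> A $$ (0, 1) \<otimes> A $$ (1, 2) \<otimes> A $$ (2, 0)
    \<oplus> A $$ (0, 2) \<otimes> A $$ (1, 0) \<otimes> A $$ (2, 1) \<ominus> A $$ (0, 2) \<otimes> A $$ (1, 1) \<otimes> A $$ (2, 0)
    \<ominus> A $$ (0, 1) \<otimes> A $$ (1, 0) \<otimes> A $$ (2, 2) \<ominus> A $$ (0, 0) \<otimes> A $$ (1, 2) \<otimes> A $$ (2, 1)"
proof -
  note [simp] = mat_entry[OF assms]
  let ?t = "Transposition.transpose :: nat \<Rightarrow> _"
  \<comment> \<open>The six permutations are already told apart by their values at 0 and 1.\<close>
  have neq: "f 0 \<noteq> g 0 \<or> f 1 \<noteq> g 1 \<Longrightarrow> f \<noteq> g" for f g :: "nat \<Rightarrow> nat" by auto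
  have d: "distinct [id, ?t 0 1, ?t 0 2, ?t 1 2, ?t 0 1 \<circ> ?t 1 2, ?t 0 2 \<circ> ?t 1 2]"
    unfolding distinct.simps list.set insert_iff de_Morgan_disj
    by (intro conjI neq) (simp_all add: Transposition.transpose_def)
  have s: "sign (?t 0 1 \<circ> ?t 1 2) = 1" "sign (?t 0 2 \<circ> ?t 1 2) = 1"
    by (simp_all add: sign_compose permutation_swap_id sign_swap_id)
  define f where "f p = [sign p] \<cdot> (\<Otimes>i\<in>{..<3}. A $$ (i, p i))" for p
  have f: "f id = A $$ (0, 0) \<otimes> A $$ (1, 1) \<otimes> A $$ (2, 2)"
    "f (?t 0 1) = \<ominus> (A $$ (0, 1) \<otimes> A $$ (1, 0) \<otimes> A $$ (2, 2))"
    "f (?t 0 2) = \<ominus> (A $$ (0, 2) \<otimes> A $$ (1, 1) \<otimes> A $$ (2, 0))"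
    "f (?t 1 2) = \<ominus> (A $$ (0, 0) \<otimes> A $$ (1, 2) \<otimes> A $$ (2, 1))"
    "f (?t 0 1 \<circ> ?t 1 2) = A $$ (0, 1) \<otimes> A $$ (1, 2) \<otimes> A $$ (2, 0)"
    "f (?t 0 2 \<circ> ?t 1 2) = A $$ (0, 2) \<otimes> A $$ (1, 0) \<otimes> A $$ (2, 1)"
    unfolding f_def
    by (subst finprod_lessThan_3; (force simp: Transposition.transpose_def)?;
        simp add: s sign_swap_id add.int_pow_neg Transposition.transpose_def del: One_nat_def)+
  have fc: "f id \<in> carrier R" "f (?t 0 1) \<in> carrier R" "f (?t 0 2) \<in> carrier R" "f (?t 1 2) \<in> carrier R"
     "f (?t 0 1 \<circ> ?t 1 2) \<in> carrier R" "f (?t 0 2 \<circ> ?t 1 2) \<in> carrier R"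
    unfolding f by simp_all
  have "{..<3::nat} = {0, 1, 2}" by auto
  then have "mat_det R 3 A = finsum R f (set [id, ?t 0 1, ?t 0 2, ?t 1 2, ?t 0 1 \<circ> ?t 1 2, ?t 0 2 \<circ> ?t 1 2])"
    unfolding mat_det_def f_def by (simp add: permutes_tripleton del: One_nat_def)
  also have "\<dots> = f id \<oplus> (f (?t 0 1) \<oplus> (f (?t 0 2) \<oplus> (f (?t 1 2) \<oplus> (f (?t 0 1 \<circ> ?t 1 2) \<oplus> f (?t 0 2 \<circ> ?t 1 2)))))"
    using d fc by (simp add: finsum_insert Pi_def del: One_nat_def)
  also have "\<dots> = A $$ (0, 0) \<otimes> A $$ (1, 1) \<otimes> A $$ (2, 2) \<oplus> A $$ (0, 1) \<otimes> A $$ (1, 2) \<otimes> A $$ (2, 0)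
    \<oplus> A $$ (0, 2) \<otimes> A $$ (1, 0) \<otimes> A $$ (2, 1) \<ominus> A $$ (0, 2) \<otimes> A $$ (1, 1) \<otimes> A $$ (2, 0)
    \<ominus> A $$ (0, 1) \<otimes> A $$ (1, 0) \<otimes> A $$ (2, 2) \<ominus> A $$ (0, 0) \<otimes> A $$ (1, 2) \<otimes> A $$ (2, 1)"
    unfolding f by (simp add: minus_eq a_ac)
  finally show ?thesis .
qed

lemma mat_conj_closed:
  assumes "g \<in> Units (Mat n)" "A \<in> carrier (Mat n)"
  shows "mat_conj R n g A \<in> carrier (Mat n)"
proof -
  interpret M: monoid "Mat n" by (rule monoid_mat_monoid)
  show ?thesis using assms by (simp add: mat_conj_def M.Units_closed M.m_closed)
qed

text \<open>Clears the inverse: conjugacy becomes an intertwining equation, which needs only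
  associativity and to which Frobenius can be applied.\<close>

lemma mat_conj_eq_iff:
  assumes "g \<in> Units (Mat n)" "A \<in> carrier (Mat n)" "B \<in> carrier (Mat n)"
  shows "mat_conj R n g A = B \<longleftrightarrow> g \<otimes>\<^bsub>Mat n\<^esub> A = B \<otimes>\<^bsub>Mat n\<^esub> g"
proof -
  interpret M: monoid "Mat n" by (rule monoid_mat_monoid)
  have g: "g \<in> carrier (Mat n)" "inv\<^bsub>Mat n\<^esub> g \<in> carrier (Mat n)" using assms by auto
  show ?thesis
  proof
    assume "mat_conj R n g A = B"
    then have "B \<otimes>\<^bsub>Mat n\<^esub> g = g \<otimes>\<^bsub>Mat n\<^esub> A \<otimes>\<^bsub>Mat n\<^esub> (inv\<^bsub>Mat n\<^esub> g \<otimes>\<^bsub>Mat n\<^esub> g)"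
      using assms g by (metis M.m_assoc M.m_closed mat_conj_def)
    then show "g \<otimes>\<^bsub>Mat n\<^esub> A = B \<otimes>\<^bsub>Mat n\<^esub> g"
      using assms g by (simp add: M.Units_l_inv)
  next
    assume "g \<otimes>\<^bsub>Mat n\<^esub> A = B \<otimes>\<^bsub>Mat n\<^esub> g"
    then show "mat_conj R n g A = B"
      using assms g by (simp add: mat_conj_def M.m_assoc M.Units_r_inv)
  qed
qed

lemma mat_mult_entry_2:
  assumes A: "A \<in> carrier (mat_monoid R 2)" and B: "B \<in> carrier (mat_monoid R 2)" and "i < 2" "j < 2"
  shows "(A \<otimes>\<^bsub>mat_monoid R 2\<^esub> B) $$ (i, j) = A $$ (i, 0) \<otimes> B $$ (0, j) \<oplus> A $$ (i, 1) \<otimes> B $$ (1, j)"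
  using mat_entry[OF A] mat_entry[OF B] assms(3,4)
  by (simp add: mat_mult_entry finsum_lessThan_2 Pi_def)

lemma mat_mult_entry_3:
  assumes A: "A \<in> carrier (mat_monoid R 3)" and B: "B \<in> carrier (mat_monoid R 3)" and "i < 3" "j < 3"
  shows "(A \<otimes>\<^bsub>mat_monoid R 3\<^esub> B) $$ (i, j) =
    A $$ (i, 0) \<otimes> B $$ (0, j) \<oplus> A $$ (i, 1) \<otimes> B $$ (1, j) \<oplus> A $$ (i, 2) \<otimes> B $$ (2, j)"
  using mat_entry[OF A] mat_entry[OF B] assms(3,4)
  by (simp add: mat_mult_entry finsum_lessThan_3 Pi_def)

text \<open>Once the determinants are expanded, this is a polynomial identity in 8 or 18 independent
  entries, settled by normalization.\<close>

lemma mat_det_mult: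
  assumes n: "n \<in> {2, 3}" and A: "A \<in> carrier (Mat n)" and B: "B \<in> carrier (Mat n)"
  shows "mat_det R n (A \<otimes>\<^bsub>Mat n\<^esub> B) = mat_det R n A \<otimes> mat_det R n B"
proof -
  consider "n = 2" | "n = 3" using n by blast
  then show ?thesis
  proof cases
    case 1
    have "(a \<otimes> a' \<oplus> b \<otimes> c') \<otimes> (c \<otimes> b' \<oplus> d \<otimes> d') \<ominus> (a \<otimes> b' \<oplus> b \<otimes> d') \<otimes> (c \<otimes> a' \<oplus> d \<otimes> c')
        \<ominus> (a \<otimes> d \<ominus> b \<otimes> c) \<otimes> (a' \<otimes> d' \<ominus> b' \<otimes> c') = \<zero>"
      if "a \<in> carrier R" "b \<in> carrier R" "c \<in> carrier R" "d \<in> carrier R"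
        "a' \<in> carrier R" "b' \<in> carrier R" "c' \<in> carrier R" "d' \<in> carrier R" for a b c d a' b' c' d'
      by (rule eq_zero_by_normalization[of "[a, b, c, d, a', b', c', d']"], simp add: in_carrier_def that,
          (rule Ipolex_intros)+, code_simp)
    then show ?thesis
      using mat_entry[OF A] mat_entry[OF B] A B mat_mult_closed[OF A B]
      unfolding 1 by (simp add: mat_det_2 mat_mult_entry_2 eq_diff0 del: One_nat_def)
  next
    case 2
    have *: "(a\<otimes>a'\<oplus>b\<otimes>d'\<oplus>c\<otimes>g') \<otimes> (d\<otimes>b'\<oplus>e\<otimes>e'\<oplus>f\<otimes>h') \<otimes> (g\<otimes>c'\<oplus>h\<otimes>f'\<oplus>i\<otimes>i')
        \<oplus> (a\<otimes>b'\<oplus>b\<otimes>e'\<oplus>c\<otimes>h') \<otimes> (d\<otimes>c'\<oplus>e\<otimes>f'\<oplus>f\<otimes>i') \<otimes> (g\<otimes>a'\<oplus>h\<otimes>d'\<oplus>i\<otimes>g')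
        \<oplus> (a\<otimes>c'\<oplus>b\<otimes>f'\<oplus>c\<otimes>i') \<otimes> (d\<otimes>a'\<oplus>e\<otimes>d'\<oplus>f\<otimes>g') \<otimes> (g\<otimes>b'\<oplus>h\<otimes>e'\<oplus>i\<otimes>h')
        \<ominus> (a\<otimes>c'\<oplus>b\<otimes>f'\<oplus>c\<otimes>i') \<otimes> (d\<otimes>b'\<oplus>e\<otimes>e'\<oplus>f\<otimes>h') \<otimes> (g\<otimes>a'\<oplus>h\<otimes>d'\<oplus>i\<otimes>g')
        \<ominus> (a\<otimes>b'\<oplus>b\<otimes>e'\<oplus>c\<otimes>h') \<otimes> (d\<otimes>a'\<oplus>e\<otimes>d'\<oplus>f\<otimes>g') \<otimes> (g\<otimes>c'\<oplus>h\<otimes>f'\<oplus>i\<otimes>i')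
        \<ominus> (a\<otimes>a'\<oplus>b\<otimes>d'\<oplus>c\<otimes>g') \<otimes> (d\<otimes>c'\<oplus>e\<otimes>f'\<oplus>f\<otimes>i') \<otimes> (g\<otimes>b'\<oplus>h\<otimes>e'\<oplus>i\<otimes>h')
        \<ominus> (a\<otimes>e\<otimes>i \<oplus> b\<otimes>f\<otimes>g \<oplus> c\<otimes>d\<otimes>h \<ominus> c\<otimes>e\<otimes>g \<ominus> b\<otimes>d\<otimes>i \<ominus> a\<otimes>f\<otimes>h)
        \<otimes> (a'\<otimes>e'\<otimes>i' \<oplus> b'\<otimes>f'\<otimes>g' \<oplus> c'\<otimes>d'\<otimes>h' \<ominus> c'\<otimes>e'\<otimes>g' \<ominus> b'\<otimes>d'\<otimes>i' \<ominus> a'\<otimes>f'\<otimes>h')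
        = \<zero>"
      if "a \<in> carrier R" "b \<in> carrier R" "c \<in> carrier R" "d \<in> carrier R" "e \<in> carrier R"
        "f \<in> carrier R" "g \<in> carrier R" "h \<in> carrier R" "i \<in> carrier R"
        "a' \<in> carrier R" "b' \<in> carrier R" "c' \<in> carrier R" "d' \<in> carrier R" "e' \<in> carrier R"
        "f' \<in> carrier R" "g' \<in> carrier R" "h' \<in> carrier R" "i' \<in> carrier R"
      for a b c d e f g h i a' b' c' d' e' f' g' h' i'
      by (rule eq_zero_by_normalization[of "[a, b, c, d, e, f, g, h, i, a', b', c', d', e', f', g', h', i']"], simp add: in_carrier_def that,
          (rule Ipolex_intros)+, code_simp)
    show ?thesis
      using mat_entry[OF A] mat_entry[OF B] A B mat_mult_closed[OF A B]
      unfolding 2 by (subst eq_diff0[symmetric])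
        (simp_all add: mat_det_3 mat_mult_entry_3 * del: One_nat_def)
  qed
qed

lemma mat_det_closed:
  assumes n: "n \<in> {2, 3}" and A: "A \<in> carrier (Mat n)"
  shows "mat_det R n A \<in> carrier R"
  using assms mat_entry[OF A] by (auto simp: mat_det_2 mat_det_3)

lemma mat_det_diag_matrix:
  assumes n: "n \<in> {2, 3}" and "\<And>i. i < n \<Longrightarrow> d i \<in> carrier R"
  shows "mat_det R n (diag_matrix R n d) = (\<Otimes>i\<in>{..<n}. d i)"
  using assms by (auto simp: mat_det_2 mat_det_3 diag_matrix_closed diag_matrix_entry
      finprod_lessThan_2 finprod_lessThan_3 Pi_def minus_eq)

lemma mat_det_conj:
  assumes n: "n \<in> {2, 3}" and g: "g \<in> Units (Mat n)" and A: "A \<in> carrier (Mat n)"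
  shows "mat_det R n (mat_conj R n g A) = mat_det R n A"
proof -
  interpret M: monoid "Mat n" by (rule monoid_mat_monoid)
  have c: "g \<in> carrier (Mat n)" "inv\<^bsub>Mat n\<^esub> g \<in> carrier (Mat n)" using g by auto
  have "mat_det R n g \<otimes> mat_det R n (inv\<^bsub>Mat n\<^esub> g) = mat_det R n \<one>\<^bsub>Mat n\<^esub>"
    using mat_det_mult[OF n c] g by (simp add: M.Units_r_inv)
  also have "\<dots> = \<one>" using n by (simp add: diag_matrix_one mat_det_diag_matrix)
  finally have *: "mat_det R n g \<otimes> mat_det R n (inv\<^bsub>Mat n\<^esub> g) = \<one>" .
  show ?thesis
    using n A c mat_det_closed[OF n] by (simp add: mat_conj_def mat_det_mult * m_ac)
qed

end

context field
begin

text \<open>Cramer's rule: \<open>A\<close> times its adjugate \<open>C\<close> is the scalar matrix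
  of the determinant, which is then divided out.\<close>

lemma mat_right_inverse_if_det:
  assumes n: "n \<in> {2, 3}" and A: "A \<in> carrier (Mat n)" and det: "mat_det R n A \<noteq> \<zero>"
  shows "\<exists>B\<in>carrier (Mat n). A \<otimes>\<^bsub>Mat n\<^esub> B = \<one>\<^bsub>Mat n\<^esub>"
proof -
  note en [simp] = mat_entry[OF A]
  consider "n = 2" | "n = 3" using n by blast
  then obtain C where "C \<in> carrier (Mat n)"
    "A \<otimes>\<^bsub>Mat n\<^esub> C = diag_matrix R n (\<lambda>_. mat_det R n A)"
  proof cases
    case 1
    have A2: "A \<in> carrier (mat_monoid R 2)" using A 1 by simp
    have less2: "i < 2 \<longleftrightarrow> i = 0 \<or> i = 1" for i :: nat by auto
    define C where "C = mat 2 2 (\<lambda>(i, j).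
      [[A $$ (1, 1), \<ominus> A $$ (0, 1)], [\<ominus> A $$ (1, 0), A $$ (0, 0)]] ! i ! j)"
    have Ce: "C $$ (0, 0) = A $$ (1, 1)" "C $$ (0, 1) = \<ominus> A $$ (0, 1)"
      "C $$ (1, 0) = \<ominus> A $$ (1, 0)" "C $$ (1, 1) = A $$ (0, 0)"
      by (simp_all add: C_def)
    have "C \<in> carrier_mat 2 2" by (simp add: C_def)
    then have C: "C \<in> carrier (mat_monoid R 2)"
      using 1 by (auto simp: Ce mat_carrier less2 simp del: One_nat_def)
    have dc: "diag_matrix R 2 (\<lambda>_. mat_det R 2 A) \<in> carrier (mat_monoid R 2)"
      by (intro diag_matrix_closed mat_det_closed A2) simp
    have "A \<otimes>\<^bsub>mat_monoid R 2\<^esub> C = diag_matrix R 2 (\<lambda>_. mat_det R 2 A)"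
      by (rule mat_eqI[OF mat_mult_closed[OF A2 C] dc])
        (use 1 in \<open>auto simp: mat_mult_entry_2[OF A2 C] Ce diag_matrix_entry mat_det_2[OF A2]
            less2 r_minus l_minus minus_eq m_comm a_comm r_neg l_neg simp del: One_nat_def\<close>)
    then show ?thesis using that C 1 by blast
  next
    case 2
    have A3: "A \<in> carrier (mat_monoid R 3)" using A 2 by simp
    \<comment> \<open>The adjugate. Taking indices cyclically modulo 3 builds the cofactor signs
      into the minors, and \<open>j\<close> stands in the row position because of the
      transposition.\<close>
    define C where "C = mat 3 3 (\<lambda>(i, j).
      A $$ ((j + 1) mod 3, (i + 1) mod 3) \<otimes> A $$ ((j + 2) mod 3, (i + 2) mod 3) \<ominus>
      A $$ ((j + 1) mod 3, (i + 2) mod 3) \<otimes> A $$ ((j + 2) mod 3, (i + 1) mod 3))"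
    have less3: "i < 3 \<longleftrightarrow> i = 0 \<or> i = 1 \<or> i = 2" for i :: nat by auto
    have Ce: "C $$ (0, 0) = A $$ (1, 1) \<otimes> A $$ (2, 2) \<ominus> A $$ (1, 2) \<otimes> A $$ (2, 1)"
      "C $$ (0, 1) = A $$ (0, 2) \<otimes> A $$ (2, 1) \<ominus> A $$ (0, 1) \<otimes> A $$ (2, 2)"
      "C $$ (0, 2) = A $$ (0, 1) \<otimes> A $$ (1, 2) \<ominus> A $$ (0, 2) \<otimes> A $$ (1, 1)"
      "C $$ (1, 0) = A $$ (1, 2) \<otimes> A $$ (2, 0) \<ominus> A $$ (1, 0) \<otimes> A $$ (2, 2)"
      "C $$ (1, 1) = A $$ (0, 0) \<otimes> A $$ (2, 2) \<ominus> A $$ (0, 2) \<otimes> A $$ (2, 0)"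
      "C $$ (1, 2) = A $$ (0, 2) \<otimes> A $$ (1, 0) \<ominus> A $$ (0, 0) \<otimes> A $$ (1, 2)"
      "C $$ (2, 0) = A $$ (1, 0) \<otimes> A $$ (2, 1) \<ominus> A $$ (1, 1) \<otimes> A $$ (2, 0)"
      "C $$ (2, 1) = A $$ (0, 1) \<otimes> A $$ (2, 0) \<ominus> A $$ (0, 0) \<otimes> A $$ (2, 1)"
      "C $$ (2, 2) = A $$ (0, 0) \<otimes> A $$ (1, 1) \<ominus> A $$ (0, 1) \<otimes> A $$ (1, 0)"
      using 2 by (simp_all add: C_def numeral_2_eq_2 m_comm)
    have "C \<in> carrier_mat 3 3" by (simp add: C_def)
    then have C: "C \<in> carrier (mat_monoid R 3)"
      using 2 by (auto simp: Ce mat_carrier less3 simp del: One_nat_def)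
    have dc: "diag_matrix R 3 (\<lambda>_. mat_det R 3 A) \<in> carrier (mat_monoid R 3)"
      by (intro diag_matrix_closed mat_det_closed A3) simp
    \<comment> \<open>The nine entries of the difference between \<open>A\<close> times
      \<open>C\<close> and the scalar matrix. Off the diagonal the subtraction of zero is kept, so
      that all nine have the shape of the goal below.\<close>
    have ids: "a \<otimes> (e \<otimes> i \<ominus> f \<otimes> h) \<oplus> b \<otimes> (f \<otimes> g \<ominus> d \<otimes> i) \<oplus> c \<otimes> (d \<otimes> h \<ominus> e \<otimes> g) \<ominus> (a \<otimes> e \<otimes> i \<oplus> b \<otimes> f \<otimes> g \<oplus> c \<otimes> d \<otimes> h \<ominus> c \<otimes> e \<otimes> g \<ominus> b \<otimes> d \<otimes> i \<ominus> a \<otimes> f \<otimes> h) = \<zero>"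
      "a \<otimes> (c \<otimes> h \<ominus> b \<otimes> i) \<oplus> b \<otimes> (a \<otimes> i \<ominus> c \<otimes> g) \<oplus> c \<otimes> (b \<otimes> g \<ominus> a \<otimes> h) \<ominus> \<zero> = \<zero>"
      "a \<otimes> (b \<otimes> f \<ominus> c \<otimes> e) \<oplus> b \<otimes> (c \<otimes> d \<ominus> a \<otimes> f) \<oplus> c \<otimes> (a \<otimes> e \<ominus> b \<otimes> d) \<ominus> \<zero> = \<zero>"
      "d \<otimes> (e \<otimes> i \<ominus> f \<otimes> h) \<oplus> e \<otimes> (f \<otimes> g \<ominus> d \<otimes> i) \<oplus> f \<otimes> (d \<otimes> h \<ominus> e \<otimes> g) \<ominus> \<zero> = \<zero>"
      "d \<otimes> (c \<otimes> h \<ominus> b \<otimes> i) \<oplus> e \<otimes> (a \<otimes> i \<ominus> c \<otimes> g) \<oplus> f \<otimes> (b \<otimes> g \<ominus> a \<otimes> h) \<ominus> (a \<otimes> e \<otimes> i \<oplus> b \<otimes> f \<otimes> g \<oplus> c \<otimes> d \<otimes> h \<ominus> c \<otimes> e \<otimes> g \<ominus> b \<otimes> d \<otimes> i \<ominus> a \<otimes> f \<otimes> h) = \<zero>"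
      "d \<otimes> (b \<otimes> f \<ominus> c \<otimes> e) \<oplus> e \<otimes> (c \<otimes> d \<ominus> a \<otimes> f) \<oplus> f \<otimes> (a \<otimes> e \<ominus> b \<otimes> d) \<ominus> \<zero> = \<zero>"
      "g \<otimes> (e \<otimes> i \<ominus> f \<otimes> h) \<oplus> h \<otimes> (f \<otimes> g \<ominus> d \<otimes> i) \<oplus> i \<otimes> (d \<otimes> h \<ominus> e \<otimes> g) \<ominus> \<zero> = \<zero>"
      "g \<otimes> (c \<otimes> h \<ominus> b \<otimes> i) \<oplus> h \<otimes> (a \<otimes> i \<ominus> c \<otimes> g) \<oplus> i \<otimes> (b \<otimes> g \<ominus> a \<otimes> h) \<ominus> \<zero> = \<zero>"
      "g \<otimes> (b \<otimes> f \<ominus> c \<otimes> e) \<oplus> h \<otimes> (c \<otimes> d \<ominus> a \<otimes> f) \<oplus> i \<otimes> (a \<otimes> e \<ominus> b \<otimes> d) \<ominus> (a \<otimes> e \<otimes> i \<oplus> b \<otimes> f \<otimes> g \<oplus> c \<otimes> d \<otimes> h \<ominus> c \<otimes> e \<otimes> g \<ominus> b \<otimes> d \<otimes> i \<ominus> a \<otimes> f \<otimes> h) = \<zero>"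
      if "a \<in> carrier R" "b \<in> carrier R" "c \<in> carrier R" "d \<in> carrier R" "e \<in> carrier R"
        "f \<in> carrier R" "g \<in> carrier R" "h \<in> carrier R" "i \<in> carrier R"
      for a b c d e f g h i
      by (rule eq_zero_by_normalization[of "[a, b, c, d, e, f, g, h, i]"], simp add: in_carrier_def that,
          (rule Ipolex_intros)+, code_simp)+
    have "A \<otimes>\<^bsub>mat_monoid R 3\<^esub> C = diag_matrix R 3 (\<lambda>_. mat_det R 3 A)"
    proof (rule mat_eqI[OF mat_mult_closed[OF A3 C] dc])
      fix i j :: nat assume "i < 3" "j < 3"
      moreover from this have "(A \<otimes>\<^bsub>mat_monoid R 3\<^esub> C) $$ (i, j) \<ominus> diag_matrix R 3 (\<lambda>_. mat_det R 3 A) $$ (i, j) = \<zero>"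
        using ids[of "A $$ (0, 0)" "A $$ (0, 1)" "A $$ (0, 2)" "A $$ (1, 0)" "A $$ (1, 1)" "A $$ (1, 2)"
            "A $$ (2, 0)" "A $$ (2, 1)" "A $$ (2, 2)"] 2
        unfolding less3
        by (elim disjE) (simp_all add: mat_mult_entry_3[OF A3 C] Ce diag_matrix_entry mat_det_3[OF A3] del: One_nat_def minus_0_r)
      ultimately show "(A \<otimes>\<^bsub>mat_monoid R 3\<^esub> C) $$ (i, j) = diag_matrix R 3 (\<lambda>_. mat_det R 3 A) $$ (i, j)"
        using mat_entry[OF mat_mult_closed[OF A3 C]] mat_entry[OF dc]
        by (simp add: eq_diff0)
    qed
    then show ?thesis using that C 2 by blast
  qed
  note C = this
  let ?D = "diag_matrix R n (\<lambda>_. inv (mat_det R n A))"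
  interpret M: monoid "Mat n" by (rule monoid_mat_monoid)
  have d: "mat_det R n A \<in> carrier R" by (rule mat_det_closed[OF n A])
  then have D: "?D \<in> carrier (Mat n)" using det by (intro diag_matrix_closed) simp
  have "A \<otimes>\<^bsub>Mat n\<^esub> (C \<otimes>\<^bsub>Mat n\<^esub> ?D) = \<one>\<^bsub>Mat n\<^esub>"
    using d det by (simp add: M.m_assoc[symmetric] A C D diag_matrix_mult diag_matrix_one)
  then show ?thesis using C(1) D by blast
qed

text \<open>The right inverse \<open>B\<close> has nonzero determinant too, hence its own right
  inverse \<open>C\<close>. Then \<open>B\<close> has the left inverse \<open>A\<close> and the
  right inverse \<open>C\<close>, which must coincide, so \<open>B\<close> is a two-sided inverse of
  \<open>A\<close>.\<close>

lemma mat_Units_if_det: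
  assumes n: "n \<in> {2, 3}" and A: "A \<in> carrier (Mat n)" and det: "mat_det R n A \<noteq> \<zero>"
  shows "A \<in> Units (Mat n)"
proof -
  interpret M: monoid "Mat n" by (rule monoid_mat_monoid)
  obtain B where B: "B \<in> carrier (Mat n)" "A \<otimes>\<^bsub>Mat n\<^esub> B = \<one>\<^bsub>Mat n\<^esub>"
    using mat_right_inverse_if_det[OF n A det] by blast
  have "mat_det R n A \<otimes> mat_det R n B = \<one>"
    using mat_det_mult[OF n A B(1)] n by (simp add: B(2) diag_matrix_one mat_det_diag_matrix)
  then have "mat_det R n B \<noteq> \<zero>" using mat_det_closed[OF n A] by auto
  then obtain C where C: "C \<in> carrier (Mat n)" "B \<otimes>\<^bsub>Mat n\<^esub> C = \<one>\<^bsub>Mat n\<^esub>"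
    using mat_right_inverse_if_det[OF n B(1)] by blast
  have "A = C" by (rule M.inv_unique[OF B(2) C(2) B(1) A C(1)])
  then show ?thesis using A B C unfolding Units_def by blast
qed

end

section \<open>Characters of free abelian groups\<close>

lemma carrier_Z_pow: "carrier (Z_pow r) = (\<Pi>\<^sub>E i\<in>{..<r}. UNIV)"
  by (simp add: Z_pow_def)

lemma mult_Z_pow: "x \<otimes>\<^bsub>Z_pow r\<^esub> y = (\<lambda>i\<in>{..<r}. x i + y i)"
  by (simp add: Z_pow_def)

lemma one_Z_pow: "\<one>\<^bsub>Z_pow r\<^esub> = (\<lambda>i\<in>{..<r}. 0)"
  by (simp add: Z_pow_def)

lemma comm_group_Z_pow: "comm_group (Z_pow r)"
proof (rule group.group_comm_groupI)
  show "group (Z_pow r)" by (simp add: Z_pow_def)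
qed (auto simp: mult_Z_pow add.commute)

lemma inv_Z_pow: "x \<in> carrier (Z_pow r) \<Longrightarrow> inv\<^bsub>Z_pow r\<^esub> x = (\<lambda>i\<in>{..<r}. - x i)"
  by (simp add: Z_pow_def)

lemma std_basis_closed: "std_basis r i \<in> carrier (Z_pow r)"
  by (simp add: std_basis_def carrier_Z_pow)

text \<open>The standard basis generates Z^r. As an induction rule this extends what the definitions
  demand on the basis to the whole group.\<close>

lemma Z_pow_induct [consumes 1, case_names one basis mult inv]:
  assumes x: "x \<in> carrier (Z_pow r)"
    and one: "P \<one>\<^bsub>Z_pow r\<^esub>"
    and basis: "\<And>i. i < r \<Longrightarrow> P (std_basis r i)"
    and mult: "\<And>x y. x \<in> carrier (Z_pow r) \<Longrightarrow> y \<in> carrier (Z_pow r) \<Longrightarrow> P x \<Longrightarrow> P y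
      \<Longrightarrow> P (x \<otimes>\<^bsub>Z_pow r\<^esub> y)"
    and inv: "\<And>x. x \<in> carrier (Z_pow r) \<Longrightarrow> P x \<Longrightarrow> P (inv\<^bsub>Z_pow r\<^esub> x)"
  shows "P x"
proof -
  \<comment> \<open>The multiple by \<open>m\<close> of the basis vector with index
    \<open>k\<close>, reached from zero by steps in both directions.\<close>
  define u where "u k m = (\<lambda>j\<in>{..<r}. if j = k then m else (0::int))" for k m
  have u_closed: "u k m \<in> carrier (Z_pow r)" for k m by (simp add: u_def carrier_Z_pow)
  have u0: "u k 0 = \<one>\<^bsub>Z_pow r\<^esub>" for k by (auto simp: u_def one_Z_pow)
  have uS: "u k (m + 1) = u k m \<otimes>\<^bsub>Z_pow r\<^esub> std_basis r k" for k m
    by (auto simp: u_def mult_Z_pow std_basis_def)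
  have uP: "u k (m - 1) = u k m \<otimes>\<^bsub>Z_pow r\<^esub> inv\<^bsub>Z_pow r\<^esub> (std_basis r k)" for k m
    unfolding inv_Z_pow[OF std_basis_closed] by (auto simp: u_def mult_Z_pow std_basis_def)
  interpret Z: comm_group "Z_pow r" by (rule comm_group_Z_pow)
  have Pu: "P (u k m)" if "k < r" for k m
  proof (induction m rule: int_induct[where k = 0])
    case base then show ?case by (simp add: u0 one)
  next
    case (step1 m) then show ?case
      unfolding uS using that by (intro mult basis u_closed std_basis_closed)
  next
    case (step2 m) then show ?case
      unfolding uP using that by (intro mult basis inv u_closed std_basis_closed Z.inv_closed)
  qed
  \<comment> \<open>The truncation of \<open>x\<close> to its first \<open>k\<close> coordinates;
    one more coordinate is gained by adding a multiple of a basis vector.\<close>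
  define t where "t k = (\<lambda>j\<in>{..<r}. if j < k then x j else 0)" for k
  have t_closed: "t k \<in> carrier (Z_pow r)" for k by (simp add: t_def carrier_Z_pow)
  have "P (t k)" if "k \<le> r" for k
    using that
  proof (induction k)
    case 0 
    have "t 0 = \<one>\<^bsub>Z_pow r\<^esub>" by (auto simp: t_def one_Z_pow)
    then show ?case using one by simp
  next
    case (Suc k)
    have "t (Suc k) = t k \<otimes>\<^bsub>Z_pow r\<^esub> u k (x k)"
      by (auto simp: t_def u_def mult_Z_pow)
    then show ?case using Suc Pu t_closed u_closed by (simp add: mult)
  qed
  from this[of r] have "P (t r)" by simp
  moreover have "t r = x"
    using x by (auto simp: t_def carrier_Z_pow PiE_def extensional_def fun_eq_iff)
  ultimately show ?thesis by simp
qed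

text \<open>The target is an arbitrary group, so that this applies both to characters and to
  representations with values in the unit group of matrices.\<close>

lemma hom_Z_pow_eqI:
  assumes "group A" and f: "f \<in> hom (Z_pow r) A" and g: "g \<in> hom (Z_pow r) A"
    and eq: "\<And>i. i < r \<Longrightarrow> f (std_basis r i) = g (std_basis r i)"
    and x: "x \<in> carrier (Z_pow r)"
  shows "f x = g x"
proof -
  interpret A: group A by fact
  interpret Z: comm_group "Z_pow r" by (rule comm_group_Z_pow)
  interpret f: group_hom "Z_pow r" A f using f by unfold_locales
  interpret g: group_hom "Z_pow r" A g using g by unfold_locales
  show ?thesis using x
    by (induction rule: Z_pow_induct) (simp_all add: eq)
qed

text \<open>For \<open>A\<close> the multiplicative group of a field this is the character group of
  \<open>G\<close>. Extensionality makes equality of characters plain equality of functions, so that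
  sets of characters can be counted.\<close>

definition hom_group :: "('a, 'c) monoid_scheme \<Rightarrow> ('b, 'd) monoid_scheme \<Rightarrow> ('a \<Rightarrow> 'b) monoid" where
  "hom_group G A = \<lparr>carrier = hom G A \<inter> extensional (carrier G),
    monoid.mult = (\<lambda>f g. \<lambda>x\<in>carrier G. f x \<otimes>\<^bsub>A\<^esub> g x), one = (\<lambda>x\<in>carrier G. \<one>\<^bsub>A\<^esub>)\<rparr>"

lemma hom_group_carrier: "f \<in> carrier (hom_group G A) \<longleftrightarrow> f \<in> hom G A \<and> f \<in> extensional (carrier G)"
  by (simp add: hom_group_def)

lemma hom_group_eqI:
  "f \<in> carrier (hom_group G A) \<Longrightarrow> g \<in> carrier (hom_group G A) \<Longrightarrow>
    (\<And>x. x \<in> carrier G \<Longrightarrow> f x = g x) \<Longrightarrow> f = g"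
  unfolding hom_group_carrier by (blast intro: extensionalityI)

lemma hom_group_mult: "x \<in> carrier G \<Longrightarrow> (f \<otimes>\<^bsub>hom_group G A\<^esub> g) x = f x \<otimes>\<^bsub>A\<^esub> g x"
  by (simp add: hom_group_def)

lemma hom_group_one: "x \<in> carrier G \<Longrightarrow> \<one>\<^bsub>hom_group G A\<^esub> x = \<one>\<^bsub>A\<^esub>"
  by (simp add: hom_group_def)

lemma comm_group_hom_group:
  assumes "group G" "comm_group A"
  shows "comm_group (hom_group G A)"
proof -
  let ?H = "hom_group G A"
  interpret G: group G by fact
  interpret A: comm_group A by fact
  have mult: "f \<otimes>\<^bsub>?H\<^esub> g \<in> carrier ?H"
    if "f \<in> carrier ?H" "g \<in> carrier ?H" for f g
    using that by (auto simp: hom_group_def hom_def A.m_ac Pi_iff)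
  have one: "\<one>\<^bsub>?H\<^esub> \<in> carrier ?H"
    by (auto simp: hom_group_def hom_def)
  have "\<exists>g\<in>carrier ?H. g \<otimes>\<^bsub>?H\<^esub> f = \<one>\<^bsub>?H\<^esub>"
    if f: "f \<in> carrier ?H" for f
  proof
    show inv: "(\<lambda>x\<in>carrier G. inv\<^bsub>A\<^esub> f x) \<in> carrier ?H"
      using f by (auto simp: hom_group_def hom_def A.inv_mult Pi_iff)
    show "(\<lambda>x\<in>carrier G. inv\<^bsub>A\<^esub> f x) \<otimes>\<^bsub>?H\<^esub> f = \<one>\<^bsub>?H\<^esub>"
      by (rule hom_group_eqI[OF mult[OF inv f] one])
        (use f in \<open>auto simp: hom_group_def hom_def Pi_iff\<close>)
  qed
  moreover have "f \<otimes>\<^bsub>?H\<^esub> g = g \<otimes>\<^bsub>?H\<^esub> f"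
    if "f \<in> carrier ?H" "g \<in> carrier ?H" for f g
    by (rule hom_group_eqI[OF mult mult])
      (use that in \<open>auto simp: hom_group_def hom_def Pi_iff A.m_comm\<close>)
  moreover have "f \<otimes>\<^bsub>?H\<^esub> g \<otimes>\<^bsub>?H\<^esub> h = f \<otimes>\<^bsub>?H\<^esub> (g \<otimes>\<^bsub>?H\<^esub> h)"
    if "f \<in> carrier ?H" "g \<in> carrier ?H" "h \<in> carrier ?H" for f g h
    by (rule hom_group_eqI[OF mult[OF mult] mult[OF _ mult]])
      (use that in \<open>auto simp: hom_group_def hom_def Pi_iff A.m_assoc\<close>)
  moreover have "\<one>\<^bsub>?H\<^esub> \<otimes>\<^bsub>?H\<^esub> f = f" if "f \<in> carrier ?H" for f
    by (rule hom_group_eqI[OF mult[OF one]])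
      (use that in \<open>auto simp: hom_group_def hom_def Pi_iff\<close>)
  ultimately show ?thesis using mult one by (intro comm_groupI) auto
qed

lemma hom_group_pow:
  assumes "group G" "comm_group A" "f \<in> carrier (hom_group G A)" "x \<in> carrier G"
  shows "(f [^]\<^bsub>hom_group G A\<^esub> (k::nat)) x = f x [^]\<^bsub>A\<^esub> k"
proof -
  interpret A: comm_group A by fact
  interpret H: comm_group "hom_group G A" using assms by (intro comm_group_hom_group)
  show ?thesis using assms by (induction k) (simp_all add: hom_group_one hom_group_mult)
qed

text \<open>The universal property of Z^r restricted to torsion: the values on the basis can be
  chosen freely among the elements killed by \<open>m\<close>. Counts of torsion characters
  therefore are powers with exponent \<open>r\<close>.\<close>

lemma bij_betw_torsion_hom_group:
  assumes "comm_group A"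
  shows "bij_betw (\<lambda>f. \<lambda>i\<in>{..<r}. f (std_basis r i))
    {f \<in> carrier (hom_group (Z_pow r) A). f [^]\<^bsub>hom_group (Z_pow r) A\<^esub> (m::nat) = \<one>\<^bsub>hom_group (Z_pow r) A\<^esub>}
    (\<Pi>\<^sub>E i\<in>{..<r}. {a \<in> carrier A. a [^]\<^bsub>A\<^esub> m = \<one>\<^bsub>A\<^esub>})"
proof -
  interpret A: comm_group A by fact
  interpret Z: comm_group "Z_pow r" by (rule comm_group_Z_pow)
  let ?H = "hom_group (Z_pow r) A"
  interpret H: comm_group ?H
    by (rule comm_group_hom_group[OF Z.group_axioms \<open>comm_group A\<close>])
  note pow = hom_group_pow[OF Z.group_axioms \<open>comm_group A\<close>]
  show ?thesis
  proof (rule bij_betwI')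
    fix f g assume f: "f \<in> {f \<in> carrier ?H. f [^]\<^bsub>?H\<^esub> m = \<one>\<^bsub>?H\<^esub>}" and g: "g \<in> {f \<in> carrier ?H. f [^]\<^bsub>?H\<^esub> m = \<one>\<^bsub>?H\<^esub>}"
    show "((\<lambda>i\<in>{..<r}. f (std_basis r i)) = (\<lambda>i\<in>{..<r}. g (std_basis r i))) \<longleftrightarrow> f = g"
    proof
      assume eq: "(\<lambda>i\<in>{..<r}. f (std_basis r i)) = (\<lambda>i\<in>{..<r}. g (std_basis r i))"
      have "f (std_basis r i) = g (std_basis r i)" if "i < r" for i
        using fun_cong[OF eq, of i] that by simp
      then show "f = g"
        using f g hom_Z_pow_eqI[OF A.group_axioms, of f r g]
        by (intro hom_group_eqI[of f _ A g]) (auto simp: hom_group_carrier)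
    qed simp
  next
    fix f assume f: "f \<in> {f \<in> carrier ?H. f [^]\<^bsub>?H\<^esub> m = \<one>\<^bsub>?H\<^esub>}"
    then have "f x [^]\<^bsub>A\<^esub> m = \<one>\<^bsub>A\<^esub>" "f x \<in> carrier A" if "x \<in> carrier (Z_pow r)" for x
      using pow[of f x m] that by (auto simp: hom_group_one hom_group_carrier hom_def)
    then show "(\<lambda>i\<in>{..<r}. f (std_basis r i)) \<in> (\<Pi>\<^sub>E i\<in>{..<r}. {a \<in> carrier A. a [^]\<^bsub>A\<^esub> m = \<one>\<^bsub>A\<^esub>})"
      using std_basis_closed by auto
  next
    fix c assume c: "c \<in> (\<Pi>\<^sub>E i\<in>{..<r}. {a \<in> carrier A. a [^]\<^bsub>A\<^esub> m = \<one>\<^bsub>A\<^esub>})"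
    then have cA: "c i \<in> carrier A" "c i [^]\<^bsub>A\<^esub> m = \<one>\<^bsub>A\<^esub>" if "i < r" for i using that by auto
    define f where "f = (\<lambda>x\<in>carrier (Z_pow r). \<Otimes>\<^bsub>A\<^esub>i\<in>{..<r}. c i [^]\<^bsub>A\<^esub> (x i :: int))"
    have f: "f \<in> carrier ?H"
      unfolding hom_group_carrier
    proof
      show "f \<in> hom (Z_pow r) A"
      proof (rule homI)
        fix x y assume xy: "x \<in> carrier (Z_pow r)" "y \<in> carrier (Z_pow r)"
        then have "f (x \<otimes>\<^bsub>Z_pow r\<^esub> y) = (\<Otimes>\<^bsub>A\<^esub>i\<in>{..<r}. c i [^]\<^bsub>A\<^esub> (x i) \<otimes>\<^bsub>A\<^esub> c i [^]\<^bsub>A\<^esub> (y i))"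
          using cA Z.m_closed[OF xy] unfolding f_def mult_Z_pow
          by (simp only: restrict_apply' if_True, intro A.finprod_cong') (auto simp: A.int_pow_mult)
        also have "\<dots> = f x \<otimes>\<^bsub>A\<^esub> f y"
          using cA xy by (auto simp: f_def A.finprod_multf)
        finally show "f (x \<otimes>\<^bsub>Z_pow r\<^esub> y) = f x \<otimes>\<^bsub>A\<^esub> f y" .
      qed (use cA in \<open>auto simp: f_def intro!: A.finprod_closed\<close>)
    qed (simp add: f_def)
    have fb: "f (std_basis r i) = c i" if "i < r" for i
    proof -
      have "f (std_basis r i) = (\<Otimes>\<^bsub>A\<^esub>j\<in>{..<r}. if i = j then c j else \<one>\<^bsub>A\<^esub>)"
        using cA std_basis_closed[of r i]
        by (auto simp: f_def std_basis_def intro!: A.finprod_cong')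
      then show ?thesis using that cA A.finprod_singleton[of i "{..<r}" c] by auto
    qed
    \<comment> \<open>The power of \<open>f\<close> is itself a homomorphism, so its triviality has
      to be tested on the basis only.\<close>
    have "f [^]\<^bsub>?H\<^esub> m = \<one>\<^bsub>?H\<^esub>"
    proof (rule hom_group_eqI[OF H.nat_pow_closed[OF f] H.one_closed])
      fix x assume "x \<in> carrier (Z_pow r)"
      then show "(f [^]\<^bsub>?H\<^esub> m) x = \<one>\<^bsub>?H\<^esub> x"
        using H.nat_pow_closed[OF f, of m] H.one_closed cA
        by - (rule hom_Z_pow_eqI[OF A.group_axioms, of "f [^]\<^bsub>?H\<^esub> m" r "\<one>\<^bsub>?H\<^esub>" x],
          simp_all add: hom_group_carrier pow[OF f] std_basis_closed fb hom_group_one)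
    qed
    moreover have "c = (\<lambda>i\<in>{..<r}. f (std_basis r i))"
      using c fb by (auto simp: PiE_def extensional_def fun_eq_iff)
    ultimately show "\<exists>f\<in>{f \<in> carrier ?H. f [^]\<^bsub>?H\<^esub> m = \<one>\<^bsub>?H\<^esub>}. c = (\<lambda>i\<in>{..<r}. f (std_basis r i))"
      using f by blast
  qed
qed

section \<open>Eigencharacters of diagonalizable representations\<close>

lemma (in ring) finsum_subring:
  assumes "subring K R" "f \<in> A \<rightarrow> K"
  shows "finsum (R\<lparr>carrier := K\<rparr>) f A = finsum R f A"
proof -
  interpret K: ring "R\<lparr>carrier := K\<rparr>" using subring_is_ring[OF assms(1)] .
  have KR: "K \<subseteq> carrier R" using subringE(1)[OF assms(1)] .
  show ?thesis using assms(2)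
  proof (induction A rule: infinite_finite_induct)
    case (insert a A)
    then show ?case
      using KR by (subst K.finsum_insert, auto, subst finsum_insert) auto
  qed (use K.finsum_infinite finsum_infinite K.finsum_empty in auto)
qed

lemma is_diagonal_iff:
  assumes "A \<in> carrier (mat_monoid R n)"
  shows "is_diagonal R n A \<longleftrightarrow> A = diag_matrix R n (\<lambda>i. A $$ (i, i))"
proof
  assume "is_diagonal R n A"
  then show "A = diag_matrix R n (\<lambda>i. A $$ (i, i))"
    using assms by (intro eq_matI) (auto simp: is_diagonal_def mat_carrier diag_matrix_def)
qed (metis is_diagonal_diag_matrix)

text \<open>The diagonal entries of \<open>A\<close> are nonzero by the product equation, so they
  can be cancelled in its off-diagonal entries. This is the inverse step of the induction over
  Z^r.\<close>

lemma (in field) is_diagonal_right_inverse: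
  assumes A: "A \<in> carrier (mat_monoid R n)" and B: "B \<in> carrier (mat_monoid R n)"
    and AB: "A \<otimes>\<^bsub>mat_monoid R n\<^esub> B = \<one>\<^bsub>mat_monoid R n\<^esub>" and diag: "is_diagonal R n A"
  shows "is_diagonal R n B"
proof -
  have e: "A $$ (i, i) \<otimes> B $$ (i, j) = (if i = j then \<one> else \<zero>)" if "i < n" "j < n" for i j
    using diag_matrix_mult_entry[OF B, of "\<lambda>i. A $$ (i, i)" i j] mat_entry[OF A]
      is_diagonal_iff[OF A] diag AB mat_one_entry[of i n j R] that by simp
  show ?thesis
    unfolding is_diagonal_def
  proof (intro allI impI)
    fix i j assume ij: "i < n" "j < n" "i \<noteq> j"
    have "A $$ (i, i) \<noteq> \<zero>" using e[OF ij(1,1)] mat_entry[OF B] ij by auto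
    then show "B $$ (i, j) = \<zero>"
      using e[OF ij(1,2)] ij mat_entry[OF A] mat_entry[OF B] integral_iff by auto
  qed
qed

locale SL_character_variety = finite_field_closure +
  fixes n r :: nat
  assumes n: "n \<in> {2, 3}"
begin

abbreviation M where "M \<equiv> mat_monoid L n"
abbreviation mat_mult (infixl "\<star>" 70) where "A \<star> B \<equiv> A \<otimes>\<^bsub>M\<^esub> B"
abbreviation Z where "Z \<equiv> Z_pow r"
abbreviation G where "G \<equiv> hom_group Z (Multiplicative_Group.mult_of L)"

sublocale M: monoid M by (rule monoid_mat_monoid)
sublocale Z: comm_group Z by (rule comm_group_Z_pow)
sublocale A: comm_group "Multiplicative_Group.mult_of L"
  by (rule group.group_comm_groupI[OF field_mult_group]) (simp add: m_comm)
sublocale G: comm_group G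
  by (rule comm_group_hom_group[OF Z.group_axioms A.comm_group_axioms])
sublocale U: group "units_of M" by (rule M.units_group)

lemma K_subring: "subring K L"
  using subfieldE(1)[OF subfield_axioms] .

lemma mat_mult_K:
  assumes "B \<in> carrier (mat_monoid (KF) n)" "C \<in> carrier (mat_monoid (KF) n)"
  shows "B \<otimes>\<^bsub>mat_monoid (KF) n\<^esub> C = B \<star> C"
  unfolding mat_monoid_def monoid.simps
  using mat_entry[OF assms(1)] mat_entry[OF assms(2)] subringE(6)[OF K_subring]
  by (intro cong_mat) (auto intro!: finsum_subring[OF K_subring])

lemma mat_carrier_K:
  "B \<in> carrier (mat_monoid (KF) n) \<longleftrightarrow> B \<in> carrier M \<and> (\<forall>i<n. \<forall>j<n. B $$ (i, j) \<in> K)"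
  using K_subset by (auto simp: mat_carrier)

text \<open>The explicit formulas reduce the comparison to negation, which unlike sum and product is
  defined through the carrier of the record.\<close>

lemma mat_det_K:
  assumes "B \<in> carrier (mat_monoid (KF) n)"
  shows "mat_det (KF) n B = mat_det L n B"
proof -
  interpret KF: field "KF" using subfield_iff(2)[OF subfield_axioms] .
  have inv: "\<ominus>\<^bsub>KF\<^esub> x = \<ominus> x" if "x \<in> K" for x
    using add.m_inv_consistent[of K x] that subring.axioms(1)[OF K_subring] by (simp add: a_inv_def)
  have minus: "x \<ominus>\<^bsub>KF\<^esub> y = x \<ominus> y" if "y \<in> K" for x y
    using inv[OF that] by (simp add: a_minus_def)
  note cl = subringE(6,7)[OF K_subring]
  have "B \<in> carrier M" using assms mat_carrier_K by blast
  with assms mat_entry[OF assms] n show ?thesis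
    by (auto simp: KF.mat_det_2 KF.mat_det_3 mat_det_2 mat_det_3 minus cl)
qed

text \<open>Moves all operations from the record of the small field to that of \<open>L\<close>;
  afterwards \<open>K\<close> enters only through membership of the entries.\<close>

lemma Hom_SL_K_iff:
  "\<rho> \<in> Hom_SL (KF) n r \<longleftrightarrow>
    \<rho> \<in> extensional (carrier Z) \<and>
    (\<forall>x\<in>carrier Z. \<rho> x \<in> carrier M \<and> (\<forall>i<n. \<forall>j<n. \<rho> x $$ (i, j) \<in> K) \<and> mat_det L n (\<rho> x) = \<one>) \<and>
    (\<forall>x\<in>carrier Z. \<forall>y\<in>carrier Z. \<rho> (x \<otimes>\<^bsub>Z\<^esub> y) = \<rho> x \<star> \<rho> y)"
proof -
  have car: "B \<in> carrier (SL (KF) n) \<longleftrightarrow>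
      B \<in> carrier M \<and> (\<forall>i<n. \<forall>j<n. B $$ (i, j) \<in> K) \<and> mat_det L n B = \<one>" for B
    using mat_carrier_K[of B] mat_det_K[of B] by (auto simp: SL_def)
  have mul: "B \<otimes>\<^bsub>SL (KF) n\<^esub> C = B \<star> C"
    if "B \<in> carrier (SL (KF) n)" "C \<in> carrier (SL (KF) n)" for B C
    using mat_mult_K[of B C] that by (simp add: SL_def)
  show ?thesis
    unfolding Hom_SL_def hom_def using mul car by (auto simp: Pi_iff)
qed

text \<open>Strengthens diagonality on the basis to all of Z^r and records the diagonal entries as
  elements of the character group.\<close>

definition diagonalizes :: "'a mat \<Rightarrow> ((nat \<Rightarrow> int) \<Rightarrow> 'a mat) \<Rightarrow> (nat \<Rightarrow> (nat \<Rightarrow> int) \<Rightarrow> 'a) \<Rightarrow> bool" where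
  "diagonalizes g \<rho> \<chi> \<longleftrightarrow> g \<in> Units M \<and> (\<forall>i<n. \<chi> i \<in> carrier G) \<and>
    (\<forall>x\<in>carrier Z. mat_conj L n g (\<rho> x) = diag_matrix L n (\<lambda>i. \<chi> i x))"

text \<open>Determinant 1 makes the values invertible. With values in a group, representations can
  be compared on the basis.\<close>

lemma Hom_SL_K_hom_units:
  assumes "\<rho> \<in> Hom_SL (KF) n r"
  shows "\<rho> \<in> hom Z (units_of M)"
proof -
  have "\<rho> x \<in> Units M" if "x \<in> carrier Z" for x
    using mat_Units_if_det[OF n, of "\<rho> x"] assms that unfolding Hom_SL_K_iff by simp
  then show ?thesis
    using assms unfolding Hom_SL_K_iff hom_def by (simp add: units_of_def Pi_iff)
qed

lemma mat_conj_hom: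
  assumes "\<rho> \<in> hom Z (units_of M)" "g \<in> Units M"
  shows "(\<lambda>x. mat_conj L n g (\<rho> x)) \<in> hom Z (units_of M)"
proof -
  interpret h: group_hom Z "units_of M" \<rho> using assms(1) by unfold_locales
  have g: "g \<in> carrier (units_of M)" using assms by (simp add: units_of_def)
  have "mat_conj L n g B = g \<otimes>\<^bsub>units_of M\<^esub> B \<otimes>\<^bsub>units_of M\<^esub> inv\<^bsub>units_of M\<^esub> g" for B
    unfolding mat_conj_def using assms(2) by (simp add: M.units_of_inv) (simp add: units_of_def)
  moreover have "inv\<^bsub>units_of M\<^esub> g \<otimes>\<^bsub>units_of M\<^esub> (g \<otimes>\<^bsub>units_of M\<^esub> B) = B"
    if "B \<in> carrier (units_of M)" for B
    using g that by (simp add: U.m_assoc[symmetric])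
  ultimately show ?thesis
    using g by (intro homI) (simp_all add: U.m_assoc)
qed

lemma char_value:
  assumes "\<chi> \<in> carrier G" "x \<in> carrier Z"
  shows "\<chi> x \<in> carrier L" "\<chi> x \<noteq> \<zero>"
  using assms by (auto simp: hom_group_carrier hom_def)

text \<open>Diagonal matrices are closed under products and inverses, so diagonality spreads from
  the basis to Z^r. On diagonal matrices each diagonal entry is multiplicative, which makes it a
  character.\<close>

lemma ex_diagonalizes:
  assumes \<rho>: "\<rho> \<in> diag_Hom_SL L K n r"
  shows "\<exists>g \<chi>. diagonalizes g \<rho> \<chi>"
proof -
  have \<rho>H: "\<rho> \<in> Hom_SL (KF) n r" using \<rho> by (simp add: diag_Hom_SL_def)
  obtain g where g: "g \<in> Units M" and gd: "\<And>i. i < r \<Longrightarrow> is_diagonal L n (mat_conj L n g (\<rho> (std_basis r i)))"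
    using \<rho> by (auto simp: diag_Hom_SL_def)
  define D where "D x = mat_conj L n g (\<rho> x)" for x
  have hom: "D \<in> hom Z (units_of M)"
    unfolding D_def by (rule mat_conj_hom[OF Hom_SL_K_hom_units[OF \<rho>H] g])
  have h: "group_hom Z (units_of M) D" using hom by unfold_locales
  have Dc: "D x \<in> carrier M" if "x \<in> carrier Z" for x
    using hom_in_carrier[OF hom that] by (simp add: units_of_def Units_def)
  have Dm: "D (x \<otimes>\<^bsub>Z\<^esub> y) = D x \<star> D y" if "x \<in> carrier Z" "y \<in> carrier Z" for x y
    using hom_mult[OF hom that] by (simp add: units_of_def)
  have D1: "D \<one>\<^bsub>Z\<^esub> = \<one>\<^bsub>M\<^esub>" using group_hom.hom_one[OF h] by (simp add: units_of_def)
  have Di: "D x \<star> D (inv\<^bsub>Z\<^esub> x) = \<one>\<^bsub>M\<^esub>" if "x \<in> carrier Z" for x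
    using Dm[of x "inv\<^bsub>Z\<^esub> x"] that D1 by simp
  have diag_mult: "is_diagonal L n (B \<star> C)" and mult_ii: "\<And>i. i < n \<Longrightarrow> (B \<star> C) $$ (i, i) = B $$ (i, i) \<otimes> C $$ (i, i)"
    if B: "B \<in> carrier M" "is_diagonal L n B" and C: "C \<in> carrier M" "is_diagonal L n C" for B C
  proof -
    have e: "B \<star> C = diag_matrix L n (\<lambda>i. B $$ (i, i) \<otimes> C $$ (i, i))"
    proof -
      have "B \<star> C = diag_matrix L n (\<lambda>i. B $$ (i, i)) \<star> diag_matrix L n (\<lambda>i. C $$ (i, i))"
        using is_diagonal_iff[OF B(1)] is_diagonal_iff[OF C(1)] B C
        by (intro arg_cong2[where f = "(\<otimes>\<^bsub>M\<^esub>)"]) blast+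
      also have "\<dots> = diag_matrix L n (\<lambda>i. B $$ (i, i) \<otimes> C $$ (i, i))"
        using mat_entry[OF B(1)] mat_entry[OF C(1)] by (intro diag_matrix_mult) auto
      finally show ?thesis .
    qed
    then show "is_diagonal L n (B \<star> C)" by (simp add: is_diagonal_diag_matrix)
    show "\<And>i. i < n \<Longrightarrow> (B \<star> C) $$ (i, i) = B $$ (i, i) \<otimes> C $$ (i, i)"
      unfolding e by (simp add: diag_matrix_entry)
  qed
  have Dd: "is_diagonal L n (D x)" if "x \<in> carrier Z" for x
    using that
  proof (induction rule: Z_pow_induct)
    case one
    show ?case by (simp add: D1 diag_matrix_one is_diagonal_diag_matrix)
  next
    case (basis i)
    then show ?case using gd by (simp add: D_def)
  next
    case (mult x y)
    then show ?case by (simp add: Dm diag_mult Dc)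
  next
    case (inv x)
    then show ?case using is_diagonal_right_inverse[OF Dc Dc Di] by simp
  qed
  define \<chi> where "\<chi> i = (\<lambda>x\<in>carrier Z. D x $$ (i, i))" for i
  have "\<chi> i \<in> carrier G" if i: "i < n" for i
    unfolding hom_group_carrier
  proof
    \<comment> \<open>The entries at \<open>x\<close> and at its inverse multiply to 1.\<close>
    have nz: "D x $$ (i, i) \<noteq> \<zero>" if x: "x \<in> carrier Z" for x
    proof
      assume "D x $$ (i, i) = \<zero>"
      moreover have "D x $$ (i, i) \<otimes> D (inv\<^bsub>Z\<^esub> x) $$ (i, i) = \<one>"
        using mult_ii[of "D x" "D (inv\<^bsub>Z\<^esub> x)" i] Di[OF x] Dc Dd x i by (simp add: mat_one_entry)
      ultimately show False using mat_entry[OF Dc[of "inv\<^bsub>Z\<^esub> x"] i i] x by simp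
    qed
    show "\<chi> i \<in> hom Z (Multiplicative_Group.mult_of L)"
      using nz Dc Dd i mat_entry[OF Dc i i] by (intro homI) (simp_all add: \<chi>_def Dm mult_ii)
  qed (simp add: \<chi>_def)
  moreover have "D x = diag_matrix L n (\<lambda>i. \<chi> i x)" if "x \<in> carrier Z" for x
  proof -
    have "D x = diag_matrix L n (\<lambda>i. D x $$ (i, i))"
      by (rule is_diagonal_iff[OF Dc[OF that], THEN iffD1, OF Dd[OF that]])
    also have "\<dots> = diag_matrix L n (\<lambda>i. \<chi> i x)" using that by (simp add: \<chi>_def)
    finally show ?thesis .
  qed
  ultimately have "diagonalizes g \<rho> \<chi>"
    using g by (simp add: diagonalizes_def D_def)
  then show ?thesis by blast
qed

lemma finprod_hom_group_apply:
  assumes "finite A" "\<chi> \<in> A \<rightarrow> carrier G" and x: "x \<in> carrier Z"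
  shows "(finprod G \<chi> A) x = (\<Otimes>i\<in>A. \<chi> i x)"
  using assms(1,2)
proof (induction A rule: finite_induct)
  case empty
  then show ?case using x by (simp add: hom_group_one)
next
  case (insert i A)
  then have "\<chi> \<in> A \<rightarrow> carrier G" "\<chi> i \<in> carrier G" by auto
  moreover have "(\<lambda>i. \<chi> i x) \<in> A \<rightarrow> carrier L" "\<chi> i x \<in> carrier L"
    using calculation char_value x by auto
  ultimately show ?case using insert x by (simp add: hom_group_mult)
qed

lemma diagonalizes_prod:
  assumes \<rho>: "\<rho> \<in> diag_Hom_SL L K n r" and d: "diagonalizes g \<rho> \<chi>"
  shows "finprod G \<chi> {..<n} = \<one>\<^bsub>G\<^esub>"
proof (rule hom_group_eqI)
  have \<chi>: "\<chi> \<in> {..<n} \<rightarrow> carrier G" using d by (auto simp: diagonalizes_def)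
  then show "finprod G \<chi> {..<n} \<in> carrier G" by (rule G.finprod_closed)
  show "\<one>\<^bsub>G\<^esub> \<in> carrier G" by simp
  fix x assume x: "x \<in> carrier Z"
  have \<rho>x: "\<rho> x \<in> carrier M" "mat_det L n (\<rho> x) = \<one>"
    using \<rho> x by (auto simp: diag_Hom_SL_def Hom_SL_K_iff)
  have "(finprod G \<chi> {..<n}) x = (\<Otimes>i\<in>{..<n}. \<chi> i x)"
    by (rule finprod_hom_group_apply[OF _ \<chi> x]) simp
  also have "\<dots> = mat_det L n (diag_matrix L n (\<lambda>i. \<chi> i x))"
    using \<chi> x by (intro mat_det_diag_matrix[OF n, symmetric] char_value) auto
  also have "\<dots> = mat_det L n (\<rho> x)"
    using d x mat_det_conj[OF n _ \<rho>x(1), of g] by (simp add: diagonalizes_def)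
  finally show "(finprod G \<chi> {..<n}) x = \<one>\<^bsub>G\<^esub> x" using \<rho>x x by (simp add: hom_group_one)
qed

text \<open>The nonzero rows of \<open>P\<close> are common left eigenvectors with eigenvalue the
  character. A square matrix in place of a vector keeps the calculation inside the monoid
  \<open>M\<close>, and no diagonalizing matrix is chosen, so the set depends on the representation
  alone.\<close>

definition eigenchars :: "((nat \<Rightarrow> int) \<Rightarrow> 'a mat) \<Rightarrow> ((nat \<Rightarrow> int) \<Rightarrow> 'a) set" where
  "eigenchars \<rho> = {\<chi> \<in> carrier G. \<exists>P\<in>carrier M. (\<exists>i<n. \<exists>j<n. P $$ (i, j) \<noteq> \<zero>) \<and>
    (\<forall>x\<in>carrier Z. P \<star> \<rho> x = diag_matrix L n (\<lambda>_. \<chi> x) \<star> P)}"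

lemma mat_mult_nonzero:
  assumes P: "P \<in> carrier M" and B: "B \<in> carrier M"
    and nz: "\<exists>i<n. \<exists>j<n. (P \<star> B) $$ (i, j) \<noteq> \<zero>"
  shows "\<exists>i<n. \<exists>j<n. P $$ (i, j) \<noteq> \<zero>"
proof (rule ccontr)
  assume "\<not> ?thesis"
  then have "(P \<star> B) $$ (i, j) = \<zero>" if "i < n" "j < n" for i j
    unfolding mat_mult_entry[OF that]
    using that mat_entry[OF B] by (intro add.finprod_one_eqI) auto
  then show False using nz by blast
qed

text \<open>Conjugation by \<open>g\<close> replaces the representation by a diagonal one. There a
  nonzero entry in column \<open>j\<close> of an intertwining matrix can be cancelled, which forces
  the character \<open>\<chi> j\<close>; conversely a matrix unit picks out each of them.\<close>

lemma eigenchars_eq: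
  assumes \<rho>: "\<And>x. x \<in> carrier Z \<Longrightarrow> \<rho> x \<in> carrier M" and d: "diagonalizes g \<rho> \<chi>"
  shows "eigenchars \<rho> = \<chi> ` {..<n}"
proof -
  have g: "g \<in> Units M" "g \<in> carrier M" "inv\<^bsub>M\<^esub> g \<in> carrier M" using d by (auto simp: diagonalizes_def)
  have \<chi>: "\<chi> i \<in> carrier G" if "i < n" for i using d that by (auto simp: diagonalizes_def)
  define D where "D x = diag_matrix L n (\<lambda>i. \<chi> i x)" for x
  have Dc: "D x \<in> carrier M" if "x \<in> carrier Z" for x
    unfolding D_def using \<chi> that by (intro diag_matrix_closed char_value) auto
  have gD: "g \<star> \<rho> x = D x \<star> g" if x: "x \<in> carrier Z" for x
    using mat_conj_eq_iff[OF g(1) \<rho>[OF x] Dc[OF x]] d x by (auto simp: diagonalizes_def D_def)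
  have scal: "diag_matrix L n (\<lambda>_. \<psi> x) \<in> carrier M" if "\<psi> \<in> carrier G" "x \<in> carrier Z" for \<psi> x
    using that by (intro diag_matrix_closed char_value)
  show ?thesis
  proof (intro equalityI subsetI)
    fix \<psi> assume "\<psi> \<in> eigenchars \<rho>"
    then obtain P where \<psi>: "\<psi> \<in> carrier G" and P: "P \<in> carrier M" "\<exists>i<n. \<exists>j<n. P $$ (i, j) \<noteq> \<zero>"
      and eig: "\<And>x. x \<in> carrier Z \<Longrightarrow> P \<star> \<rho> x = diag_matrix L n (\<lambda>_. \<psi> x) \<star> P"
      by (auto simp: eigenchars_def)
    define Q where "Q = P \<star> inv\<^bsub>M\<^esub> g"
    have Q: "Q \<in> carrier M" using P g by (simp add: Q_def)
    have Qg: "Q \<star> g = P" using P g by (simp add: Q_def M.m_assoc M.Units_l_inv)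
    obtain i j where ij: "i < n" "j < n" "Q $$ (i, j) \<noteq> \<zero>"
      using mat_mult_nonzero[OF Q g(2)] P Qg by auto
    have QD: "Q \<star> D x = diag_matrix L n (\<lambda>_. \<psi> x) \<star> Q" if x: "x \<in> carrier Z" for x
    proof -
      have "Q \<star> D x \<star> g = P \<star> \<rho> x"
        using Q Dc[OF x] g \<rho>[OF x] gD[OF x] Qg by (metis M.m_assoc)
      also have "\<dots> = diag_matrix L n (\<lambda>_. \<psi> x) \<star> Q \<star> g"
        using eig[OF x] Q g scal[OF \<psi> x] Qg by (simp add: M.m_assoc)
      finally have "Q \<star> D x \<star> g \<star> inv\<^bsub>M\<^esub> g = diag_matrix L n (\<lambda>_. \<psi> x) \<star> Q \<star> g \<star> inv\<^bsub>M\<^esub> g"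
        by simp
      then show ?thesis
        using Q Dc[OF x] g scal[OF \<psi> x] by (simp add: M.m_assoc M.Units_r_inv)
    qed
    have "\<psi> = \<chi> j"
    proof (rule hom_group_eqI[OF \<psi> \<chi>[OF ij(2)]])
      fix x assume x: "x \<in> carrier Z"
      have "Q $$ (i, j) \<otimes> \<chi> j x = (Q \<star> D x) $$ (i, j)"
        unfolding D_def using Q ij char_value[OF \<chi> x] by (simp add: mult_diag_matrix_entry)
      also have "\<dots> = Q $$ (i, j) \<otimes> \<psi> x"
        unfolding QD[OF x] using Q ij char_value[OF \<psi> x] mat_entry[OF Q]
        by (simp add: diag_matrix_mult_entry m_comm)
      finally show "\<psi> x = \<chi> j x"
        using ij mat_entry[OF Q] char_value[OF \<psi> x] char_value[OF \<chi> x]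
        by (subst (asm) m_lcancel) auto
    qed
    then show "\<psi> \<in> \<chi> ` {..<n}" using ij by auto
  next
    fix \<psi> assume "\<psi> \<in> \<chi> ` {..<n}"
    then obtain j where j: "j < n" and \<psi>: "\<psi> = \<chi> j" by auto
    \<comment> \<open>The matrix unit at \<open>(j, j)\<close>: \<open>E \<star> g\<close> is row
      \<open>j\<close> of \<open>g\<close>, an eigenvector for \<open>\<chi> j\<close>, padded by
      zero rows.\<close>
    define E where "E = diag_matrix L n (\<lambda>i. if i = j then \<one> else \<zero>)"
    have E: "E \<in> carrier M" unfolding E_def by (intro diag_matrix_closed) auto
    have "P \<star> inv\<^bsub>M\<^esub> g = E" if "P = E \<star> g" for P
      using that E g by (simp add: M.m_assoc M.Units_r_inv)
    moreover have "E $$ (j, j) \<noteq> \<zero>" using j by (simp add: E_def diag_matrix_entry)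
    ultimately have "\<exists>i<n. \<exists>j<n. (E \<star> g) $$ (i, j) \<noteq> \<zero>"
      using mat_mult_nonzero[of "E \<star> g" "inv\<^bsub>M\<^esub> g"] E g j by auto
    moreover have "E \<star> g \<star> \<rho> x = diag_matrix L n (\<lambda>_. \<psi> x) \<star> (E \<star> g)"
      if x: "x \<in> carrier Z" for x
    proof -
      have "E \<star> D x = diag_matrix L n (\<lambda>i. (if i = j then \<one> else \<zero>) \<otimes> \<chi> i x)"
        unfolding E_def D_def using \<chi> x by (intro diag_matrix_mult) (auto intro: char_value)
      also have "\<dots> = diag_matrix L n (\<lambda>i. \<psi> x \<otimes> (if i = j then \<one> else \<zero>))"
        unfolding diag_matrix_def using char_value[OF \<chi> x] j by (intro cong_mat) (auto simp: \<psi>)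
      also have "\<dots> = diag_matrix L n (\<lambda>_. \<psi> x) \<star> E"
        unfolding E_def \<psi> using \<chi>[OF j] x by (intro diag_matrix_mult[symmetric]) (auto intro: char_value)
      finally have "E \<star> D x = diag_matrix L n (\<lambda>_. \<psi> x) \<star> E" .
      moreover have "E \<star> g \<star> \<rho> x = E \<star> D x \<star> g"
        using E g \<rho>[OF x] Dc[OF x] gD[OF x] by (simp add: M.m_assoc)
      ultimately show ?thesis
        using E g scal[of \<psi> x] \<chi>[OF j] x \<psi> by (simp add: M.m_assoc)
    qed
    ultimately show "\<psi> \<in> eigenchars \<rho>"
      using E g \<chi>[OF j] \<psi> unfolding eigenchars_def by blast
  qed
qed

section \<open>Frobenius on matrices and on eigencharacters\<close>

definition frob_mat :: "'a mat \<Rightarrow> 'a mat" where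
  "frob_mat B = mat n n (\<lambda>(i, j). B $$ (i, j) [^] q)"

lemma frob_mat_entry: "i < n \<Longrightarrow> j < n \<Longrightarrow> frob_mat B $$ (i, j) = B $$ (i, j) [^] q"
  by (simp add: frob_mat_def)

lemma frob_mat_closed: "B \<in> carrier M \<Longrightarrow> frob_mat B \<in> carrier M"
  by (auto simp: frob_mat_def mat_carrier)

lemma frob_finsum:
  assumes "finite A" "f \<in> A \<rightarrow> carrier L"
  shows "finsum L f A [^] q = (\<Oplus>a\<in>A. f a [^] q)"
  using assms
proof (induction A rule: finite_induct)
  case (insert a A)
  then have "f \<in> A \<rightarrow> carrier L" "(\<lambda>a. f a [^] q) \<in> A \<rightarrow> carrier L" "f a \<in> carrier L" by auto
  with insert show ?case by (simp add: frob_add)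
qed (simp add: frob_zero)

lemma frob_mat_mult:
  assumes B: "B \<in> carrier M" and C: "C \<in> carrier M"
  shows "frob_mat (B \<star> C) = frob_mat B \<star> frob_mat C"
proof (rule mat_eqI)
  show "frob_mat (B \<star> C) \<in> carrier M" "frob_mat B \<star> frob_mat C \<in> carrier M"
    using B C frob_mat_closed by auto
  fix i j assume ij: "i < n" "j < n"
  then show "frob_mat (B \<star> C) $$ (i, j) = (frob_mat B \<star> frob_mat C) $$ (i, j)"
    unfolding frob_mat_entry[OF ij] mat_mult_entry[OF ij]
    using mat_entry[OF B] mat_entry[OF C]
    by (subst frob_finsum) (auto simp: frob_mat_entry nat_pow_distrib intro!: finsum_cong')
qed

lemma frob_mat_fixed_iff:
  assumes "B \<in> carrier M"
  shows "frob_mat B = B \<longleftrightarrow> (\<forall>i<n. \<forall>j<n. B $$ (i, j) \<in> K)"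
proof -
  have "frob_mat B = B \<longleftrightarrow> (\<forall>i<n. \<forall>j<n. frob_mat B $$ (i, j) = B $$ (i, j))"
    using mat_eqI[OF frob_mat_closed[OF assms] assms] by auto
  then show ?thesis
    using mat_entry[OF assms] by (auto simp: frob_mat_entry mem_K_iff)
qed

lemma frob_diag_matrix: "frob_mat (diag_matrix L n d) = diag_matrix L n (\<lambda>i. d i [^] q)"
  by (auto simp: frob_mat_def diag_matrix_def frob_zero)

lemma G_pow: "\<chi> \<in> carrier G \<Longrightarrow> x \<in> carrier Z \<Longrightarrow> (\<chi> [^]\<^bsub>G\<^esub> (k::nat)) x = \<chi> x [^] k"
  by (simp add: hom_group_pow[OF Z.group_axioms A.comm_group_axioms] Multiplicative_Group.nat_pow_mult_of)

text \<open>Frobenius is multiplicative on matrices and fixes those over \<open>K\<close>. Applied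
  to the equation defining an eigencharacter, it yields the same equation for the power
  \<open>q\<close> of the character.\<close>

lemma eigenchars_frob:
  assumes \<rho>: "\<rho> \<in> Hom_SL (KF) n r" and \<chi>: "\<chi> \<in> eigenchars \<rho>"
  shows "\<chi> [^]\<^bsub>G\<^esub> q \<in> eigenchars \<rho>"
proof -
  obtain P where c: "\<chi> \<in> carrier G" and P: "P \<in> carrier M" "\<exists>i<n. \<exists>j<n. P $$ (i, j) \<noteq> \<zero>"
    and eig: "\<And>x. x \<in> carrier Z \<Longrightarrow> P \<star> \<rho> x = diag_matrix L n (\<lambda>_. \<chi> x) \<star> P"
    using \<chi> by (auto simp: eigenchars_def)
  have "frob_mat P \<star> \<rho> x = diag_matrix L n (\<lambda>_. (\<chi> [^]\<^bsub>G\<^esub> q) x) \<star> frob_mat P"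
    if x: "x \<in> carrier Z" for x
  proof -
    have \<rho>x: "\<rho> x \<in> carrier M" "frob_mat (\<rho> x) = \<rho> x"
      using \<rho> x frob_mat_fixed_iff[of "\<rho> x"] by (auto simp: Hom_SL_K_iff)
    have "diag_matrix L n (\<lambda>_. \<chi> x) \<in> carrier M"
      using char_value[OF c x] by (intro diag_matrix_closed)
    then show ?thesis
      using frob_mat_mult[OF P(1) \<rho>x(1)] frob_mat_mult[OF _ P(1), of "diag_matrix L n (\<lambda>_. \<chi> x)"]
        eig[OF x] \<rho>x(2) by (simp add: frob_diag_matrix G_pow[OF c x])
  qed
  moreover have "\<exists>i<n. \<exists>j<n. frob_mat P $$ (i, j) \<noteq> \<zero>"
  proof -
    obtain i j where "i < n" "j < n" "P $$ (i, j) \<noteq> \<zero>" using P by blast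
    then have "frob_mat P $$ (i, j) \<noteq> \<zero>"
      using mat_entry[OF P(1)] by (simp add: frob_mat_entry)
    then show ?thesis using \<open>i < n\<close> \<open>j < n\<close> by blast
  qed
  ultimately show ?thesis
    using c frob_mat_closed[OF P(1)] by (auto simp: eigenchars_def)
qed

lemma char_prod_2:
  assumes "n = 2" "\<chi> 0 \<in> carrier G" "\<chi> 1 \<in> carrier G"
  shows "finprod G \<chi> {..<n} = \<chi> 0 \<otimes>\<^bsub>G\<^esub> \<chi> 1"
  using assms by (simp add: numeral_2_eq_2 lessThan_Suc G.m_comm)

lemma char_prod_3:
  assumes "n = 3" "\<chi> 0 \<in> carrier G" "\<chi> 1 \<in> carrier G" "\<chi> 2 \<in> carrier G"
  shows "finprod G \<chi> {..<n} = \<chi> 0 \<otimes>\<^bsub>G\<^esub> \<chi> 1 \<otimes>\<^bsub>G\<^esub> \<chi> 2"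
  using assms by (simp add: numeral_3_eq_3 numeral_2_eq_2 lessThan_Suc G.m_ac Pi_def)

text \<open>For \<open>n \<le> 3\<close> multiplicities are recovered from the set of characters because their product is
  trivial: \<open>a\<^sup>2 b = 1 = a b\<^sup>2\<close> forces \<open>a = b\<close>.\<close>

lemma ex_permutation:
  assumes \<chi>: "\<And>i. i < n \<Longrightarrow> \<chi> i \<in> carrier G" "finprod G \<chi> {..<n} = \<one>\<^bsub>G\<^esub>"
    and \<psi>: "\<And>i. i < n \<Longrightarrow> \<psi> i \<in> carrier G" "finprod G \<psi> {..<n} = \<one>\<^bsub>G\<^esub>"
    and eq: "\<chi> ` {..<n} = \<psi> ` {..<n}"
  shows "\<exists>p. p permutes {..<n} \<and> (\<forall>i<n. \<psi> i = \<chi> (p i))"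
proof -
  have "mset (map \<psi> [0..<n]) = mset (map \<chi> [0..<n])"
  proof -
    consider "n = 2" | "n = 3" using n by blast
    then show ?thesis
    proof cases
      case 1
      have "{..<2::nat} = {0, 1}" by auto
      then have "{\<chi> 0, \<chi> 1} = {\<psi> 0, \<psi> 1}" using eq 1 by simp
      then have "{#\<psi> 0, \<psi> 1#} = {#\<chi> 0, \<chi> 1#}" by (auto simp: doubleton_eq_iff)
      then show ?thesis using 1 by (simp add: upt_rec)
    next
      case 2
      have "{..<3::nat} = {0, 1, 2}" by auto
      then have s: "{\<chi> 0, \<chi> 1, \<chi> 2} = {\<psi> 0, \<psi> 1, \<psi> 2}" using eq 2 by simp
      have c: "\<chi> 0 \<in> carrier G" "\<chi> 1 \<in> carrier G" "\<chi> 2 \<in> carrier G"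
        "\<psi> 0 \<in> carrier G" "\<psi> 1 \<in> carrier G" "\<psi> 2 \<in> carrier G" using \<chi> \<psi> 2 by auto
      have p: "\<chi> 0 \<otimes>\<^bsub>G\<^esub> \<chi> 1 \<otimes>\<^bsub>G\<^esub> \<chi> 2 = \<psi> 0 \<otimes>\<^bsub>G\<^esub> \<psi> 1 \<otimes>\<^bsub>G\<^esub> \<psi> 2"
        using \<chi>(2) \<psi>(2) char_prod_3[OF 2] c by simp
      have *: "{#d, e, f#} = {#a, b, c#}"
        if "{a, b, c} = {d, e, f}" "a \<otimes>\<^bsub>G\<^esub> b \<otimes>\<^bsub>G\<^esub> c = d \<otimes>\<^bsub>G\<^esub> e \<otimes>\<^bsub>G\<^esub> f"
          "a \<in> carrier G" "b \<in> carrier G" "c \<in> carrier G" for a b c d e f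
      proof -
        have "d \<in> {a, b, c}" "e \<in> {a, b, c}" "f \<in> {a, b, c}" using that by auto
        moreover have "a \<in> {d, e, f}" "b \<in> {d, e, f}" "c \<in> {d, e, f}" using that by auto
        ultimately show ?thesis
          using that(2-) by (auto simp: G.m_ac G.m_assoc)
      qed
      have "{#\<psi> 0, \<psi> 1, \<psi> 2#} = {#\<chi> 0, \<chi> 1, \<chi> 2#}" by (rule *[OF s p c(1-3)])
      then show ?thesis using 2 by (simp add: upt_rec numeral_3_eq_3 numeral_2_eq_2)
    qed
  qed
  then obtain p where p: "p permutes {..<length (map \<chi> [0..<n])}"
      "permute_list p (map \<chi> [0..<n]) = map \<psi> [0..<n]"
    using mset_eq_permutation by blast
  have "\<psi> i = \<chi> (p i)" if "i < n" for i
  proof -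
    have "p i < n" using p(1) that permutes_in_image[of p "{..<n}"] by auto
    then show ?thesis
      using arg_cong[OF p(2), of "\<lambda>l. l ! i"] permute_list_nth[OF p(1), of i] that by simp
  qed
  then show ?thesis using p(1) by auto
qed

text \<open>If \<open>h\<close> conjugates one representation into the other, then \<open>g\<close>
  times the inverse of \<open>h\<close> diagonalizes the second by the characters of the first.
  Conversely, equal sets give diagonal forms that differ by a permutation matrix.\<close>

lemma conj_rel_iff_eigenchars:
  assumes \<rho>: "\<rho> \<in> diag_Hom_SL L K n r" and \<rho>': "\<rho>' \<in> diag_Hom_SL L K n r"
  shows "(\<rho>, \<rho>') \<in> conj_rel L K n r \<longleftrightarrow> eigenchars \<rho> = eigenchars \<rho>'"
proof -
  obtain g \<chi> where d: "diagonalizes g \<rho> \<chi>" using ex_diagonalizes[OF \<rho>] by blast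
  obtain g' \<chi>' where d': "diagonalizes g' \<rho>' \<chi>'" using ex_diagonalizes[OF \<rho>'] by blast
  have \<rho>H: "\<rho> \<in> Hom_SL (KF) n r" "\<rho>' \<in> Hom_SL (KF) n r"
    using \<rho> \<rho>' by (auto simp: diag_Hom_SL_def)
  have \<rho>c: "\<rho> x \<in> carrier M" "\<rho>' x \<in> carrier M" if "x \<in> carrier Z" for x
    using \<rho>H that by (auto simp: Hom_SL_K_iff)
  have e: "eigenchars \<rho> = \<chi> ` {..<n}" "eigenchars \<rho>' = \<chi>' ` {..<n}"
    using eigenchars_eq[OF \<rho>c(1) d] eigenchars_eq[OF \<rho>c(2) d'] by auto
  have g: "g \<in> Units M" "g' \<in> Units M" using d d' by (auto simp: diagonalizes_def)
  have \<chi>: "\<And>i. i < n \<Longrightarrow> \<chi> i \<in> carrier G" "\<And>i. i < n \<Longrightarrow> \<chi>' i \<in> carrier G"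
    using d d' by (auto simp: diagonalizes_def)
  have conj_comp: "mat_conj L n (h \<star> k) B = mat_conj L n h (mat_conj L n k B)"
    if "h \<in> Units M" "k \<in> Units M" "B \<in> carrier M" for h k B
  proof -
    have "inv\<^bsub>M\<^esub> (h \<star> k) = inv\<^bsub>M\<^esub> k \<star> inv\<^bsub>M\<^esub> h"
      using U.inv_mult_group[of h k] that M.units_of_inv by (simp add: units_of_carrier units_of_mult)
    then show ?thesis using that by (simp add: mat_conj_def M.m_assoc M.Units_closed)
  qed
  show ?thesis
  proof
    assume "(\<rho>, \<rho>') \<in> conj_rel L K n r"
    then obtain h where h: "h \<in> Units M"
      and eq: "\<And>i. i < r \<Longrightarrow> \<rho>' (std_basis r i) = mat_conj L n h (\<rho> (std_basis r i))"
      by (auto simp: conj_rel_def)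
    have eqZ: "\<rho>' x = mat_conj L n h (\<rho> x)" if "x \<in> carrier Z" for x
      using hom_Z_pow_eqI[OF U.group_axioms Hom_SL_K_hom_units[OF \<rho>H(2)]
          mat_conj_hom[OF Hom_SL_K_hom_units[OF \<rho>H(1)] h]] eq that by blast
    have inv: "mat_conj L n (g \<star> inv\<^bsub>M\<^esub> h) (\<rho>' x) = mat_conj L n g (\<rho> x)" if x: "x \<in> carrier Z" for x
    proof -
      have "mat_conj L n (inv\<^bsub>M\<^esub> h) (mat_conj L n h (\<rho> x)) = \<rho> x"
        using \<rho>c[OF x] h conj_comp[of "inv\<^bsub>M\<^esub> h" h "\<rho> x"] by (simp add: M.Units_l_inv) (simp add: mat_conj_def)
      then show ?thesis
        using conj_comp[of g "inv\<^bsub>M\<^esub> h" "\<rho>' x"] g h \<rho>c[OF x] by (simp add: eqZ[OF x] mat_conj_closed)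
    qed
    have "diagonalizes (g \<star> inv\<^bsub>M\<^esub> h) \<rho>' \<chi>"
      using d h g inv by (simp add: diagonalizes_def)
    then show "eigenchars \<rho> = eigenchars \<rho>'"
      using eigenchars_eq[OF \<rho>c(2)] e by auto
  next
    assume "eigenchars \<rho> = eigenchars \<rho>'"
    then obtain p where p: "p permutes {..<n}" "\<And>i. i < n \<Longrightarrow> \<chi>' i = \<chi> (p i)"
      using ex_permutation[OF \<chi>(1) diagonalizes_prod[OF \<rho> d] \<chi>(2) diagonalizes_prod[OF \<rho>' d']] e by auto
    \<comment> \<open>Goes to the first diagonal form, permutes the diagonal, and returns from the
      second diagonal form.\<close>
    define h where "h = inv\<^bsub>M\<^esub> g' \<star> (perm_matrix L n p \<star> g)"
    have P: "perm_matrix L n p \<in> Units M" by (rule perm_matrix_Units[OF p(1)])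
    have h: "h \<in> Units M" using g P by (simp add: h_def)
    have "\<rho>' x = mat_conj L n h (\<rho> x)" if x: "x \<in> carrier Z" for x
    proof -
      have Dc: "diag_matrix L n (\<lambda>i. \<chi> i x) \<in> carrier M" "diag_matrix L n (\<lambda>i. \<chi>' i x) \<in> carrier M"
        using \<chi> x by (auto intro!: diag_matrix_closed char_value)
      have "mat_conj L n (perm_matrix L n p) (diag_matrix L n (\<lambda>i. \<chi> i x)) = diag_matrix L n (\<lambda>i. \<chi> (p i) x)"
      proof (subst mat_conj_eq_iff[OF P Dc(1)])
        have "p i < n" if "i < n" for i using p(1) that permutes_in_image[of p "{..<n}"] by auto
        then show "diag_matrix L n (\<lambda>i. \<chi> (p i) x) \<in> carrier M"
          using \<chi> x by (auto intro!: diag_matrix_closed char_value)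
        show "perm_matrix L n p \<star> diag_matrix L n (\<lambda>i. \<chi> i x)
          = diag_matrix L n (\<lambda>i. \<chi> (p i) x) \<star> perm_matrix L n p"
          using \<chi> x by (intro perm_matrix_diag_matrix p(1)) (auto intro: char_value)
      qed
      also have "diag_matrix L n (\<lambda>i. \<chi> (p i) x) = diag_matrix L n (\<lambda>i. \<chi>' i x)"
        unfolding diag_matrix_def using p(2) by (intro cong_mat) auto
      also have "\<dots> = mat_conj L n g' (\<rho>' x)" using d' x by (simp add: diagonalizes_def)
      also have "diag_matrix L n (\<lambda>i. \<chi> i x) = mat_conj L n g (\<rho> x)" using d x by (simp add: diagonalizes_def)
      finally have eq: "mat_conj L n (perm_matrix L n p) (mat_conj L n g (\<rho> x)) = mat_conj L n g' (\<rho>' x)" .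
      have "mat_conj L n h (\<rho> x) = mat_conj L n (inv\<^bsub>M\<^esub> g') (mat_conj L n g' (\<rho>' x))"
        using g P \<rho>c[OF x] by (simp add: h_def conj_comp mat_conj_closed eq)
      also have "\<dots> = \<rho>' x"
        using g \<rho>c[OF x] conj_comp[of "inv\<^bsub>M\<^esub> g'" g' "\<rho>' x"] by (simp add: M.Units_l_inv) (simp add: mat_conj_def)
      finally show ?thesis by simp
    qed
    then show "(\<rho>, \<rho>') \<in> conj_rel L K n r"
      using \<rho> \<rho>' h std_basis_closed by (auto simp: conj_rel_def)
  qed
qed

end

section \<open>Descent to the finite field and the action on points\<close>

context SL_character_variety
begin

text \<open>An explicit form of Lang's theorem: if \<open>V\<close> satisfies \<open>V\<^sup>(\<^sup>q\<^sup>) = P V\<close> for the permutation matrix \<open>P\<close>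
  by which Frobenius permutes the characters, then conjugating by \<open>V\<close> descends the diagonal
  representation to \<open>K\<close>.\<close>

lemma eigenchars_surj:
  assumes \<chi>: "\<And>i. i < n \<Longrightarrow> \<chi> i \<in> carrier G" "finprod G \<chi> {..<n} = \<one>\<^bsub>G\<^esub>"
    and w: "w permutes {..<n}" and V: "V \<in> Units M"
    and Vw: "\<And>i j. i < n \<Longrightarrow> j < n \<Longrightarrow> V $$ (i, j) [^] q = V $$ (w i, j)"
    and \<chi>w: "\<And>i. i < n \<Longrightarrow> \<chi> i [^]\<^bsub>G\<^esub> q = \<chi> (w i)"
  shows "\<chi> ` {..<n} \<in> eigenchars ` diag_Hom_SL L K n r"
proof -
  have win: "w i < n" if "i < n" for i using w that permutes_in_image[of w "{..<n}"] by auto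
  define D where "D x = diag_matrix L n (\<lambda>i. \<chi> i x)" for x
  define P where "P = perm_matrix L n w"
  define \<rho> where "\<rho> = (\<lambda>x\<in>carrier Z. mat_conj L n (inv\<^bsub>M\<^esub> V) (D x))"
  have Vc: "V \<in> carrier M" "inv\<^bsub>M\<^esub> V \<in> Units M" "inv\<^bsub>M\<^esub> V \<in> carrier M" using V by auto
  have \<chi>x: "\<chi> i x \<in> carrier L" "\<chi> i x \<noteq> \<zero>" if "i < n" "x \<in> carrier Z" for i x
    using char_value[OF \<chi>(1)] that by auto
  have Dc: "D x \<in> carrier M" if "x \<in> carrier Z" for x
    unfolding D_def using \<chi>x that by (intro diag_matrix_closed) auto
  have \<rho>c: "\<rho> x \<in> carrier M" if "x \<in> carrier Z" for x
    using that Vc Dc by (simp add: \<rho>_def mat_conj_closed)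
  have P: "P \<in> Units M" unfolding P_def by (rule perm_matrix_Units[OF w])
  have VD: "V \<star> \<rho> x = D x \<star> V" if x: "x \<in> carrier Z" for x
  proof -
    have "\<rho> x = inv\<^bsub>M\<^esub> V \<star> (D x \<star> V)"
      using V Vc Dc[OF x] x by (simp add: \<rho>_def mat_conj_def M.Units_inv_inv M.m_assoc)
    then show ?thesis
      using V Vc Dc[OF x] by (simp add: M.m_assoc[symmetric] M.Units_r_inv)
  qed
  have conj: "mat_conj L n V (\<rho> x) = D x" if x: "x \<in> carrier Z" for x
    using mat_conj_eq_iff[OF V \<rho>c[OF x] Dc[OF x]] VD[OF x] by simp
  have frobV: "frob_mat V = P \<star> V"
    using Vc(1) P Vw win by (intro mat_eqI[OF frob_mat_closed])
      (auto simp: P_def frob_mat_entry perm_matrix_mult_entry[OF _ w])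
  have frob\<rho>: "frob_mat (\<rho> x) = \<rho> x" if x: "x \<in> carrier Z" for x
  proof -
    have frobD: "frob_mat (D x) = diag_matrix L n (\<lambda>i. \<chi> (w i) x)"
    proof -
      have "\<chi> i x [^] q = \<chi> (w i) x" if "i < n" for i
        using G_pow[OF \<chi>(1)[OF that] x, of q] \<chi>w[OF that] by simp
      then show ?thesis unfolding D_def frob_diag_matrix unfolding diag_matrix_def by (intro cong_mat) auto
    qed
    have fc: "frob_mat (\<rho> x) \<in> carrier M" "frob_mat (D x) \<in> carrier M"
      using frob_mat_closed \<rho>c[OF x] Dc[OF x] by auto
    have PD: "P \<star> D x = frob_mat (D x) \<star> P"
      unfolding P_def frobD unfolding D_def using \<chi>x x by (intro perm_matrix_diag_matrix[OF w]) auto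
    \<comment> \<open>Frobenius replaces \<open>V\<close> by \<open>P \<star> V\<close> and the
      diagonal by its conjugate under \<open>P\<close>; the two changes cancel. Hence
      \<open>\<rho> x\<close> and its Frobenius image agree after multiplication by the unit
      \<open>P \<star> V\<close>, and the entries lie in \<open>K\<close>.\<close>
    have "P \<star> V \<star> frob_mat (\<rho> x) = frob_mat (D x) \<star> (P \<star> V)"
      using frob_mat_mult[OF Vc(1) \<rho>c[OF x]] frob_mat_mult[OF Dc[OF x] Vc(1)] VD[OF x] frobV by simp
    also have "\<dots> = P \<star> D x \<star> V"
      using PD P Vc fc by (simp add: M.m_assoc M.Units_closed)
    also have "\<dots> = P \<star> V \<star> \<rho> x"
      using VD[OF x] P Vc Dc[OF x] \<rho>c[OF x] by (simp add: M.m_assoc M.Units_closed)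
    finally have eq: "P \<star> V \<star> frob_mat (\<rho> x) = P \<star> V \<star> \<rho> x" .
    have "P \<star> V \<in> Units M" using P V by simp
    from M.Units_l_cancel[OF this fc(1) \<rho>c[OF x]] eq show ?thesis by simp
  qed
  have Dm: "D (x \<otimes>\<^bsub>Z\<^esub> y) = D x \<star> D y" if "x \<in> carrier Z" "y \<in> carrier Z" for x y
  proof -
    have "D x \<star> D y = diag_matrix L n (\<lambda>i. \<chi> i x \<otimes> \<chi> i y)"
      unfolding D_def using \<chi>x that by (intro diag_matrix_mult) auto
    also have "\<dots> = D (x \<otimes>\<^bsub>Z\<^esub> y)"
      unfolding D_def diag_matrix_def using \<chi>(1) that
      by (intro cong_mat) (auto simp: hom_group_carrier hom_def)
    finally show ?thesis by simp
  qed
  have "\<rho> (x \<otimes>\<^bsub>Z\<^esub> y) = \<rho> x \<star> \<rho> y" if xy: "x \<in> carrier Z" "y \<in> carrier Z" for x y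
  proof -
    have xyc: "x \<otimes>\<^bsub>Z\<^esub> y \<in> carrier Z" using xy by simp
    have "V \<star> \<rho> (x \<otimes>\<^bsub>Z\<^esub> y) = D x \<star> (D y \<star> V)"
      using VD[OF xyc] Dm[OF xy] Dc xy Vc by (simp add: M.m_assoc)
    also have "\<dots> = D x \<star> V \<star> \<rho> y"
      using VD[OF xy(2)] Dc xy Vc \<rho>c by (simp add: M.m_assoc)
    also have "\<dots> = V \<star> (\<rho> x \<star> \<rho> y)"
      using VD[OF xy(1)] Dc xy Vc \<rho>c by (simp add: M.m_assoc[symmetric])
    finally show ?thesis
      using M.Units_l_cancel[OF V \<rho>c[OF xyc] M.m_closed[OF \<rho>c \<rho>c]] xy by simp
  qed
  moreover have "mat_det L n (\<rho> x) = \<one>" if x: "x \<in> carrier Z" for x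
  proof -
    have "mat_det L n (\<rho> x) = mat_det L n (D x)"
      using mat_det_conj[OF n V \<rho>c[OF x]] conj[OF x] by simp
    also have "\<dots> = (\<Otimes>i\<in>{..<n}. \<chi> i x)"
      unfolding D_def using \<chi>x x by (intro mat_det_diag_matrix[OF n]) auto
    also have "\<dots> = (finprod G \<chi> {..<n}) x"
      using finprod_hom_group_apply[OF _ _ x, of "{..<n}" \<chi>] \<chi>(1) by auto
    also have "\<dots> = \<one>" unfolding \<chi>(2) using x by (simp add: hom_group_one)
    finally show ?thesis .
  qed
  ultimately have \<rho>H: "\<rho> \<in> Hom_SL (KF) n r"
    unfolding Hom_SL_K_iff
  proof (intro conjI ballI)
    show "\<rho> \<in> extensional (carrier Z)" by (simp add: \<rho>_def)
    fix x assume x: "x \<in> carrier Z"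
    show "\<forall>i<n. \<forall>j<n. \<rho> x $$ (i, j) \<in> K"
      using frob_mat_fixed_iff[OF \<rho>c[OF x]] frob\<rho>[OF x] by simp
  qed (use \<rho>c in auto)
  have "\<rho> \<in> diag_Hom_SL L K n r"
    unfolding diag_Hom_SL_def using \<rho>H V conj[OF std_basis_closed]
    by (auto simp: D_def is_diagonal_diag_matrix intro!: bexI[of _ V])
  moreover have "diagonalizes V \<rho> \<chi>"
    using V \<chi>(1) conj by (simp add: diagonalizes_def D_def)
  then have "\<chi> ` {..<n} = eigenchars \<rho>"
    using eigenchars_eq[of \<rho> V \<chi>] \<rho>c by simp
  ultimately show ?thesis by (simp add: imageI)
qed

section \<open>Conjugacy classes as spectra, and the action by precomposition\<close>

definition precomp :: "((nat \<Rightarrow> int) \<Rightarrow> (nat \<Rightarrow> int)) \<Rightarrow> ((nat \<Rightarrow> int) \<Rightarrow> 'c) \<Rightarrow> (nat \<Rightarrow> int) \<Rightarrow> 'c" where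
  "precomp \<beta> f = compose (carrier Z) f \<beta>"

lemma precomp_apply: "x \<in> carrier Z \<Longrightarrow> precomp \<beta> f x = f (\<beta> x)"
  by (simp add: precomp_def compose_def)

lemma precomp_cancel:
  assumes "\<And>x. x \<in> carrier Z \<Longrightarrow> \<alpha> x \<in> carrier Z" "\<And>x. x \<in> carrier Z \<Longrightarrow> \<beta> (\<alpha> x) = x"
    and "f \<in> extensional (carrier Z)"
  shows "precomp \<alpha> (precomp \<beta> f) = f"
  using assms by (auto simp: precomp_def compose_def extensional_def)

lemma precomp_G: "\<beta> \<in> hom Z Z \<Longrightarrow> \<chi> \<in> carrier G \<Longrightarrow> precomp \<beta> \<chi> \<in> carrier G"
  by (auto simp: hom_group_carrier hom_def precomp_def compose_def Pi_iff)

text \<open>The same \<open>g\<close> diagonalizes the new representation, with each character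
  precomposed.\<close>

lemma eigenchars_precomp:
  assumes \<rho>: "\<rho> \<in> diag_Hom_SL L K n r" and \<beta>: "\<beta> \<in> hom Z Z"
  shows "precomp \<beta> \<rho> \<in> diag_Hom_SL L K n r"
    and "eigenchars (precomp \<beta> \<rho>) = precomp \<beta> ` eigenchars \<rho>"
proof -
  obtain g \<chi> where d: "diagonalizes g \<rho> \<chi>" using ex_diagonalizes[OF \<rho>] by blast
  have \<rho>H: "\<rho> \<in> Hom_SL (KF) n r" using \<rho> by (simp add: diag_Hom_SL_def)
  have \<beta>x: "\<beta> x \<in> carrier Z" if "x \<in> carrier Z" for x using \<beta> that by (auto simp: hom_def)
  have "\<beta> (x \<otimes>\<^bsub>Z\<^esub> y) = \<beta> x \<otimes>\<^bsub>Z\<^esub> \<beta> y" if "x \<in> carrier Z" "y \<in> carrier Z" for x y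
    using hom_mult[OF \<beta> that] .
  then have H: "precomp \<beta> \<rho> \<in> Hom_SL (KF) n r"
    using \<rho>H \<beta>x unfolding Hom_SL_K_iff by (simp add: precomp_apply) (simp add: precomp_def)
  have d': "diagonalizes g (precomp \<beta> \<rho>) (\<lambda>i. precomp \<beta> (\<chi> i))"
    using d \<beta>x precomp_G[OF \<beta>] by (simp add: diagonalizes_def precomp_apply)
  then show "precomp \<beta> \<rho> \<in> diag_Hom_SL L K n r"
    unfolding diag_Hom_SL_def using H std_basis_closed
    by (auto simp: diagonalizes_def is_diagonal_diag_matrix intro!: bexI[of _ g])
  have "eigenchars (precomp \<beta> \<rho>) = (\<lambda>i. precomp \<beta> (\<chi> i)) ` {..<n}"
    using H by (intro eigenchars_eq[OF _ d']) (simp add: Hom_SL_K_iff)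
  moreover have "eigenchars \<rho> = \<chi> ` {..<n}"
    using \<rho>H by (intro eigenchars_eq[OF _ d]) (simp add: Hom_SL_K_iff)
  ultimately show "eigenchars (precomp \<beta> \<rho>) = precomp \<beta> ` eigenchars \<rho>" by auto
qed

definition spectra :: "((nat \<Rightarrow> int) \<Rightarrow> 'a) set set" where
  "spectra = eigenchars ` diag_Hom_SL L K n r"

text \<open>On \<open>spectra\<close> this inverts the passage from a conjugacy class to its set of
  eigencharacters, so points can be counted as sets of characters.\<close>

definition point :: "((nat \<Rightarrow> int) \<Rightarrow> 'a) set \<Rightarrow> ((nat \<Rightarrow> int) \<Rightarrow> 'a mat) set" where
  "point S = {\<rho> \<in> diag_Hom_SL L K n r. eigenchars \<rho> = S}"

lemma char_variety_eq: "char_variety L K n r = point ` spectra"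
proof -
  have "conj_rel L K n r `` {\<rho>} = point (eigenchars \<rho>)" if "\<rho> \<in> diag_Hom_SL L K n r" for \<rho>
  proof -
    have "\<rho>' \<in> diag_Hom_SL L K n r" if "(\<rho>, \<rho>') \<in> conj_rel L K n r" for \<rho>'
      using that by (simp add: conj_rel_def)
    then show ?thesis using conj_rel_iff_eigenchars[OF that] unfolding point_def by blast
  qed
  then show ?thesis unfolding char_variety_def quotient_def spectra_def by auto
qed

lemma inj_on_point: "inj_on point spectra"
  unfolding inj_on_def spectra_def point_def by blast

lemma card_char_variety: "card (char_variety L K n r) = card spectra"
  unfolding char_variety_eq by (rule card_image[OF inj_on_point])

lemma AutoGroup_Z: "group (AutoGroup Z)"
  by (rule Z.AutoGroup)

text \<open>Z^r is abelian, so outer automorphisms are singleton cosets and the union in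
  \<open>out_act\<close> has a single term.\<close>

lemma Inn_Z: "Inn Z = {\<one>\<^bsub>AutoGroup Z\<^esub>}"
proof -
  have "(\<lambda>x\<in>carrier Z. g \<otimes>\<^bsub>Z\<^esub> x \<otimes>\<^bsub>Z\<^esub> inv\<^bsub>Z\<^esub> g) = (\<lambda>x\<in>carrier Z. x)" if "g \<in> carrier Z" for g
  proof (rule restrict_ext)
    fix x assume "x \<in> carrier Z"
    then show "g \<otimes>\<^bsub>Z\<^esub> x \<otimes>\<^bsub>Z\<^esub> inv\<^bsub>Z\<^esub> g = x"
      using that by (metis Z.inv_closed Z.m_assoc Z.m_comm Z.r_inv Z.r_one)
  qed
  then show ?thesis
    unfolding Inn_def using Z.one_closed by (auto simp: AutoGroup_def BijGroup_def image_iff)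
qed

lemma carrier_Out_Z: "c \<in> carrier (Out Z) \<Longrightarrow> \<exists>\<alpha>\<in>auto Z. c = {\<alpha>}"
proof -
  interpret Au: group "AutoGroup Z" by (rule AutoGroup_Z)
  assume "c \<in> carrier (Out Z)"
  then obtain \<alpha> where "\<alpha> \<in> carrier (AutoGroup Z)" "c = Inn Z #>\<^bsub>AutoGroup Z\<^esub> \<alpha>"
    unfolding Out_def FactGroup_def RCOSETS_def by auto
  then show ?thesis
    unfolding Inn_Z r_coset_def by (simp add: Au.l_one) (simp add: AutoGroup_def)
qed

text \<open>Here \<open>\<beta>\<close> is the inverse of \<open>\<alpha>\<close>. Precomposition
  with \<open>\<alpha>\<close> undoes the action, which gives the whole class on the right and not
  merely a subset.\<close>

lemma aut_act_point:
  assumes \<alpha>: "\<alpha> \<in> auto Z" and S: "S \<in> spectra"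
  shows "\<exists>\<beta>\<in>hom Z Z. aut_act Z \<alpha> ` point S = point (precomp \<beta> ` S)"
proof
  interpret Au: group "AutoGroup Z" by (rule AutoGroup_Z)
  define \<beta> where "\<beta> = inv\<^bsub>AutoGroup Z\<^esub> \<alpha>"
  have car: "carrier (AutoGroup Z) = auto Z" by (simp add: AutoGroup_def)
  have "\<beta> \<in> auto Z" using Au.inv_closed[of \<alpha>] \<alpha> by (simp add: car \<beta>_def)
  then show \<beta>: "\<beta> \<in> hom Z Z" by (simp add: auto_def)
  have \<alpha>h: "\<alpha> \<in> hom Z Z" using \<alpha> by (simp add: auto_def)
  have mult: "f \<otimes>\<^bsub>AutoGroup Z\<^esub> g = compose (carrier Z) f g" if "f \<in> auto Z" "g \<in> auto Z" for f g
    using that by (simp add: AutoGroup_def BijGroup_def auto_def)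
  have "compose (carrier Z) \<alpha> \<beta> = (\<lambda>x\<in>carrier Z. x)" "compose (carrier Z) \<beta> \<alpha> = (\<lambda>x\<in>carrier Z. x)"
    using Au.l_inv[of \<alpha>] Au.r_inv[of \<alpha>] mult \<alpha> \<open>\<beta> \<in> auto Z\<close> unfolding car \<beta>_def[symmetric]
    by (simp_all add: AutoGroup_def BijGroup_def)
  then have inv: "\<alpha> (\<beta> x) = x" "\<beta> (\<alpha> x) = x" if "x \<in> carrier Z" for x
    using that by (auto simp: compose_def fun_eq_iff split: if_splits)
  have act: "aut_act Z \<alpha> = precomp \<beta>" by (auto simp: aut_act_def precomp_def \<beta>_def)
  have cl: "\<alpha> x \<in> carrier Z" "\<beta> x \<in> carrier Z" if "x \<in> carrier Z" for x
    using \<alpha>h \<beta> that by (auto simp: hom_def)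
  show "aut_act Z \<alpha> ` point S = point (precomp \<beta> ` S)"
    unfolding act
  proof (intro equalityI subsetI)
    fix \<rho>' assume "\<rho>' \<in> precomp \<beta> ` point S"
    then show "\<rho>' \<in> point (precomp \<beta> ` S)"
      using eigenchars_precomp[OF _ \<beta>] by (auto simp: point_def)
  next
    fix \<rho>' assume "\<rho>' \<in> point (precomp \<beta> ` S)"
    then have \<rho>': "\<rho>' \<in> diag_Hom_SL L K n r" "eigenchars \<rho>' = precomp \<beta> ` S" by (auto simp: point_def)
    have "precomp \<alpha> ` precomp \<beta> ` S = S"
    proof -
      have "S \<subseteq> carrier G" using S by (auto simp: spectra_def eigenchars_def)
      then have "\<chi> \<in> extensional (carrier Z)" if "\<chi> \<in> S" for \<chi>
        using that hom_group_carrier by blast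
      then have "precomp \<alpha> (precomp \<beta> \<chi>) = \<chi>" if "\<chi> \<in> S" for \<chi>
        using that by (intro precomp_cancel[OF cl(1) inv(2)])
      then show ?thesis by (simp add: image_image)
    qed
    then have "precomp \<alpha> \<rho>' \<in> point S"
      using eigenchars_precomp[OF \<rho>'(1) \<alpha>h] \<rho>'(2) by (simp add: point_def)
    moreover have "\<rho>' \<in> extensional (carrier Z)"
      using \<rho>'(1) by (auto simp: diag_Hom_SL_def Hom_SL_def)
    then have "precomp \<beta> (precomp \<alpha> \<rho>') = \<rho>'"
      by (intro precomp_cancel[OF cl(2) inv(1)])
    ultimately show "\<rho>' \<in> precomp \<beta> ` point S" by (metis image_eqI)
  qed
qed

text \<open>Only membership in a stable family is tracked; how the orbit sits inside it is left
  open.\<close>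

lemma card_orbit_le:
  assumes S: "S \<in> spectra" "S \<in> Y" and Y: "finite Y"
    and inv: "\<And>\<beta> S. \<beta> \<in> hom Z Z \<Longrightarrow> S \<in> Y \<Longrightarrow> precomp \<beta> ` S \<in> Y"
  shows "card (orbit (Out Z) (out_act Z) (point S)) \<le> card Y"
proof -
  have "orbit (Out Z) (out_act Z) (point S) \<subseteq> point ` Y"
  proof
    fix u assume "u \<in> orbit (Out Z) (out_act Z) (point S)"
    then obtain c where c: "c \<in> carrier (Out Z)" "u = out_act Z c (point S)"
      by (auto simp: orbit_def)
    then obtain \<alpha> where \<alpha>: "\<alpha> \<in> auto Z" "c = {\<alpha>}" using carrier_Out_Z by blast
    then obtain \<beta> where "\<beta> \<in> hom Z Z" "u = point (precomp \<beta> ` S)"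
      using aut_act_point[OF \<alpha>(1) S(1)] c by (auto simp: out_act_def)
    then show "u \<in> point ` Y" using inv S(2) by blast
  qed
  then show ?thesis
    by (meson Y card_image_le card_mono finite_imageI le_trans)
qed

end

section \<open>Counting Frobenius-stable sets of characters\<close>

lemma card_eq_sum_fibres:
  assumes "finite A" "finite B" "f ` A \<subseteq> B"
  shows "card A = (\<Sum>y\<in>B. card {x \<in> A. f x = y})"
  using sum.group[OF assms, of "\<lambda>_. 1::nat"] by simp

lemma card_le_mult_card_image:
  assumes "finite A" "\<And>x. x \<in> A \<Longrightarrow> card {y \<in> A. f y = f x} \<le> k"
  shows "card A \<le> k * card (f ` A)"
proof -
  have "card A = (\<Sum>y\<in>f ` A. card {x \<in> A. f x = y})"
    using assms by (intro card_eq_sum_fibres) auto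
  also have "\<dots> \<le> (\<Sum>y\<in>f ` A. k)" using assms(2) by (intro sum_mono) auto
  finally show ?thesis by (simp add: mult.commute)
qed

text \<open>A fibre of \<open>f\<close> contains two elements unless it meets a fixed point of
  \<open>s\<close>, and counting fixed points twice repairs that case. With \<open>s\<close> an
  inversion, a swap or Frobenius this gives the upper bound for each type.\<close>

lemma two_card_image_le:
  assumes A: "finite A" and s: "\<And>x. x \<in> A \<Longrightarrow> s x \<in> A" "\<And>x. x \<in> A \<Longrightarrow> f (s x) = f x"
  shows "2 * card (f ` A) \<le> card A + card {x \<in> A. s x = x}"
proof -
  let ?F = "{x \<in> A. s x = x}"
  have "2 \<le> card {x \<in> A. f x = y} + card {x \<in> ?F. f x = y}" if "y \<in> f ` A" for y
  proof -
    obtain x where x: "x \<in> A" "f x = y" using \<open>y \<in> f ` A\<close> by auto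
    have fin: "finite {x \<in> A. f x = y}" "finite {x \<in> ?F. f x = y}" using A by auto
    show ?thesis
    proof (cases "s x = x")
      case True
      then have "{x} \<subseteq> {x \<in> A. f x = y}" "{x} \<subseteq> {x \<in> ?F. f x = y}" using x by auto
      from card_mono[OF fin(1) this(1)] card_mono[OF fin(2) this(2)] show ?thesis by simp
    next
      case False
      have "{x, s x} \<subseteq> {x \<in> A. f x = y}" using x s by auto
      from card_mono[OF fin(1) this] False show ?thesis by simp
    qed
  qed
  then have "(\<Sum>y\<in>f ` A. 2) \<le> (\<Sum>y\<in>f ` A. card {x \<in> A. f x = y} + card {x \<in> ?F. f x = y})"
    by (intro sum_mono)
  also have "\<dots> = card A + card ?F"
    using A card_eq_sum_fibres[of A "f ` A" f] card_eq_sum_fibres[of ?F "f ` A" f]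
    by (simp add: sum.distrib image_mono)
  finally show ?thesis by simp
qed

context comm_group
begin

definition torsion :: "nat \<Rightarrow> 'a set" where
  "torsion m = {x \<in> carrier G. x [^] m = \<one>}"

lemma torsion_closed: "x \<in> torsion m \<Longrightarrow> x \<in> carrier G"
  by (simp add: torsion_def)

lemma torsion_mult: "x \<in> torsion m \<Longrightarrow> y \<in> torsion m \<Longrightarrow> x \<otimes> y \<in> torsion m"
  by (simp add: torsion_def nat_pow_distrib)

lemma torsion_inv: "x \<in> torsion m \<Longrightarrow> inv x \<in> torsion m"
  by (simp add: torsion_def nat_pow_inv)

lemma torsion_pow: "x \<in> torsion m \<Longrightarrow> x [^] (k::nat) \<in> torsion m"
  by (simp add: torsion_def nat_pow_pow) (metis nat_pow_one nat_pow_pow mult.commute)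

lemma torsion_dvd: "x \<in> torsion m \<Longrightarrow> m dvd k \<Longrightarrow> x \<in> torsion k"
  by (auto simp: torsion_def dvd_def nat_pow_pow[symmetric])

lemma torsion_diff:
  assumes "x \<in> torsion m" "x \<in> torsion (m + k)" shows "x \<in> torsion k"
  using assms by (simp add: torsion_def nat_pow_mult[symmetric])

text \<open>Translates torsion by \<open>q - 1\<close> or \<open>q ^ 2 - 1\<close> into invariance
  under Frobenius or its square. Positivity of \<open>m\<close> keeps the subtraction from
  truncating.\<close>

lemma mem_torsion_pred_iff:
  assumes "x \<in> carrier G" "m > 0"
  shows "x \<in> torsion (m - 1) \<longleftrightarrow> x [^] m = x"
proof -
  have "x [^] m = x [^] (m - 1) \<otimes> x" using assms nat_pow_Suc[of x "m - 1"] by simp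
  then show ?thesis using assms by (simp add: torsion_def)
qed

definition pair :: "'a \<Rightarrow> 'a set" where
  "pair x = {x, inv x}"

text \<open>Inversion is the symmetry of the fibres, and its fixed points are killed by 2.\<close>

lemma card_pairs_le:
  assumes "finite (torsion m)" "finite (torsion 2)"
  shows "2 * card (pair ` torsion m) \<le> card (torsion m) + card (torsion 2)"
proof -
  have "2 * card (pair ` torsion m) \<le> card (torsion m) + card {x \<in> torsion m. inv x = x}"
    using assms(1) by (rule two_card_image_le) (auto simp: torsion_inv torsion_closed pair_def)
  also have "card {x \<in> torsion m. inv x = x} \<le> card (torsion 2)"
  proof (rule card_mono[OF assms(2)], clarify)
    fix x assume "x \<in> torsion m" "inv x = x"
    then show "x \<in> torsion 2"
      using r_inv[of x] by (simp add: torsion_def numeral_2_eq_2)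
  qed
  finally show ?thesis by simp
qed

lemma card_torsion_le_pairs:
  assumes "finite (torsion m)"
  shows "card (torsion m) \<le> 2 * card (pair ` torsion m)"
proof (rule card_le_mult_card_image[OF assms])
  fix x
  have "{y \<in> torsion m. pair y = pair x} \<subseteq> {x, inv x}" by (auto simp: pair_def)
  then have "card {y \<in> torsion m. pair y = pair x} \<le> card {x, inv x}" by (intro card_mono) auto
  also have "\<dots> \<le> 2" by (simp add: card_insert_if)
  finally show "card {y \<in> torsion m. pair y = pair x} \<le> 2" .
qed

text \<open>A representative of a common pair is killed by both exponents, hence by their difference
  2. It is applied with \<open>q - 1\<close> and \<open>q + 1\<close>.\<close>

lemma card_pairs_Int_le:
  assumes "finite (torsion 2)"
  shows "card (pair ` torsion m \<inter> pair ` torsion (m + 2)) \<le> card (torsion 2)"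
proof -
  have "pair ` torsion m \<inter> pair ` torsion (m + 2) \<subseteq> pair ` torsion 2"
  proof clarify
    fix x y assume xy: "x \<in> torsion m" "y \<in> torsion (m + 2)" "pair x = pair y"
    then have "x = y \<or> x = inv y" by (auto simp: pair_def)
    then have "x \<in> torsion (m + 2)" using xy torsion_inv by auto
    then show "pair x \<in> pair ` torsion 2" using torsion_diff xy by blast
  qed
  then show ?thesis by (meson assms card_image_le card_mono finite_imageI le_trans)
qed

section \<open>Triples of characters with trivial product\<close>

definition split_triple :: "'a \<times> 'a \<Rightarrow> 'a set" where
  "split_triple = (\<lambda>(x, y). {x, y, inv (x \<otimes> y)})"

text \<open>Frobenius exchanges the first two members when its square fixes \<open>x\<close>; the
  third is dictated by the trivial product and is then fixed.\<close>

definition quadratic_triple :: "nat \<Rightarrow> 'a \<Rightarrow> 'a set" where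
  "quadratic_triple q x = {x, x [^] q, inv (x \<otimes> x [^] q)}"

text \<open>A Frobenius orbit whose product is \<open>x\<close> to the power 1 + q + q^2; this
  explains the torsion order used for the cubic type.\<close>

definition cubic_triple :: "nat \<Rightarrow> 'a \<Rightarrow> 'a set" where
  "cubic_triple q x = {x, x [^] q, x [^] (q ^ 2)}"

abbreviation split_triples :: "nat \<Rightarrow> 'a set set" where
  "split_triples m \<equiv> split_triple ` (torsion m \<times> torsion m)"

abbreviation quadratic_triples :: "nat \<Rightarrow> 'a set set" where
  "quadratic_triples q \<equiv> quadratic_triple q ` torsion (q ^ 2 - 1)"

abbreviation cubic_triples :: "nat \<Rightarrow> 'a set set" where
  "cubic_triples q \<equiv> cubic_triple q ` torsion (q ^ 2 + q + 1)"

text \<open>Only the swap of the two coordinates is used, out of six permutations. The resulting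
  factor 1/2 in place of 1/6 is enough.\<close>

lemma card_split_triples_le:
  assumes "finite (torsion m)"
  shows "2 * card (split_triples m) \<le> card (torsion m) ^ 2 + card (torsion m)"
proof -
  have "2 * card (split_triples m) \<le>
    card (torsion m \<times> torsion m) + card {z \<in> torsion m \<times> torsion m. prod.swap z = z}"
    using assms by (intro two_card_image_le) (auto simp: split_triple_def torsion_closed m_comm)
  also have "card {z \<in> torsion m \<times> torsion m. prod.swap z = z} \<le> card ((\<lambda>x. (x, x)) ` torsion m)"
  proof (rule card_mono)
    show "{z \<in> torsion m \<times> torsion m. prod.swap z = z} \<subseteq> (\<lambda>x. (x, x)) ` torsion m"
    proof
      fix z assume "z \<in> {z \<in> torsion m \<times> torsion m. prod.swap z = z}"
      then have z: "z \<in> torsion m \<times> torsion m" "prod.swap z = z" by blast+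
      obtain a b where ab: "z = (a, b)" by (cases z)
      have "a = b" using z(2) unfolding ab swap_simp by (rule Pair_inject)
      then show "z \<in> (\<lambda>x. (x, x)) ` torsion m" using z(1) ab by simp
    qed
  qed (use assms in simp)
  also have "card ((\<lambda>x. (x, x)) ` torsion m) \<le> card (torsion m)" by (rule card_image_le[OF assms])
  finally show ?thesis by (simp add: card_cartesian_product power2_eq_square)
qed

text \<open>Both coordinates are members of the triple. If it has three elements, they form an
  ordered pair of distinct ones, 9 - 3 = 6 choices; if it degenerates to at most two elements, there
  are at most 4 pairs.\<close>

lemma card_torsion_le_split_triples:
  assumes "finite (torsion m)"
  shows "card (torsion m) ^ 2 \<le> 6 * card (split_triples m)"
proof -
  have "card (torsion m \<times> torsion m) \<le> 6 * card (split_triples m)"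
  proof (rule card_le_mult_card_image)
    fix z
    let ?S = "split_triple z" and ?F = "{y \<in> torsion m \<times> torsion m. split_triple y = split_triple z}"
    have S: "finite ?S" "card ?S \<le> 3" by (auto simp: split_triple_def card_insert_if split: prod.splits)
    have mem: "fst y \<in> split_triple y" "snd y \<in> split_triple y" for y
      by (simp_all add: split_triple_def case_prod_beta)
    have sub: "?F \<subseteq> ?S \<times> ?S"
    proof
      fix y assume "y \<in> ?F"
      then show "y \<in> ?S \<times> ?S" using mem[of y] by (simp add: mem_Times_iff)
    qed
    show "card ?F \<le> 6"
    proof (cases "card ?S = 3")
      case True
      have "?F \<subseteq> ?S \<times> ?S - (\<lambda>x. (x, x)) ` ?S"
      proof -
        have "x \<noteq> y" if "split_triple (x, y) = ?S" for x y
        proof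
          assume "x = y"
          then have "card ?S \<le> 2" unfolding that[symmetric] by (simp add: split_triple_def card_insert_if)
          then show False using True by simp
        qed
        then have "y \<notin> (\<lambda>x. (x, x)) ` ?S" if "y \<in> ?F" for y using that by blast
        then show ?thesis using sub by blast
      qed
      then have "card ?F \<le> card (?S \<times> ?S - (\<lambda>x. (x, x)) ` ?S)"
        using S by (intro card_mono) auto
      also have "\<dots> = card (?S \<times> ?S) - card ((\<lambda>x. (x, x)) ` ?S)"
        using S by (intro card_Diff_subset) auto
      also have "\<dots> = 6" using True by (simp add: card_cartesian_product card_image inj_on_def)
      finally show ?thesis .
    next
      case False
      then have "card ?S \<le> 2" using S by simp
      then have "card ?S * card ?S \<le> 2 * 2" by (intro mult_mono) auto
      moreover have "card ?F \<le> card (?S \<times> ?S)" using S sub by (intro card_mono) auto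
      ultimately show ?thesis by (simp add: card_cartesian_product)
    qed
  qed (use assms in simp)
  then show ?thesis by (simp add: card_cartesian_product power2_eq_square)
qed

section \<open>Counting the quadratic and cubic types and their overlaps\<close>

context
  fixes q :: nat
  assumes q: "q > 1" and fin: "\<And>m. m > 0 \<Longrightarrow> finite (torsion m)"
begin

lemma q_arith: "q ^ 2 - 1 > 0" "q ^ 2 > 0" "q - 1 > 0" "q > 0"
  using q one_less_power[OF q, of 2] by auto

lemma torsion_q2: "x \<in> torsion (q ^ 2 - 1) \<longleftrightarrow> x \<in> carrier G \<and> x [^] (q ^ 2) = x"
  using mem_torsion_pred_iff[of x "q ^ 2"] q_arith torsion_closed by blast

lemma torsion_q: "x \<in> torsion (q - 1) \<longleftrightarrow> x \<in> carrier G \<and> x [^] q = x"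
  using mem_torsion_pred_iff[of x q] q_arith torsion_closed by blast

lemma torsion_cubic: "x \<in> torsion (q ^ 2 + q + 1) \<longleftrightarrow>
    x \<in> carrier G \<and> x \<otimes> x [^] q \<otimes> x [^] (q ^ 2) = \<one>"
proof -
  have "x [^] (q ^ 2 + q + 1) = x \<otimes> x [^] q \<otimes> x [^] (q ^ 2)" if "x \<in> carrier G"
    using that by (simp add: nat_pow_mult[symmetric] m_ac)
  then show ?thesis by (auto simp: torsion_def)
qed

lemma torsion_cubic_pow: "x \<in> torsion (q ^ 2 + q + 1) \<Longrightarrow> x [^] (q ^ 3) = x"
proof -
  assume x: "x \<in> torsion (q ^ 2 + q + 1)"
  have "q ^ 3 - 1 = (q ^ 2 + q + 1) * (q - 1)"
    using q by (simp add: algebra_simps power2_eq_square power3_eq_cube diff_mult_distrib2)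
  then have "x \<in> torsion (q ^ 3 - 1)" using torsion_dvd[OF x, of "q ^ 3 - 1"] by (metis dvd_triv_left)
  then show ?thesis using mem_torsion_pred_iff[of x "q ^ 3"] torsion_closed[OF x] q by simp
qed

lemma pow_q_q: "x \<in> carrier G \<Longrightarrow> (x [^] q) [^] q = x [^] (q ^ 2)"
  by (simp add: nat_pow_pow power2_eq_square)

lemma quadratic_triple_pow:
  assumes "x \<in> torsion (q ^ 2 - 1)"
  shows "quadratic_triple q (x [^] q) = quadratic_triple q x"
proof -
  have x: "x \<in> carrier G" "x [^] (q ^ 2) = x" using assms torsion_q2 by blast+
  then show ?thesis by (auto simp: quadratic_triple_def pow_q_q m_comm)
qed

text \<open>Frobenius is the symmetry of the fibres, with fixed points the characters killed by
  \<open>q - 1\<close>.\<close>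

lemma card_quadratic_triples_le:
  "2 * card (quadratic_triples q) \<le> card (torsion (q ^ 2 - 1)) + card (torsion (q - 1))"
proof -
  have "2 * card (quadratic_triples q) \<le>
      card (torsion (q ^ 2 - 1)) + card {x \<in> torsion (q ^ 2 - 1). x [^] q = x}"
    by (rule two_card_image_le[OF fin[OF q_arith(1)]]) (auto simp: torsion_pow quadratic_triple_pow)
  also have "card {x \<in> torsion (q ^ 2 - 1). x [^] q = x} \<le> card (torsion (q - 1))"
    by (rule card_mono[OF fin[OF q_arith(3)]]) (use torsion_q torsion_closed in blast)
  finally show ?thesis by simp
qed

text \<open>If Frobenius fixes \<open>x\<close>, the triple itself has at most two elements.
  Otherwise the fixed third member cannot generate the same triple, which leaves \<open>x\<close>
  and its Frobenius image.\<close>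

lemma card_torsion_le_quadratic_triples:
  "card (torsion (q ^ 2 - 1)) \<le> 2 * card (quadratic_triples q)"
proof (rule card_le_mult_card_image[OF fin[OF q_arith(1)]])
  fix x assume x: "x \<in> torsion (q ^ 2 - 1)"
  then have xc: "x \<in> carrier G" by (rule torsion_closed)
  let ?c = "inv (x \<otimes> x [^] q)"
  have "x [^] (q ^ 2) = x" using x torsion_q2 by blast
  then have fix_c: "?c [^] q = ?c"
    using xc by (simp add: nat_pow_inv nat_pow_distrib pow_q_q m_comm)
  have "\<exists>z. {y \<in> torsion (q ^ 2 - 1). quadratic_triple q y = quadratic_triple q x} \<subseteq> {x, z}"
  proof (cases "x [^] q = x")
    case True
    then have "{y \<in> torsion (q ^ 2 - 1). quadratic_triple q y = quadratic_triple q x} \<subseteq> {x, ?c}"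
      by (auto simp: quadratic_triple_def)
    then show ?thesis by blast
  next
    case False
    have "{y \<in> torsion (q ^ 2 - 1). quadratic_triple q y = quadratic_triple q x} \<subseteq> {x, x [^] q}"
    proof
      fix y assume "y \<in> {y \<in> torsion (q ^ 2 - 1). quadratic_triple q y = quadratic_triple q x}"
      then have y: "y \<in> torsion (q ^ 2 - 1)" "quadratic_triple q y = quadratic_triple q x" by auto
      have "y \<in> {x, x [^] q, ?c}" using y(2) by (auto simp: quadratic_triple_def)
      \<comment> \<open>A triple generated by a fixed \<open>y\<close> consists of fixed characters
        only, yet it contains \<open>x\<close>, which Frobenius moves.\<close>
      moreover have "y \<noteq> ?c"
      proof
        assume yc: "y = ?c"
        have yy: "y [^] q = y" using fix_c yc by simp
        then have "(inv (y \<otimes> y)) [^] q = inv (y \<otimes> y)"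
          using torsion_closed[OF y(1)] by (simp add: nat_pow_inv nat_pow_distrib)
        moreover have "x \<in> {y, inv (y \<otimes> y)}" using y(2) yy by (auto simp: quadratic_triple_def)
        ultimately show False using yy False by auto
      qed
      ultimately show "y \<in> {x, x [^] q}" by auto
    qed
    then show ?thesis by blast
  qed
  then obtain z where "{y \<in> torsion (q ^ 2 - 1). quadratic_triple q y = quadratic_triple q x} \<subseteq> {x, z}" by blast
  then have "card {y \<in> torsion (q ^ 2 - 1). quadratic_triple q y = quadratic_triple q x} \<le> card {x, z}"
    by (intro card_mono) auto
  also have "\<dots> \<le> 2" by (simp add: card_insert_if)
  finally show "card {y \<in> torsion (q ^ 2 - 1). quadratic_triple q y = quadratic_triple q x} \<le> 2" .
qed

lemma cubic_triple_pow:
  assumes "x \<in> torsion (q ^ 2 + q + 1)"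
  shows "cubic_triple q (x [^] q) = cubic_triple q x"
proof -
  have "(x [^] q) [^] (q ^ 2) = x [^] (q ^ 3)"
    using torsion_closed[OF assms] by (simp add: nat_pow_pow power2_eq_square power3_eq_cube mult.assoc)
  then show ?thesis
    using torsion_closed[OF assms] torsion_cubic_pow[OF assms] by (auto simp: cubic_triple_def pow_q_q)
qed

text \<open>For a fixed \<open>x\<close> the three factors of the trivial product coincide.\<close>

lemma torsion_3I:
  assumes "x \<in> torsion (q ^ 2 + q + 1)" "x [^] q = x"
  shows "x \<in> torsion 3"
proof -
  have xc: "x \<in> carrier G" by (rule torsion_closed[OF assms(1)])
  have "x [^] (q ^ 2) = x" using pow_q_q[OF xc] assms(2) by simp
  then show ?thesis
    using assms xc unfolding torsion_cubic by (simp add: torsion_def numeral_3_eq_3)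
qed

text \<open>Frobenius permutes each fibre, but only two elements per fibre are exploited, so the
  factor is 1/2 and not the asymptotic 1/3.\<close>

lemma card_cubic_triples_le:
  "2 * card (cubic_triples q) \<le> card (torsion (q ^ 2 + q + 1)) + card (torsion 3)"
proof -
  have "2 * card (cubic_triples q) \<le>
      card (torsion (q ^ 2 + q + 1)) + card {x \<in> torsion (q ^ 2 + q + 1). x [^] q = x}"
    by (rule two_card_image_le[OF fin]) (auto simp: torsion_pow cubic_triple_pow)
  also have "card {x \<in> torsion (q ^ 2 + q + 1). x [^] q = x} \<le> card (torsion 3)"
    by (rule card_mono[OF fin]) (auto intro: torsion_3I)
  finally show ?thesis by simp
qed

lemma card_torsion_le_cubic_triples:
  "card (torsion (q ^ 2 + q + 1)) \<le> 3 * card (cubic_triples q)"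
proof (rule card_le_mult_card_image[OF fin])
  fix x
  have "{y \<in> torsion (q ^ 2 + q + 1). cubic_triple q y = cubic_triple q x} \<subseteq> cubic_triple q x"
    by (auto simp: cubic_triple_def)
  then have "card {y \<in> torsion (q ^ 2 + q + 1). cubic_triple q y = cubic_triple q x} \<le> card (cubic_triple q x)"
    by (intro card_mono) (auto simp: cubic_triple_def)
  also have "\<dots> \<le> 3" by (simp add: cubic_triple_def card_insert_if)
  finally show "card {y \<in> torsion (q ^ 2 + q + 1). cubic_triple q y = cubic_triple q x} \<le> 3" .
qed simp

text \<open>The generator \<open>x\<close> of a common triple is one of the split characters, so the
  triple is determined by a single character killed by \<open>q - 1\<close>. This is of half the
  degree of the main term.\<close>

lemma split_Int_quadratic:
  "card (split_triples (q - 1) \<inter> quadratic_triples q)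
    \<le> card (torsion (q - 1))"
proof -
  have "split_triples (q - 1) \<inter> quadratic_triples q
      \<subseteq> quadratic_triple q ` torsion (q - 1)"
  proof clarify
    fix a b x assume *: "a \<in> torsion (q - 1)" "b \<in> torsion (q - 1)"
      "split_triple (a, b) = quadratic_triple q x"
    have "x \<in> {a, b, inv (a \<otimes> b)}" using *(3) by (auto simp: split_triple_def quadratic_triple_def)
    then have "x \<in> torsion (q - 1)" using * torsion_inv torsion_mult by blast
    then show "split_triple (a, b) \<in> quadratic_triple q ` torsion (q - 1)" using *(3) by blast
  qed
  then show ?thesis by (meson fin q_arith(3) card_image_le card_mono finite_imageI le_trans)
qed

text \<open>Split and quadratic triples contain a character fixed by Frobenius. In a cubic triple, a
  single Frobenius orbit, this forces all members to be equal and killed by 3.\<close>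

lemma rational_Int_cubic:
  "card ((split_triples (q - 1) \<union> quadratic_triples q)
    \<inter> cubic_triples q) \<le> card (torsion 3)"
proof -
  have "(split_triples (q - 1) \<union> quadratic_triples q)
    \<inter> cubic_triples q \<subseteq> cubic_triple q ` torsion 3"
  proof
    fix S assume S: "S \<in> (split_triples (q - 1) \<union> quadratic_triples q)
      \<inter> cubic_triples q"
    then obtain x where x: "x \<in> torsion (q ^ 2 + q + 1)" "S = cubic_triple q x" by blast
    have xc: "x \<in> carrier G" by (rule torsion_closed[OF x(1)])
    have "\<exists>c\<in>S. c [^] q = c"
    proof -
      consider a b where "a \<in> torsion (q - 1)" "S = split_triple (a, b)"
        | a where "a \<in> torsion (q ^ 2 - 1)" "S = quadratic_triple q a" using S by blast
      then show ?thesis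
      proof cases
        case 1
        then have "a [^] q = a" using torsion_q by blast
        then show ?thesis using 1 by (auto simp: split_triple_def)
      next
        case 2
        have "a \<in> carrier G" "a [^] (q ^ 2) = a" using 2 torsion_q2 by blast+
        then have "inv (a \<otimes> a [^] q) [^] q = inv (a \<otimes> a [^] q)"
          by (simp add: nat_pow_inv nat_pow_distrib pow_q_q m_comm)
        then show ?thesis using 2 by (auto simp: quadratic_triple_def)
      qed
    qed
    then obtain c where c: "c \<in> S" "c [^] q = c" by blast
    then have "c = x \<or> c = x [^] q \<or> c = x [^] (q ^ 2)" using x by (auto simp: cubic_triple_def)
    then have "c \<in> torsion (q ^ 2 + q + 1)" using x(1) torsion_pow by blast
    then have "c \<in> torsion 3" using torsion_3I c(2) by blast
    \<comment> \<open>The cube of Frobenius fixes \<open>x\<close>, so from any of the three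
      positions the fixed \<open>c\<close> is carried back to \<open>x\<close>.\<close>
    moreover have "x = c"
    proof -
      have 3: "x [^] (q ^ 3) = x" by (rule torsion_cubic_pow[OF x(1)])
      have e: "(x [^] q) [^] (q ^ 2) = x [^] (q ^ 3)" "(x [^] (q ^ 2)) [^] q = x [^] (q ^ 3)"
        using xc by (simp_all add: nat_pow_pow power2_eq_square power3_eq_cube mult.assoc)
      from \<open>c = x \<or> c = x [^] q \<or> c = x [^] (q ^ 2)\<close> show ?thesis
      proof (elim disjE)
        assume cx: "c = x [^] q"
        have "c [^] (q ^ 2) = c" using pow_q_q[of c] c(2) cx xc by simp
        then show ?thesis using e(1) 3 cx by simp
      next
        assume cx: "c = x [^] (q ^ 2)"
        then show ?thesis using e(2) 3 c(2) by simp
      qed simp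
    qed
    ultimately show "S \<in> cubic_triple q ` torsion 3" using x(2) by blast
  qed
  then show ?thesis
    using fin[of 3] by (meson card_image_le card_mono finite_imageI le_trans zero_less_numeral)
qed

end

end

section \<open>The spectra occurring in dimensions two and three\<close>

context comm_group
begin

text \<open>The two cases for Frobenius say that a^q is \<open>a\<close> or the inverse of
  \<open>a\<close>, that is torsion by \<open>q - 1\<close> or by \<open>q + 1\<close>.\<close>

lemma pair_in_pairs:
  assumes "a \<in> carrier G" "b \<in> carrier G" "a \<otimes> b = \<one>" "a [^] q = a \<or> a [^] q = b" "q > 0"
  shows "{a, b} \<in> pair ` torsion (q - 1) \<union> pair ` torsion (q + 1)"
proof -
  have b: "b = inv a" using assms by (metis inv_equality m_comm)
  have "a \<in> torsion (q - 1) \<or> a \<in> torsion (q + 1)"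
    using assms mem_torsion_pred_iff[of a q] by (auto simp: torsion_def m_comm)
  then show ?thesis by (auto simp: b pair_def)
qed

text \<open>If Frobenius sends \<open>a\<close> to \<open>b\<close>, the trivial product sends
  \<open>b\<close> back to \<open>a\<close> and the triple is quadratic. Otherwise \<open>a\<close>
  is fixed, since injectivity rules out that \<open>a\<close> moves to a fixed \<open>c\<close>
  different from it, and \<open>a\<close>, \<open>c\<close> determine a split triple.\<close>

lemma triple_with_fixed_point:
  assumes abc: "a \<in> carrier G" "b \<in> carrier G" "c \<in> carrier G" "a \<otimes> b \<otimes> c = \<one>"
    and inj: "\<And>x y. x \<in> carrier G \<Longrightarrow> y \<in> carrier G \<Longrightarrow> x [^] q = y [^] q \<Longrightarrow> x = y"
    and c: "c [^] q = c" and a: "a [^] q \<in> {a, b, c}" and q: "q > 1"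
  shows "{a, b, c} \<in> split_triples (q - 1) \<union>
    quadratic_triples q"
proof -
  have tq: "x \<in> torsion (q - 1)" if "x \<in> carrier G" "x [^] q = x" for x
    using mem_torsion_pred_iff[of x q] that q by simp
  have "(a \<otimes> b \<otimes> c) [^] q = a [^] q \<otimes> b [^] q \<otimes> c [^] q"
    using abc(1-3) by (simp add: nat_pow_distrib)
  then have pq: "a [^] q \<otimes> b [^] q \<otimes> c = \<one>" using abc c by simp
  show ?thesis
  proof (cases "a [^] q = b")
    case True
    have "b \<otimes> c \<otimes> b [^] q = b \<otimes> c \<otimes> a" using pq abc True by (simp add: m_ac)
    then have "b [^] q = a" using abc by (subst (asm) l_cancel) auto
    then have "a [^] (q ^ 2) = a" using True abc by (simp add: power2_eq_square nat_pow_pow[symmetric])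
    then have "a \<in> torsion (q ^ 2 - 1)" using mem_torsion_pred_iff[of a "q ^ 2"] abc q by simp
    moreover have "c = inv (a \<otimes> b)" using abc by (metis inv_equality m_comm m_closed)
    then have "{a, b, c} = quadratic_triple q a" by (simp add: quadratic_triple_def True)
    ultimately show ?thesis by blast
  next
    case False
    have "a [^] q = a"
    proof (cases "a [^] q = c")
      case True
      then show ?thesis using inj[of a c] abc c by simp
    qed (use False a in auto)
    then have "a \<in> torsion (q - 1)" "c \<in> torsion (q - 1)" using tq abc c by auto
    moreover have "b = inv (a \<otimes> c)"
      using abc by (metis inv_equality m_assoc m_comm m_closed)
    then have "{a, b, c} = split_triple (a, c)" by (auto simp: split_triple_def)
    ultimately show ?thesis by blast
  qed
qed

text \<open>With a fixed member, the triple can be reordered so that the previous lemma applies.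
  Without one, Frobenius must cycle the three members.\<close>

lemma triple_cases:
  assumes abc: "a \<in> carrier G" "b \<in> carrier G" "c \<in> carrier G" "a \<otimes> b \<otimes> c = \<one>"
    and inj: "\<And>x y. x \<in> carrier G \<Longrightarrow> y \<in> carrier G \<Longrightarrow> x [^] q = y [^] q \<Longrightarrow> x = y"
    and frob: "a [^] q \<in> {a, b, c}" "b [^] q \<in> {a, b, c}" "c [^] q \<in> {a, b, c}" and q: "q > 1"
  shows "{a, b, c} \<in> split_triples (q - 1) \<union>
    quadratic_triples q \<union> cubic_triples q"
proof (cases "a [^] q = a \<or> b [^] q = b \<or> c [^] q = c")
  case True
  have fixed: "{x, y, z} \<in> split_triples (q - 1) \<union>
      quadratic_triples q"
    if "x \<in> carrier G" "y \<in> carrier G" "z \<in> carrier G" "x \<otimes> y \<otimes> z = \<one>" "z [^] q = z"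
      "x [^] q \<in> {x, y, z}" for x y z
    by (rule triple_with_fixed_point[OF that(1-4) inj that(5,6) q])
  have perm: "b \<otimes> c \<otimes> a = \<one>" "a \<otimes> c \<otimes> b = \<one>" "{b, c, a} = {a, b, c}" "{a, c, b} = {a, b, c}"
    using abc by (auto simp: m_ac)
  from True consider "a [^] q = a" | "b [^] q = b" | "c [^] q = c" by blast
  then have "{a, b, c} \<in> split_triples (q - 1) \<union>
      quadratic_triples q"
  proof cases
    case 1
    then show ?thesis using fixed[OF abc(2,3,1) perm(1)] frob(2) unfolding perm by blast
  next
    case 2
    then show ?thesis using fixed[OF abc(1,3,2) perm(2)] frob(1) unfolding perm by blast
  next
    case 3
    then show ?thesis using fixed[OF abc] frob(1) by blast
  qed
  then show ?thesis by blast
next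
  case False
  have cycle: "{x, y, z} \<in> cubic_triples q"
    if "x \<in> carrier G" "y \<in> carrier G" "z \<in> carrier G" "x \<otimes> y \<otimes> z = \<one>" "x [^] q = y"
      "y [^] q \<in> {x, y, z}" "z [^] q \<noteq> z" "y [^] q \<noteq> y" for x y z
  proof -
    \<comment> \<open>If Frobenius exchanged \<open>x\<close> and \<open>y\<close>, comparing the
      trivial product with its Frobenius image would make \<open>z\<close> fixed.\<close>
    have "y [^] q = z"
    proof (rule ccontr)
      assume "y [^] q \<noteq> z"
      then have yq: "y [^] q = x" using that by auto
      have "(x \<otimes> y \<otimes> z) [^] q = x [^] q \<otimes> y [^] q \<otimes> z [^] q"
        using that(1-3) by (simp add: nat_pow_distrib)
      then have "y \<otimes> x \<otimes> z [^] q = \<one>" using that(4,5) yq by simp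
      moreover have "y \<otimes> x \<otimes> z = \<one>" using that(1-4) by (simp add: m_comm)
      ultimately have "y \<otimes> x \<otimes> z [^] q = y \<otimes> x \<otimes> z" by simp
      then have "z [^] q = z" using that by (subst (asm) l_cancel) auto
      then show False using that by simp
    qed
    then have z: "z = x [^] (q ^ 2)" using that by (simp add: power2_eq_square nat_pow_pow[symmetric])
    have "x \<in> torsion (q ^ 2 + q + 1)"
      using that z by (simp add: torsion_def nat_pow_mult[symmetric] m_ac)
    moreover have "{x, y, z} = cubic_triple q x" using that z by (simp add: cubic_triple_def)
    ultimately show ?thesis by blast
  qed
  have "a [^] q = b \<or> a [^] q = c" using False frob by auto
  then show ?thesis
  proof
    assume "a [^] q = b"
    then show ?thesis using cycle[of a b c] abc False frob by blast
  next
    assume "a [^] q = c"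
    moreover have "a \<otimes> c \<otimes> b = \<one>" using abc by (simp add: m_ac)
    moreover have "{a, c, b} = {a, b, c}" by auto
    ultimately show ?thesis using cycle[of a c b] abc False frob by simp
  qed
qed

section \<open>Stability of the types under endomorphisms of the character group\<close>

context
  fixes h
  assumes h: "h \<in> hom G G"
begin

interpretation h: group_hom G G h by unfold_locales (rule h)

lemma hom_torsion: "x \<in> torsion m \<Longrightarrow> h x \<in> torsion m"
  by (simp add: torsion_def h.hom_nat_pow[symmetric])

lemma hom_pair: "x \<in> carrier G \<Longrightarrow> h ` pair x = pair (h x)"
  by (simp add: pair_def)

lemma hom_split_triple: "x \<in> carrier G \<Longrightarrow> y \<in> carrier G \<Longrightarrow> h ` split_triple (x, y) = split_triple (h x, h y)"
  by (simp add: split_triple_def)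

lemma hom_quadratic_triple: "x \<in> carrier G \<Longrightarrow> h ` quadratic_triple q x = quadratic_triple q (h x)"
  by (simp add: quadratic_triple_def h.hom_nat_pow)

lemma hom_cubic_triple: "x \<in> carrier G \<Longrightarrow> h ` cubic_triple q x = cubic_triple q (h x)"
  by (simp add: cubic_triple_def h.hom_nat_pow)

end

end

context SL_character_variety
begin

text \<open>Makes the stability of the types, a statement about endomorphisms of an abelian group,
  apply to the action on spectra.\<close>

lemma precomp_hom:
  assumes "\<beta> \<in> hom Z Z" shows "precomp \<beta> \<in> hom G G"
proof (rule homI)
  have \<beta>x: "\<beta> x \<in> carrier Z" if "x \<in> carrier Z" for x using assms that by (auto simp: hom_def)
  fix \<chi> \<psi> assume "\<chi> \<in> carrier G" "\<psi> \<in> carrier G"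
  then show "precomp \<beta> (\<chi> \<otimes>\<^bsub>G\<^esub> \<psi>) = precomp \<beta> \<chi> \<otimes>\<^bsub>G\<^esub> precomp \<beta> \<psi>"
    using \<beta>x precomp_G[OF assms] by (intro hom_group_eqI[of _ Z]) (auto simp: precomp_apply hom_group_mult)
qed (rule precomp_G[OF assms])

text \<open>Positivity of \<open>m\<close> keeps zero out of \<open>roots_of_unity\<close>, as its
  zeroth power is 1, so these are exactly torsion elements of the multiplicative group.\<close>

lemma bij_betw_G_torsion:
  assumes "m > 0"
  shows "bij_betw (\<lambda>f. \<lambda>i\<in>{..<r}. f (std_basis r i)) (G.torsion m) (\<Pi>\<^sub>E i\<in>{..<r}. roots_of_unity L m)"
proof -
  have "{a \<in> carrier (Multiplicative_Group.mult_of L). a [^]\<^bsub>Multiplicative_Group.mult_of L\<^esub> m = \<one>\<^bsub>Multiplicative_Group.mult_of L\<^esub>}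
      = roots_of_unity L m"
    using assms by (auto simp: roots_of_unity_def Multiplicative_Group.nat_pow_mult_of nat_pow_zero)
  then show ?thesis
    using bij_betw_torsion_hom_group[OF A.comm_group_axioms, of r m] by (simp add: G.torsion_def)
qed

lemma finite_G_torsion: "m > 0 \<Longrightarrow> finite (G.torsion m)"
  using bij_betw_finite[OF bij_betw_G_torsion] finite_roots_of_unity by (simp add: finite_PiE)

lemma card_G_torsion: "m > 0 \<Longrightarrow> card (G.torsion m) = card (roots_of_unity L m) ^ r"
  using bij_betw_same_card[OF bij_betw_G_torsion] by (simp add: card_PiE)

lemma card_G_torsion_le: "m > 0 \<Longrightarrow> card (G.torsion m) \<le> m ^ r"
  using card_G_torsion card_roots_of_unity_le by (simp add: power_mono)

lemma card_G_torsion_coprime: "m > 0 \<Longrightarrow> coprime m q \<Longrightarrow> card (G.torsion m) = m ^ r"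
  using card_G_torsion card_roots_of_unity by simp

text \<open>By additivity Frobenius annihilates the difference, and a field has no nonzero
  nilpotents.\<close>

lemma frob_inj:
  assumes "x \<in> carrier L" "y \<in> carrier L" "x [^] q = y [^] q"
  shows "x = y"
proof -
  have "(x \<ominus> y \<oplus> y) [^] q = (x \<ominus> y) [^] q \<oplus> y [^] q"
    using assms by (intro frob_add) auto
  moreover have "x \<ominus> y \<oplus> y = x" using assms by (simp add: minus_eq a_assoc l_neg)
  ultimately have "(x \<ominus> y) [^] q = \<zero>" using assms by (simp add: add.r_cancel_one)
  then have "x \<ominus> y = \<zero>" using assms by simp
  then show ?thesis using assms by (simp add: eq_diff0)
qed

lemma G_frob_inj:
  assumes "\<chi> \<in> carrier G" "\<psi> \<in> carrier G" "\<chi> [^]\<^bsub>G\<^esub> q = \<psi> [^]\<^bsub>G\<^esub> q"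
  shows "\<chi> = \<psi>"
proof (rule hom_group_eqI[OF assms(1,2)])
  fix x assume x: "x \<in> carrier Z"
  then have "\<chi> x [^] q = \<psi> x [^] q"
    using G_pow[OF assms(1) x, of q] G_pow[OF assms(2) x, of q] by (simp only: assms(3))
  then show "\<chi> x = \<psi> x"
    by (rule frob_inj[OF char_value(1)[OF assms(1) x] char_value(1)[OF assms(2) x]])
qed

lemma spectraE:
  assumes "S \<in> spectra"
  obtains \<chi> where "\<And>i. i < n \<Longrightarrow> \<chi> i \<in> carrier G" "finprod G \<chi> {..<n} = \<one>\<^bsub>G\<^esub>"
    "S = \<chi> ` {..<n}" "\<And>\<psi>. \<psi> \<in> S \<Longrightarrow> \<psi> [^]\<^bsub>G\<^esub> q \<in> S"
proof -
  obtain \<rho> where \<rho>: "\<rho> \<in> diag_Hom_SL L K n r" "S = eigenchars \<rho>"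
    using assms by (auto simp: spectra_def)
  obtain g \<chi> where d: "diagonalizes g \<rho> \<chi>" using ex_diagonalizes[OF \<rho>(1)] by blast
  have \<rho>H: "\<rho> \<in> Hom_SL (KF) n r" using \<rho> by (simp add: diag_Hom_SL_def)
  show ?thesis
  proof (rule that)
    show "\<And>i. i < n \<Longrightarrow> \<chi> i \<in> carrier G" using d by (simp add: diagonalizes_def)
    show "finprod G \<chi> {..<n} = \<one>\<^bsub>G\<^esub>" by (rule diagonalizes_prod[OF \<rho>(1) d])
    show "S = \<chi> ` {..<n}"
      unfolding \<rho>(2) using \<rho>H by (intro eigenchars_eq[OF _ d]) (simp add: Hom_SL_K_iff)
    show "\<And>\<psi>. \<psi> \<in> S \<Longrightarrow> \<psi> [^]\<^bsub>G\<^esub> q \<in> S" unfolding \<rho>(2) by (rule eigenchars_frob[OF \<rho>H])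
  qed
qed

text \<open>Frobenius fixes each character, so the diagonal representation is already defined over
  \<open>K\<close> and the descent datum is trivial.\<close>

lemma spectra_split:
  assumes "\<And>i. i < n \<Longrightarrow> \<chi> i \<in> G.torsion (q - 1)" "finprod G \<chi> {..<n} = \<one>\<^bsub>G\<^esub>"
  shows "\<chi> ` {..<n} \<in> spectra"
  unfolding spectra_def
proof (rule eigenchars_surj[where w = id and V = "\<one>\<^bsub>M\<^esub>"])
  show "\<one>\<^bsub>M\<^esub> $$ (i, j) [^] q = \<one>\<^bsub>M\<^esub> $$ (id i, j)" if "i < n" "j < n" for i j
    using that by (simp add: mat_one_entry frob_zero)
  show "\<chi> i [^]\<^bsub>G\<^esub> q = \<chi> (id i)" if "i < n" for i
    using assms(1)[OF that] G.mem_torsion_pred_iff[of "\<chi> i" q] G.torsion_closed q_gt_1 by simp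
qed (use assms G.torsion_closed permutes_id in auto)

text \<open>The invariants of a representation force one of the two types. Conversely, type
  \<open>q - 1\<close> is diagonal over \<open>K\<close>, and type \<open>q + 1\<close> is descended
  along a matrix whose two rows Frobenius exchanges.\<close>

lemma spectra_2:
  assumes n2: "n = 2"
  shows "spectra = G.pair ` G.torsion (q - 1) \<union> G.pair ` G.torsion (q + 1)"
proof (intro equalityI subsetI)
  have l2: "{..<2::nat} = {0, 1}" by auto
  fix S assume "S \<in> spectra"
  then obtain \<chi> where \<chi>: "\<And>i. i < n \<Longrightarrow> \<chi> i \<in> carrier G" "finprod G \<chi> {..<n} = \<one>\<^bsub>G\<^esub>"
    "S = \<chi> ` {..<n}" "\<And>\<psi>. \<psi> \<in> S \<Longrightarrow> \<psi> [^]\<^bsub>G\<^esub> q \<in> S" by (rule spectraE) blast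
  then have c: "\<chi> 0 \<in> carrier G" "\<chi> 1 \<in> carrier G" "S = {\<chi> 0, \<chi> 1}" using n2 l2 by auto
  then have "\<chi> 0 \<otimes>\<^bsub>G\<^esub> \<chi> 1 = \<one>\<^bsub>G\<^esub>" using char_prod_2[OF n2 c(1,2)] \<chi>(2) by simp
  moreover have "\<chi> 0 [^]\<^bsub>G\<^esub> q = \<chi> 0 \<or> \<chi> 0 [^]\<^bsub>G\<^esub> q = \<chi> 1" using \<chi>(4)[of "\<chi> 0"] c(3) by auto
  ultimately show "S \<in> G.pair ` G.torsion (q - 1) \<union> G.pair ` G.torsion (q + 1)"
    unfolding c(3) using c q_gt_1 by (intro G.pair_in_pairs) auto
next
  have l2: "{..<2::nat} = {0, 1}" by auto
  fix S assume "S \<in> G.pair ` G.torsion (q - 1) \<union> G.pair ` G.torsion (q + 1)"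
  then obtain a where S: "S = G.pair a" and a: "a \<in> G.torsion (q - 1) \<or> a \<in> G.torsion (q + 1)" by auto
  then have ac: "a \<in> carrier G" using G.torsion_closed by blast
  define \<chi> where "\<chi> i = (if i = 0 then a else inv\<^bsub>G\<^esub> a)" for i :: nat
  have \<chi>: "\<chi> i \<in> carrier G" for i using ac by (simp add: \<chi>_def)
  have prod: "finprod G \<chi> {..<n} = \<one>\<^bsub>G\<^esub>"
    using char_prod_2[OF n2, of \<chi>] \<chi> ac by (simp add: \<chi>_def)
  have im: "\<chi> ` {..<n} = S" by (simp add: S n2 l2 \<chi>_def G.pair_def insert_commute)
  from a show "S \<in> spectra"
  proof
    assume "a \<in> G.torsion (q - 1)"
    then show ?thesis using spectra_split[OF _ prod] G.torsion_inv im by (simp add: \<chi>_def)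
  next
    assume "a \<in> G.torsion (q + 1)"
    then have aq: "a [^]\<^bsub>G\<^esub> q = inv\<^bsub>G\<^esub> a"
      using ac by (intro G.inv_equality[symmetric]) (auto simp: G.torsion_def)
    obtain t where t: "t \<in> carrier L" "t [^] (q ^ 2) = t" "t [^] q \<noteq> t"
      using ex_generic_element[of 2] by auto
    \<comment> \<open>The rows are (1, t) and (1, t^q). Frobenius exchanges them because its square
      fixes \<open>t\<close>, and the determinant t^q - t is nonzero.\<close>
    define V where "V = mat 2 2 (\<lambda>(i, j). if j = 0 then \<one> else if i = 0 then t else t [^] q)"
    have V: "V \<in> carrier M" using t by (auto simp: V_def mat_carrier n2)
    have "mat_det L 2 V = t [^] q \<ominus> t"
      using V t unfolding n2 by (subst mat_det_2) (auto simp: V_def)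
    then have "V \<in> Units M"
      using t V by (intro mat_Units_if_det[OF n V]) (simp add: n2 eq_diff0)
    moreover have "V $$ (i, j) [^] q = V $$ (Transposition.transpose 0 1 i, j)" if "i < n" "j < n" for i j
      using that t by (auto simp: V_def n2 Transposition.transpose_def nat_pow_pow monoid_mult_class.power2_eq_square[symmetric])
    moreover have "\<chi> i [^]\<^bsub>G\<^esub> q = \<chi> (Transposition.transpose 0 1 i)" if "i < n" for i
      using that ac aq by (auto simp: \<chi>_def n2 Transposition.transpose_def G.nat_pow_inv less_2_cases_iff)
    moreover have "Transposition.transpose 0 1 permutes {..<n}"
      using n2 by (intro permutes_swap_id) auto
    ultimately have "\<chi> ` {..<n} \<in> spectra"
      unfolding spectra_def using \<chi> prod by (intro eigenchars_surj) auto
    then show ?thesis by (simp add: im)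
  qed
qed

lemma spectra_3:
  assumes n3: "n = 3"
  shows "spectra = G.split_triples (q - 1) \<union>
    G.quadratic_triples q \<union> G.cubic_triples q"
proof (intro equalityI subsetI)
  have l3: "{..<3::nat} = {0, 1, 2}" by auto
  fix S assume "S \<in> spectra"
  then obtain \<chi> where \<chi>: "\<And>i. i < n \<Longrightarrow> \<chi> i \<in> carrier G" "finprod G \<chi> {..<n} = \<one>\<^bsub>G\<^esub>"
    "S = \<chi> ` {..<n}" "\<And>\<psi>. \<psi> \<in> S \<Longrightarrow> \<psi> [^]\<^bsub>G\<^esub> q \<in> S" by (rule spectraE) blast
  then have c: "\<chi> 0 \<in> carrier G" "\<chi> 1 \<in> carrier G" "\<chi> 2 \<in> carrier G" "S = {\<chi> 0, \<chi> 1, \<chi> 2}" using n3 l3 by auto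
  have p: "\<chi> 0 \<otimes>\<^bsub>G\<^esub> \<chi> 1 \<otimes>\<^bsub>G\<^esub> \<chi> 2 = \<one>\<^bsub>G\<^esub>" using char_prod_3[OF n3 c(1-3)] \<chi>(2) by simp
  show "S \<in> G.split_triples (q - 1) \<union>
    G.quadratic_triples q \<union> G.cubic_triples q"
    unfolding c(4) using \<chi>(4) unfolding c(4)
    by (intro G.triple_cases[OF c(1-3) p G_frob_inj _ _ _ q_gt_1]) simp_all
next
  have l3: "{..<3::nat} = {0, 1, 2}" by auto
  have less3: "i < 3 \<longleftrightarrow> i = 0 \<or> i = 1 \<or> i = 2" for i :: nat by auto
  have inv3: "a \<otimes>\<^bsub>G\<^esub> b \<otimes>\<^bsub>G\<^esub> inv\<^bsub>G\<^esub> (a \<otimes>\<^bsub>G\<^esub> b) = \<one>\<^bsub>G\<^esub>" if "a \<in> carrier G" "b \<in> carrier G" for a b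
    using that by simp
  fix S assume "S \<in> G.split_triples (q - 1) \<union>
    G.quadratic_triples q \<union> G.cubic_triples q"
  then consider a b where "a \<in> G.torsion (q - 1)" "b \<in> G.torsion (q - 1)" "S = G.split_triple (a, b)"
    | a where "a \<in> G.torsion (q ^ 2 - 1)" "S = G.quadratic_triple q a"
    | a where "a \<in> G.torsion (q ^ 2 + q + 1)" "S = G.cubic_triple q a" by blast
  then show "S \<in> spectra"
  proof cases
    case 1
    define \<chi> where "\<chi> i = (if i = 0 then a else if i = 1 then b else inv\<^bsub>G\<^esub> (a \<otimes>\<^bsub>G\<^esub> b))" for i :: nat
    have \<chi>: "\<chi> i \<in> G.torsion (q - 1)" for i using 1 by (simp add: \<chi>_def G.torsion_inv G.torsion_mult)
    have "finprod G \<chi> {..<n} = \<one>\<^bsub>G\<^esub>"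
      using char_prod_3[OF n3, of \<chi>] \<chi>[THEN G.torsion_closed] 1(1,2)[THEN G.torsion_closed] inv3 by (simp add: \<chi>_def)
    moreover have "\<chi> ` {..<n} = S" by (simp add: n3 l3 \<chi>_def 1 G.split_triple_def insert_commute)
    ultimately show ?thesis using spectra_split[of \<chi>] \<chi> by simp
  next
    case 2
    have ac: "a \<in> carrier G" "a [^]\<^bsub>G\<^esub> (q ^ 2) = a"
      using G.torsion_q2[OF q_gt_1 finite_G_torsion] 2 by blast+
    define \<chi> where "\<chi> i = (if i = 0 then a else if i = 1 then a [^]\<^bsub>G\<^esub> q else inv\<^bsub>G\<^esub> (a \<otimes>\<^bsub>G\<^esub> a [^]\<^bsub>G\<^esub> q))" for i :: nat
    have \<chi>: "\<chi> i \<in> carrier G" for i using ac by (simp add: \<chi>_def)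
    have prod: "finprod G \<chi> {..<n} = \<one>\<^bsub>G\<^esub>"
      using char_prod_3[OF n3, of \<chi>] \<chi> ac inv3 by (simp add: \<chi>_def)
    have im: "\<chi> ` {..<n} = S" by (simp add: n3 l3 \<chi>_def 2 G.quadratic_triple_def insert_commute)
    obtain t where t: "t \<in> carrier L" "t [^] (q ^ 2) = t" "t [^] q \<noteq> t"
      using ex_generic_element[of 2] by auto
    \<comment> \<open>The matrix of dimension two extended by a block 1 for the third character,
      which Frobenius fixes.\<close>
    define V where "V = mat 3 3 (\<lambda>(i, j). if i = 2 then (if j = 2 then \<one> else \<zero>) else
      if j = 2 then \<zero> else if j = 0 then \<one> else if i = 0 then t else t [^] q)"
    have V: "V \<in> carrier M" using t by (auto simp: V_def mat_carrier n3)
    have "mat_det L 3 V = t [^] q \<ominus> t"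
      using V t unfolding n3 by (subst mat_det_3) (auto simp: V_def minus_eq)
    then have "V \<in> Units M"
      using t V by (intro mat_Units_if_det[OF n V]) (simp add: n3 eq_diff0)
    moreover have "V $$ (i, j) [^] q = V $$ (Transposition.transpose 0 1 i, j)" if "i < n" "j < n" for i j
      using that t by (auto simp: V_def n3 Transposition.transpose_def nat_pow_pow monoid_mult_class.power2_eq_square[symmetric] frob_zero less3)
    moreover have "\<chi> i [^]\<^bsub>G\<^esub> q = \<chi> (Transposition.transpose 0 1 i)" if "i < n" for i
    proof -
      have "(a [^]\<^bsub>G\<^esub> q) [^]\<^bsub>G\<^esub> q = a" using ac by (simp add: G.nat_pow_pow monoid_mult_class.power2_eq_square[symmetric])
      then show ?thesis
        using that ac by (auto simp: \<chi>_def n3 less3 Transposition.transpose_def G.nat_pow_inv G.nat_pow_distrib G.m_comm)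
    qed
    moreover have "Transposition.transpose 0 1 permutes {..<n}"
      using n3 by (intro permutes_swap_id) auto
    ultimately have "\<chi> ` {..<n} \<in> spectra"
      unfolding spectra_def using \<chi> prod by (intro eigenchars_surj) auto
    then show ?thesis by (simp add: im)
  next
    case 3
    have ac: "a \<in> carrier G" "a \<otimes>\<^bsub>G\<^esub> a [^]\<^bsub>G\<^esub> q \<otimes>\<^bsub>G\<^esub> a [^]\<^bsub>G\<^esub> (q ^ 2) = \<one>\<^bsub>G\<^esub>"
      using G.torsion_cubic[OF q_gt_1 finite_G_torsion] 3 by blast+
    have aq3: "a [^]\<^bsub>G\<^esub> (q ^ 3) = a"
      using G.torsion_cubic_pow[OF q_gt_1 finite_G_torsion 3(1)] by simp
    define \<chi> where "\<chi> i = a [^]\<^bsub>G\<^esub> (q ^ i)" for i :: nat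
    have \<chi>: "\<chi> i \<in> carrier G" for i using ac by (simp add: \<chi>_def)
    have prod: "finprod G \<chi> {..<n} = \<one>\<^bsub>G\<^esub>"
      using char_prod_3[OF n3, of \<chi>] \<chi> ac by (simp add: \<chi>_def)
    have im: "\<chi> ` {..<n} = S" using ac by (simp add: n3 l3 \<chi>_def 3 G.cubic_triple_def)
    obtain t where t: "t \<in> carrier L" "t [^] (q ^ 3) = t" "t [^] q \<noteq> t"
      using ex_generic_element[of 3] by auto
    \<comment> \<open>The Frobenius orbit of \<open>t\<close>. It has three distinct members:
      equality of two of them would, by injectivity or by the period 3, give t^q = t.\<close>
    define u where "u i = t [^] (q ^ i)" for i :: nat
    have u: "u i \<in> carrier L" for i using t by (simp add: u_def)
    have uS: "u i [^] q = u (Suc i)" for i using t by (simp add: u_def nat_pow_pow mult.commute)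
    have u3: "u 3 = u 0" using t by (simp add: u_def)
    have u01: "u 1 \<noteq> u 0" using t by (simp add: u_def)
    have u12: "u 2 \<noteq> u 1"
    proof
      assume "u 2 = u 1"
      then have "u 1 [^] q = u 0 [^] q" using uS[of 1] uS[of 0] by (simp add: numeral_2_eq_2)
      then show False using frob_inj[OF u u] u01 by blast
    qed
    have u20: "u 2 \<noteq> u 0"
    proof
      assume "u 2 = u 0"
      then have "u 3 = u 1" using uS[of 2] uS[of 0] by (simp add: numeral_3_eq_3 numeral_2_eq_2)
      then show False using u3 u01 by simp
    qed
    define w where "w = Transposition.transpose 0 1 \<circ> Transposition.transpose 1 (2::nat)"
    have w: "w permutes {..<n}"
      unfolding w_def using n3 by (intro permutes_compose permutes_swap_id) auto
    have wi: "w 0 = 1" "w 1 = 2" "w 2 = 0" by (simp_all add: w_def Transposition.transpose_def)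
    \<comment> \<open>The Vandermonde matrix of the orbit. Frobenius moves each row to the next one,
      following the 3-cycle \<open>w\<close>, and the determinant is nonzero as the nodes
      differ.\<close>
    define V where "V = mat 3 3 (\<lambda>(i, j). u i [^] j)"
    have V: "V \<in> carrier M" using u by (auto simp: V_def mat_carrier n3)
    have vandermonde: "\<one> \<otimes> y \<otimes> (z \<otimes> z) \<oplus> x \<otimes> (y \<otimes> y) \<otimes> \<one> \<oplus> x \<otimes> x \<otimes> \<one> \<otimes> z \<ominus> x \<otimes> x \<otimes> y \<otimes> \<one>
        \<ominus> x \<otimes> \<one> \<otimes> (z \<otimes> z) \<ominus> \<one> \<otimes> (y \<otimes> y) \<otimes> z \<ominus> (y \<ominus> x) \<otimes> (z \<ominus> x) \<otimes> (z \<ominus> y) = \<zero>"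
      if "x \<in> carrier L" "y \<in> carrier L" "z \<in> carrier L" for x y z
      by (rule eq_zero_by_normalization[of "[x, y, z]"], simp add: in_carrier_def that,
          (rule Ipolex_intros)+, code_simp)
    have "mat_det L 3 V \<ominus> (u 1 \<ominus> u 0) \<otimes> (u 2 \<ominus> u 0) \<otimes> (u 2 \<ominus> u 1) = \<zero>"
      using V u vandermonde[OF u u u, of 1 2 0] unfolding n3
      by (subst mat_det_3) (simp_all add: V_def power2_eq_square del: One_nat_def)
    then have "mat_det L n V = (u 1 \<ominus> u 0) \<otimes> (u 2 \<ominus> u 0) \<otimes> (u 2 \<ominus> u 1)"
      using mat_det_closed[OF n V] u unfolding n3 by (simp add: eq_diff0)
    then have "V \<in> Units M"
      using u u01 u12 u20 by (intro mat_Units_if_det[OF n V]) (simp add: integral_iff eq_diff0)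
    moreover have "V $$ (i, j) [^] q = V $$ (w i, j)" if "i < n" "j < n" for i j
    proof -
      have "w i < 3" using that wi unfolding n3 less3 by auto
      moreover have "u i [^] q = u (w i)"
        using that wi uS[of i] u3 unfolding n3 less3 by (auto simp: numeral_3_eq_3 numeral_2_eq_2)
      moreover have "(u i [^] j) [^] q = (u i [^] q) [^] j" using u by (simp add: nat_pow_pow mult.commute)
      ultimately show ?thesis using that by (simp add: V_def n3)
    qed
    moreover have "\<chi> i [^]\<^bsub>G\<^esub> q = \<chi> (w i)" if "i < n" for i
    proof -
      have "\<chi> i [^]\<^bsub>G\<^esub> q = \<chi> (Suc i)" using ac by (simp add: \<chi>_def G.nat_pow_pow mult.commute)
      moreover have "\<chi> 3 = \<chi> 0" using aq3 ac by (simp add: \<chi>_def)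
      ultimately show ?thesis
        using that wi unfolding n3 less3 by (auto simp: numeral_3_eq_3 numeral_2_eq_2)
    qed
    ultimately have "\<chi> ` {..<n} \<in> spectra"
      unfolding spectra_def using \<chi> prod w by (intro eigenchars_surj) auto
    then show ?thesis by (simp add: im)
  qed
qed

end

section \<open>Orbit bounds and limits\<close>

text \<open>Inclusion-exclusion: \<open>A\<close>, \<open>B\<close> are the sizes of the types,
  \<open>s\<close> that of their union, \<open>I\<close> that of the overlap, and \<open>a\<close>,
  \<open>b\<close> count the torsion characters generating them.\<close>

lemma two_types_bound:
  fixes a b s t A B I :: nat
  assumes "A + B = s + I" "I \<le> t" "a \<le> 2 * A" "b \<le> 2 * B"
  shows "a + b \<le> 2 * (s + t)"
proof -
  have "a + b \<le> 2 * (A + B)" using add_mono[OF assms(3,4)] by simp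
  also have "\<dots> \<le> 2 * (s + t)" unfolding assms(1) using assms(2) by simp
  finally show ?thesis .
qed

text \<open>As before, with \<open>D\<close> the size of the union of the first two types and
  \<open>J\<close> that of its overlap with the third. Multiplying by 6 clears the weights 1/6, 1/2
  and 1/3.\<close>

lemma three_types_bound:
  fixes a b c s t u A B C D I J :: nat
  assumes "A + B = D + I" "D + C = s + J" "I \<le> t" "J \<le> u" "a \<le> 6 * A" "b \<le> 2 * B" "c \<le> 3 * C"
  shows "a + 3 * b + 2 * c \<le> 6 * (s + t + u)"
proof -
  have "a + 3 * b + 2 * c \<le> 6 * (A + B + C)" using assms(5-7) by simp
  also have "A + B + C = s + J + I" using assms(1,2) by simp
  also have "6 * (s + J + I) \<le> 6 * (s + t + u)" using assms(3,4) by simp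
  finally show ?thesis .
qed

context SL_character_variety
begin

text \<open>Positivity of \<open>T\<close> makes the set of spectra nonempty and finite, so the
  maximum is attained at a point, whose stable family \<open>Y\<close> contains its orbit.\<close>

lemma max_orbit_ratio_le:
  fixes U T :: real
  assumes Y: "\<And>S. S \<in> spectra \<Longrightarrow> \<exists>Y. S \<in> Y \<and> finite Y \<and>
      (\<forall>\<beta>\<in>hom Z Z. \<forall>S\<in>Y. precomp \<beta> ` S \<in> Y) \<and> real (card Y) \<le> U"
    and T: "T \<le> real (card spectra)" "T > 0"
  shows "max_orbit_ratio (Out Z) (out_act Z) (char_variety L K n r) \<le> U / T"
proof -
  let ?o = "\<lambda>v. card (orbit (Out Z) (out_act Z) v)"
  have "card spectra > 0" using T by linarith
  then have fin: "finite spectra" "spectra \<noteq> {}" by (auto simp: card_gt_0_iff)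
  have "Max (?o ` char_variety L K n r) \<in> ?o ` char_variety L K n r"
    using fin by (intro Max_in) (auto simp: char_variety_eq)
  then obtain S where S: "S \<in> spectra" "Max (?o ` char_variety L K n r) = ?o (point S)"
    by (auto simp: char_variety_eq)
  obtain Y where Y': "S \<in> Y" "finite Y" "\<And>\<beta> S. \<beta> \<in> hom Z Z \<Longrightarrow> S \<in> Y \<Longrightarrow> precomp \<beta> ` S \<in> Y"
      "real (card Y) \<le> U" using Y[OF S(1)] by blast
  have "real (?o (point S)) \<le> U"
    using card_orbit_le[OF S(1) Y'(1-3)] Y'(4) by linarith
  then show ?thesis
    unfolding max_orbit_ratio_def S(2) card_char_variety using T by (intro frac_le) auto
qed

lemma coprime_q: "coprime (q - 1) q" "coprime (q + 1) q" "coprime (q ^ 2 - 1) q" "coprime (q ^ 2 + q + 1) q"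
proof -
  show "coprime (q - 1) q" using q_gt_1 by (intro coprime_diff_one_left_nat) simp
  show "coprime (q + 1) q" by simp
  have "coprime (q ^ 2 - 1) (q ^ 2)" using q_gt_1 by (intro coprime_diff_one_left_nat) simp
  then show "coprime (q ^ 2 - 1) q" by simp
  have "coprime (q * (q + 1) + 1) (q * (q + 1))" by simp
  then have "coprime (q * (q + 1) + 1) q" by (simp only: coprime_mult_right_iff)
  then show "coprime (q ^ 2 + q + 1) q" by (simp add: monoid_mult_class.power2_eq_square add.commute)
qed

lemma card_torsion_q:
  "card (G.torsion (q - 1)) = (q - 1) ^ r" "card (G.torsion (q + 1)) = (q + 1) ^ r"
  "card (G.torsion (q ^ 2 - 1)) = (q ^ 2 - 1) ^ r"
  "card (G.torsion (q ^ 2 + q + 1)) = (q ^ 2 + q + 1) ^ r"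
  using card_G_torsion_coprime coprime_q q_gt_1 one_less_power[OF q_gt_1, of 2] by auto

text \<open>In \<open>U\<close> the larger count (q+1)^r serves both types, and 2^r bounds the
  self-inverse characters. In \<open>T\<close> the halves come from fibres with at most two
  elements, and 2^r bounds the overlap of the types.\<close>

lemma max_orbit_ratio_2:
  fixes U T :: real
  assumes n2: "n = 2"
    and U: "U = ((real q + 1) ^ r + 2 ^ r) / 2"
    and T: "T = ((real q - 1) ^ r + (real q + 1) ^ r) / 2 - 2 ^ r" "T > 0"
  shows "max_orbit_ratio (Out Z) (out_act Z) (char_variety L K n r) \<le> U / T"
proof (rule max_orbit_ratio_le)
  have fin: "finite (G.torsion m)" if "m > 0" for m using finite_G_torsion[OF that] .
  have q1: "q - 1 > 0" "q + 1 > 0" "q + 1 = (q - 1) + 2" using q_gt_1 by auto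
  have closed: "precomp \<beta> ` S \<in> G.pair ` G.torsion m" if "\<beta> \<in> hom Z Z" "S \<in> G.pair ` G.torsion m" for \<beta> S m
    using that G.hom_pair[OF precomp_hom] G.hom_torsion[OF precomp_hom] G.torsion_closed by auto
  have two: "card (G.torsion 2) \<le> 2 ^ r" by (rule card_G_torsion_le) simp
  have up: "real (card (G.pair ` G.torsion m)) \<le> U" if "m = q - 1 \<or> m = q + 1" for m
  proof -
    have "card (G.torsion m) = m ^ r" using that card_torsion_q(1,2) by blast
    also have "\<dots> \<le> (q + 1) ^ r" using that by (intro power_mono) auto
    finally have "card (G.torsion m) \<le> (q + 1) ^ r" .
    then have "2 * card (G.pair ` G.torsion m) \<le> (q + 1) ^ r + 2 ^ r"
      using G.card_pairs_le[of m] fin that q1 two by fastforce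
    then have "real (2 * card (G.pair ` G.torsion m)) \<le> real ((q + 1) ^ r + 2 ^ r)"
      by (simp only: of_nat_le_iff)
    then show ?thesis by (simp add: U add.commute)
  qed
  fix S assume "S \<in> spectra"
  then consider "S \<in> G.pair ` G.torsion (q - 1)" | "S \<in> G.pair ` G.torsion (q + 1)"
    unfolding spectra_2[OF n2] by blast
  then show "\<exists>Y. S \<in> Y \<and> finite Y \<and> (\<forall>\<beta>\<in>hom Z Z. \<forall>S\<in>Y. precomp \<beta> ` S \<in> Y) \<and> real (card Y) \<le> U"
  proof cases
    case 1
    then show ?thesis
      using closed up fin[OF q1(1)] by (intro exI[of _ "G.pair ` G.torsion (q - 1)"]) auto
  next
    case 2
    then show ?thesis
      using closed up fin[OF q1(2)] by (intro exI[of _ "G.pair ` G.torsion (q + 1)"]) auto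
  qed
next
  have fin: "finite (G.torsion m)" if "m > 0" for m using finite_G_torsion[OF that] .
  have q1: "q - 1 > 0" "q + 1 > 0" "q + 1 = (q - 1) + 2" using q_gt_1 by auto
  have two: "card (G.torsion 2) \<le> 2 ^ r" by (rule card_G_torsion_le) simp
  let ?A = "G.pair ` G.torsion (q - 1)" and ?B = "G.pair ` G.torsion (q + 1)"
  have "card ?A + card ?B = card spectra + card (?A \<inter> ?B)"
    unfolding spectra_2[OF n2] using fin q1 by (intro card_Un_Int) auto
  moreover have "card (?A \<inter> ?B) \<le> 2 ^ r"
    using G.card_pairs_Int_le[of "q - 1"] fin[of 2] two unfolding q1(3) by simp
  moreover have "(q - 1) ^ r \<le> 2 * card ?A" "(q + 1) ^ r \<le> 2 * card ?B"
    using G.card_torsion_le_pairs fin q1 card_torsion_q by metis+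
  ultimately have "(q - 1) ^ r + (q + 1) ^ r \<le> 2 * (card spectra + 2 ^ r)"
    by (rule two_types_bound)
  then have "real ((q - 1) ^ r + (q + 1) ^ r) \<le> real (2 * (card spectra + 2 ^ r))"
    by (simp only: of_nat_le_iff)
  then show "T \<le> real (card spectra)" using q_gt_1 by (simp add: T of_nat_diff field_simps)
qed (rule T(2))

text \<open>In \<open>U\<close> the power of q^2 + q + 1 majorizes the main term of each type, and
  the other terms cover the fixed points of the symmetries. The weights in \<open>T\<close> are
  reciprocals of the fibre bounds 6, 2 and 3; its subtracted terms bound the overlaps.\<close>

lemma max_orbit_ratio_3:
  fixes U T :: real
  assumes n3: "n = 3"
    and U: "U = ((real q ^ 2 + real q + 1) ^ r + (real q - 1) ^ r + 3 ^ r) / 2"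
    and T: "T = ((real q - 1) ^ 2) ^ r / 6 + (real q ^ 2 - 1) ^ r / 2 + (real q ^ 2 + real q + 1) ^ r / 3
      - (real q - 1) ^ r - 3 ^ r" "T > 0"
  shows "max_orbit_ratio (Out Z) (out_act Z) (char_variety L K n r) \<le> U / T"
proof -
  have fin: "finite (G.torsion m)" if "m > 0" for m using finite_G_torsion[OF that] .
  note counts = G.card_quadratic_triples_le[OF q_gt_1 fin] G.card_torsion_le_quadratic_triples[OF q_gt_1 fin]
    G.card_cubic_triples_le[OF q_gt_1 fin] G.card_torsion_le_cubic_triples[OF q_gt_1 fin]
    G.split_Int_quadratic[OF q_gt_1 fin] G.rational_Int_cubic[OF q_gt_1 fin]
  define Y1 where "Y1 = G.split_triples (q - 1)"
  define Y2 where "Y2 = G.quadratic_triples q"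
  define Y3 where "Y3 = G.cubic_triples q"
  note Y_defs = Y1_def Y2_def Y3_def
  have spectra: "spectra = Y1 \<union> Y2 \<union> Y3" unfolding Y_defs by (rule spectra_3[OF n3])
  have q1: "q - 1 > 0" "q ^ 2 - 1 > 0" using q_gt_1 one_less_power[OF q_gt_1, of 2] by auto
  have finY: "finite Y1" "finite Y2" "finite Y3" unfolding Y_defs using fin q1 by auto
  have three: "card (G.torsion 3) \<le> 3 ^ r" by (rule card_G_torsion_le) simp
  have upY: "2 * card Y1 \<le> ((q - 1) ^ r) ^ 2 + (q - 1) ^ r"
    "2 * card Y2 \<le> (q ^ 2 - 1) ^ r + (q - 1) ^ r"
    "2 * card Y3 \<le> (q ^ 2 + q + 1) ^ r + 3 ^ r"
    unfolding Y_defs card_torsion_q[symmetric]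
    using G.card_split_triples_le[OF fin[OF q1(1)]] counts(1,3) three by linarith+
  have lowY: "((q - 1) ^ r) ^ 2 \<le> 6 * card Y1" "(q ^ 2 - 1) ^ r \<le> 2 * card Y2"
    "(q ^ 2 + q + 1) ^ r \<le> 3 * card Y3"
    unfolding Y_defs card_torsion_q[symmetric]
    using G.card_torsion_le_split_triples[OF fin[OF q1(1)]] counts(2,4) by linarith+
  have sq: "((q - 1) ^ r) ^ 2 = ((q - 1) ^ 2) ^ r" by (simp add: power_mult[symmetric] mult.commute)
  have qsq: "q ^ 2 \<ge> 1" using q1(2) by linarith
  have r1: "real (q - 1) = real q - 1" "real (q ^ 2 - 1) = real q ^ 2 - 1"
    "real (q ^ 2 + q + 1) = real q ^ 2 + real q + 1"
    using q_gt_1 qsq by (simp_all add: of_nat_diff)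
  \<comment> \<open>The cubic count dominates the split and the quadratic one, so a single
    \<open>U\<close> serves all three types.\<close>
  have N: "((q - 1) ^ r) ^ 2 \<le> (q ^ 2 + q + 1) ^ r" "(q ^ 2 - 1) ^ r \<le> (q ^ 2 + q + 1) ^ r"
  proof -
    have "(q - 1) ^ 2 \<le> q ^ 2" by (intro power_mono) auto
    then have "(q - 1) ^ 2 \<le> q ^ 2 + q + 1" by linarith
    then show "((q - 1) ^ r) ^ 2 \<le> (q ^ 2 + q + 1) ^ r" unfolding sq by (intro power_mono) auto
    show "(q ^ 2 - 1) ^ r \<le> (q ^ 2 + q + 1) ^ r" by (intro power_mono) auto
  qed
  have U': "U = real ((q ^ 2 + q + 1) ^ r + (q - 1) ^ r + 3 ^ r) / 2"
    unfolding U by (simp only: semiring_1_class.of_nat_add semiring_1_class.of_nat_power r1(1) of_nat_numeral semiring_1_class.of_nat_1)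
  have up: "real (card Y1) \<le> U" "real (card Y2) \<le> U" "real (card Y3) \<le> U"
  proof -
    have *: "real c \<le> U" if "2 * c \<le> (q ^ 2 + q + 1) ^ r + (q - 1) ^ r + 3 ^ r" for c
    proof -
      have "real (2 * c) \<le> real ((q ^ 2 + q + 1) ^ r + (q - 1) ^ r + 3 ^ r)"
        using that by (simp only: of_nat_le_iff)
      then show ?thesis unfolding U' by simp
    qed
    show "real (card Y1) \<le> U" "real (card Y2) \<le> U" "real (card Y3) \<le> U"
      using upY N by (intro *; linarith)+
  qed
  have closed1: "precomp \<beta> ` S \<in> Y1" if "\<beta> \<in> hom Z Z" "S \<in> Y1" for \<beta> S
    using that G.hom_split_triple[OF precomp_hom] G.hom_torsion[OF precomp_hom] G.torsion_closed
    unfolding Y1_def by blast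
  have closed2: "precomp \<beta> ` S \<in> Y2" if "\<beta> \<in> hom Z Z" "S \<in> Y2" for \<beta> S
    using that G.hom_quadratic_triple[OF precomp_hom] G.hom_torsion[OF precomp_hom] G.torsion_closed
    unfolding Y2_def by blast
  have closed3: "precomp \<beta> ` S \<in> Y3" if "\<beta> \<in> hom Z Z" "S \<in> Y3" for \<beta> S
    using that G.hom_cubic_triple[OF precomp_hom] G.hom_torsion[OF precomp_hom] G.torsion_closed
    unfolding Y3_def by blast
  have "card Y1 + card Y2 = card (Y1 \<union> Y2) + card (Y1 \<inter> Y2)"
    using finY by (intro card_Un_Int)
  moreover have "card (Y1 \<union> Y2) + card Y3 = card spectra + card ((Y1 \<union> Y2) \<inter> Y3)"
    unfolding spectra using finY by (intro card_Un_Int) auto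
  moreover have "card (Y1 \<inter> Y2) \<le> (q - 1) ^ r" "card ((Y1 \<union> Y2) \<inter> Y3) \<le> 3 ^ r"
    unfolding Y_defs using counts(5,6) three card_torsion_q(1) by linarith+
  ultimately have "((q - 1) ^ 2) ^ r + 3 * (q ^ 2 - 1) ^ r + 2 * (q ^ 2 + q + 1) ^ r
      \<le> 6 * (card spectra + (q - 1) ^ r + 3 ^ r)"
    using lowY unfolding sq by (rule three_types_bound)
  then have "real (((q - 1) ^ 2) ^ r + 3 * (q ^ 2 - 1) ^ r + 2 * (q ^ 2 + q + 1) ^ r)
      \<le> real (6 * (card spectra + (q - 1) ^ r + 3 ^ r))"
    by (simp only: of_nat_le_iff)
  then have "((real q - 1) ^ 2) ^ r + 3 * (real q ^ 2 - 1) ^ r + 2 * (real q ^ 2 + real q + 1) ^ r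
      \<le> 6 * (real (card spectra) + (real q - 1) ^ r + 3 ^ r)"
    by (simp only: semiring_1_class.of_nat_add semiring_1_class.of_nat_mult semiring_1_class.of_nat_power r1(1,2) of_nat_numeral semiring_1_class.of_nat_1)
  then have "T \<le> real (card spectra)" unfolding T(1) by (simp add: field_simps)
  from _ this T(2) show ?thesis
  proof (rule max_orbit_ratio_le)
    fix S assume "S \<in> spectra"
    then consider "S \<in> Y1" | "S \<in> Y2" | "S \<in> Y3" unfolding spectra by blast
    then show "\<exists>Y. S \<in> Y \<and> finite Y \<and> (\<forall>\<beta>\<in>hom Z Z. \<forall>S\<in>Y. precomp \<beta> ` S \<in> Y) \<and> real (card Y) \<le> U"
    proof cases
      case 1
      with finY(1) up(1) closed1 show ?thesis by (intro exI[of _ Y1] conjI ballI)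
    next
      case 2
      with finY(2) up(2) closed2 show ?thesis by (intro exI[of _ Y2] conjI ballI)
    next
      case 3
      with finY(3) up(3) closed3 show ?thesis by (intro exI[of _ Y3] conjI ballI)
    qed
  qed
qed

end

section \<open>Limits of the explicit bounds along prime powers\<close>

lemma quotient_tendsto_half:
  fixes U T N :: "real \<Rightarrow> real"
  assumes "((\<lambda>x. U x / N x) \<longlongrightarrow> 1 / 2) at_top" "((\<lambda>x. T x / N x) \<longlongrightarrow> 1) at_top"
    and N: "eventually (\<lambda>x. N x > 0) at_top"
  shows "((\<lambda>x. U x / T x) \<longlongrightarrow> 1 / 2) at_top" "eventually (\<lambda>x. T x > 0) at_top"
proof -
  have "((\<lambda>x. (U x / N x) / (T x / N x)) \<longlongrightarrow> (1 / 2) / 1) at_top"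
    by (intro tendsto_divide assms) auto
  moreover have "eventually (\<lambda>x. (U x / N x) / (T x / N x) = U x / T x) at_top"
    using N by eventually_elim auto
  ultimately show "((\<lambda>x. U x / T x) \<longlongrightarrow> 1 / 2) at_top"
    using Lim_transform_eventually by fastforce
  have "eventually (\<lambda>x. T x / N x > 0) at_top"
    using assms(2) by (rule order_tendstoD) simp
  then show "eventually (\<lambda>x. T x > 0) at_top"
    using N by eventually_elim (simp add: zero_less_divide_iff)
qed

text \<open>Both bounds are divided by x^r. Positivity of \<open>r\<close> makes the error (2/x)^r
  tend to zero, which leaves 1/2 over 1/2 + 1/2.\<close>

lemma bounds_2:
  fixes r :: nat
  assumes "r > 0"
  defines "U \<equiv> \<lambda>x::real. ((x + 1) ^ r + 2 ^ r) / 2"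
    and "T \<equiv> \<lambda>x::real. ((x - 1) ^ r + (x + 1) ^ r) / 2 - 2 ^ r"
  shows "((\<lambda>x. U x / T x) \<longlongrightarrow> 1 / 2) at_top" "eventually (\<lambda>x. T x > 0) at_top"
proof -
  have U_eq: "U x / x ^ r = (((x + 1) / x) ^ r + (2 / x) ^ r) / 2" for x
    unfolding U_def power_divide by (simp only: add_divide_distrib divide_divide_eq_left mult.commute)
  have T_eq: "T x / x ^ r = (((x - 1) / x) ^ r + ((x + 1) / x) ^ r) / 2 - (2 / x) ^ r" for x
    unfolding T_def power_divide
    by (simp only: add_divide_distrib diff_divide_distrib divide_divide_eq_left mult.commute)
  have lims: "((\<lambda>x::real. ((x + 1) / x) ^ r) \<longlongrightarrow> 1 ^ r) at_top"
    "((\<lambda>x::real. ((x - 1) / x) ^ r) \<longlongrightarrow> 1 ^ r) at_top"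
    "((\<lambda>x::real. (2 / x) ^ r) \<longlongrightarrow> 0 ^ r) at_top"
    by (rule tendsto_power, real_asymp)+
  have "((\<lambda>x::real. (((x + 1) / x) ^ r + (2 / x) ^ r) / 2) \<longlongrightarrow> (1 ^ r + 0 ^ r) / 2) at_top"
    by (intro tendsto_intros lims) auto
  then have 1: "((\<lambda>x. U x / x ^ r) \<longlongrightarrow> 1 / 2) at_top"
    using assms(1) by (simp only: U_eq zero_power) simp
  have "((\<lambda>x::real. (((x - 1) / x) ^ r + ((x + 1) / x) ^ r) / 2 - (2 / x) ^ r)
      \<longlongrightarrow> (1 ^ r + 1 ^ r) / 2 - 0 ^ r) at_top"
    by (intro tendsto_intros lims) auto
  then have 2: "((\<lambda>x. T x / x ^ r) \<longlongrightarrow> 1) at_top"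
    using assms(1) by (simp only: T_eq zero_power) simp
  have 3: "eventually (\<lambda>x::real. x ^ r > 0) at_top"
    using eventually_gt_at_top[of 0] by eventually_elim simp
  show "((\<lambda>x. U x / T x) \<longlongrightarrow> 1 / 2) at_top" "eventually (\<lambda>x. T x > 0) at_top"
    by (rule quotient_tendsto_half[OF 1 2 3])+
qed

text \<open>The normalization is now x^(2r), of the degree of the main terms. The subtracted terms
  vanish in the limit, and the denominator tends to 1/6 + 1/2 + 1/3 = 1.\<close>

lemma bounds_3:
  fixes r :: nat
  assumes "r > 0"
  defines "U \<equiv> \<lambda>x::real. ((x ^ 2 + x + 1) ^ r + (x - 1) ^ r + 3 ^ r) / 2"
    and "T \<equiv> \<lambda>x::real. ((x - 1) ^ 2) ^ r / 6 + (x ^ 2 - 1) ^ r / 2 + (x ^ 2 + x + 1) ^ r / 3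
      - (x - 1) ^ r - 3 ^ r"
  shows "((\<lambda>x. U x / T x) \<longlongrightarrow> 1 / 2) at_top" "eventually (\<lambda>x. T x > 0) at_top"
proof -
  have U_eq: "U x / (x ^ 2) ^ r =
      (((x ^ 2 + x + 1) / x ^ 2) ^ r + ((x - 1) / x ^ 2) ^ r + (3 / x ^ 2) ^ r) / 2" for x
    unfolding U_def power_divide[of _ _ r]
    by (simp only: add_divide_distrib divide_divide_eq_left mult.commute)
  have T_eq: "T x / (x ^ 2) ^ r = ((x - 1) ^ 2 / x ^ 2) ^ r / 6 + ((x ^ 2 - 1) / x ^ 2) ^ r / 2
        + ((x ^ 2 + x + 1) / x ^ 2) ^ r / 3 - ((x - 1) / x ^ 2) ^ r - (3 / x ^ 2) ^ r" for x
    unfolding T_def power_divide[of _ _ r]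
    by (simp only: add_divide_distrib diff_divide_distrib divide_divide_eq_left mult.commute)
  have lims: "((\<lambda>x::real. ((x ^ 2 + x + 1) / x ^ 2) ^ r) \<longlongrightarrow> 1 ^ r) at_top"
    "((\<lambda>x::real. ((x - 1) ^ 2 / x ^ 2) ^ r) \<longlongrightarrow> 1 ^ r) at_top"
    "((\<lambda>x::real. ((x ^ 2 - 1) / x ^ 2) ^ r) \<longlongrightarrow> 1 ^ r) at_top"
    "((\<lambda>x::real. ((x - 1) / x ^ 2) ^ r) \<longlongrightarrow> 0 ^ r) at_top"
    "((\<lambda>x::real. (3 / x ^ 2) ^ r) \<longlongrightarrow> 0 ^ r) at_top"
    by (rule tendsto_power, real_asymp)+
  have "((\<lambda>x::real. (((x ^ 2 + x + 1) / x ^ 2) ^ r + ((x - 1) / x ^ 2) ^ r + (3 / x ^ 2) ^ r) / 2)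
      \<longlongrightarrow> (1 ^ r + 0 ^ r + 0 ^ r) / 2) at_top"
    by (intro tendsto_intros lims) auto
  then have 1: "((\<lambda>x. U x / (x ^ 2) ^ r) \<longlongrightarrow> 1 / 2) at_top"
    using assms(1) by (simp only: U_eq zero_power) simp
  have "((\<lambda>x::real. ((x - 1) ^ 2 / x ^ 2) ^ r / 6 + ((x ^ 2 - 1) / x ^ 2) ^ r / 2
        + ((x ^ 2 + x + 1) / x ^ 2) ^ r / 3 - ((x - 1) / x ^ 2) ^ r - (3 / x ^ 2) ^ r)
      \<longlongrightarrow> 1 ^ r / 6 + 1 ^ r / 2 + 1 ^ r / 3 - 0 ^ r - 0 ^ r) at_top"
    by (intro tendsto_intros lims) auto
  then have 2: "((\<lambda>x. T x / (x ^ 2) ^ r) \<longlongrightarrow> 1) at_top"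
    using assms(1) by (simp only: T_eq zero_power) simp
  have 3: "eventually (\<lambda>x::real. (x ^ 2) ^ r > 0) at_top"
    using eventually_gt_at_top[of 0] by eventually_elim simp
  show "((\<lambda>x. U x / T x) \<longlongrightarrow> 1 / 2) at_top" "eventually (\<lambda>x. T x > 0) at_top"
    by (rule quotient_tendsto_half[OF 1 2 3])+
qed

text \<open>Primes outside a finite set are unbounded. Along a trivial filter every limit statement
  would hold, so this is what allows limits to be compared.\<close>

lemma prime_powers_at_top_neq_bot:
  assumes "finite S" shows "prime_powers_at_top S \<noteq> bot"
proof
  assume "prime_powers_at_top S = bot"
  then have "eventually (\<lambda>_. False) (prime_powers_at_top S)" by simp
  then obtain N where N: "\<And>m. m \<ge> N \<Longrightarrow> m \<notin> {p ^ k | p k. Factorial_Ring.prime p \<and> p \<notin> S \<and> k > 0}"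
    unfolding prime_powers_at_top_def eventually_inf_principal eventually_at_top_linorder by auto
  obtain p where p: "Factorial_Ring.prime p" "p > N + Max (insert 0 S)" using bigger_prime by blast
  have "p \<notin> S"
  proof
    assume "p \<in> S"
    then have "p \<le> Max (insert 0 S)" using assms by (intro Max_ge) auto
    then show False using p(2) by simp
  qed
  moreover have "p = p ^ 1" by simp
  ultimately have "p \<in> {p ^ k | p k. Factorial_Ring.prime p \<and> p \<notin> S \<and> k > 0}"
    using p(1) by blast
  moreover have "p \<ge> N" using p(2) by simp
  ultimately show False using N by blast
qed

lemma eventually_prime_powers_at_top:
  assumes "eventually P at_top"
  shows "eventually (\<lambda>q. primepow q \<and> P (real q)) (prime_powers_at_top S)"
proof -
  have "eventually (\<lambda>q::nat. P (real q)) at_top"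
    using assms filterlim_real_sequentially by (simp add: filterlim_iff)
  moreover have "primepow q" if "q \<in> {p ^ k | p k. Factorial_Ring.prime p \<and> p \<notin> S \<and> k > 0}" for q :: nat
    using that by (auto simp: primepow_def)
  ultimately show ?thesis
    unfolding prime_powers_at_top_def eventually_inf_principal by (auto elim: eventually_mono)
qed

theorem theorem1:
  fixes L :: "nat \<Rightarrow> 'a ring" and F :: "nat \<Rightarrow> 'a set" and n r :: nat
  assumes closure: "\<And>q. primepow q \<Longrightarrow> algebraic_closure (L q) (F q)"
    and card: "\<And>q. primepow q \<Longrightarrow> card (F q) = q"
    and n: "n \<in> {2, 3}"
    and r: "r \<ge> 2"
  shows "\<not> asymptotically_transitive (char_variety_ratio L F n r) \<and>
    asymptotic_ratio_bounded_by (char_variety_ratio L F n r) (1 / 2) \<and>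
    (\<forall>c. has_asymptotic_ratio (char_variety_ratio L F n r) c \<longrightarrow> c \<le> 1 / 2)"
proof -
  let ?f = "char_variety_ratio L F n r"
  have loc: "SL_character_variety (L q) (F q) q n" if "primepow q" for q
    unfolding SL_character_variety_def finite_field_closure_def finite_field_closure_axioms_def
      SL_character_variety_axioms_def using closure[OF that] card[OF that] that n by simp
  \<comment> \<open>One comparison function with limit 1/2 covers both dimensions. It is valid for
    every set \<open>S\<close> of discarded primes, because a hypothetical asymptotic ratio comes
    with a set of its own.\<close>
  obtain b :: "real \<Rightarrow> real" where b: "(b \<longlongrightarrow> 1 / 2) at_top"
    and le: "\<And>S. eventually (\<lambda>q. ?f q \<le> b (real q)) (prime_powers_at_top S)"
  proof -
    consider "n = 2" | "n = 3" using n by blast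
    then show thesis
    proof cases
      case 1
      define U where "U = (\<lambda>x::real. ((x + 1) ^ r + 2 ^ r) / 2)"
      define T where "T = (\<lambda>x::real. ((x - 1) ^ r + (x + 1) ^ r) / 2 - 2 ^ r)"
      have r0: "r > 0" using r by simp
      have bounds: "((\<lambda>x. U x / T x) \<longlongrightarrow> 1 / 2) at_top" "eventually (\<lambda>x. T x > 0) at_top"
        unfolding U_def T_def by (rule bounds_2[OF r0])+
      have "eventually (\<lambda>q. ?f q \<le> U (real q) / T (real q)) (prime_powers_at_top S)" for S
        using eventually_prime_powers_at_top[OF bounds(2), of S]
      proof (rule eventually_mono)
        fix q assume "primepow q \<and> T (real q) > 0"
        then show "?f q \<le> U (real q) / T (real q)"
          unfolding char_variety_ratio_def
          by (intro SL_character_variety.max_orbit_ratio_2[OF loc 1]) (auto simp: U_def T_def)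
      qed
      then show thesis by (rule that[OF bounds(1)])
    next
      case 2
      define U where "U = (\<lambda>x::real. ((x ^ 2 + x + 1) ^ r + (x - 1) ^ r + 3 ^ r) / 2)"
      define T where "T = (\<lambda>x::real. ((x - 1) ^ 2) ^ r / 6 + (x ^ 2 - 1) ^ r / 2 +
        (x ^ 2 + x + 1) ^ r / 3 - (x - 1) ^ r - 3 ^ r)"
      have r0: "r > 0" using r by simp
      have bounds: "((\<lambda>x. U x / T x) \<longlongrightarrow> 1 / 2) at_top" "eventually (\<lambda>x. T x > 0) at_top"
        unfolding U_def T_def by (rule bounds_3[OF r0])+
      have "eventually (\<lambda>q. ?f q \<le> U (real q) / T (real q)) (prime_powers_at_top S)" for S
        using eventually_prime_powers_at_top[OF bounds(2), of S]
      proof (rule eventually_mono)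
        fix q assume "primepow q \<and> T (real q) > 0"
        then show "?f q \<le> U (real q) / T (real q)"
          unfolding char_variety_ratio_def
          by (intro SL_character_variety.max_orbit_ratio_3[OF loc 2]) (auto simp: U_def T_def)
      qed
      then show thesis by (rule that[OF bounds(1)])
    qed
  qed
  have lim: "((\<lambda>q. b (real q)) \<longlongrightarrow> 1 / 2) (prime_powers_at_top S)" for S
    using filterlim_compose[OF b filterlim_real_sequentially]
    unfolding prime_powers_at_top_def by (rule tendsto_mono[OF inf_le1])
  have bound: "c \<le> 1 / 2" if "has_asymptotic_ratio ?f c" for c
  proof -
    from that[unfolded has_asymptotic_ratio_def]
    obtain S where S: "finite S" "(?f \<longlongrightarrow> c) (prime_powers_at_top S)"
      by (elim exE conjE)
    show ?thesis
      by (rule tendsto_le[OF prime_powers_at_top_neq_bot[OF S(1)] lim S(2) le])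
  qed
  moreover have "asymptotic_ratio_bounded_by ?f (1 / 2)"
    unfolding asymptotic_ratio_bounded_by_def
  proof (intro exI conjI)
    \<comment> \<open>The witness is the empty set of discarded primes, as the comparison holds at
      all sufficiently large prime powers.\<close>
    have "Limsup (prime_powers_at_top {}) (\<lambda>q. ereal (?f q))
        \<le> Limsup (prime_powers_at_top {}) (\<lambda>q. ereal (b (real q)))"
      using le[of "{}"] by (intro Limsup_mono) simp
    also have "\<dots> = ereal (1 / 2)"
      using lim[of "{}"] by (intro lim_imp_Limsup prime_powers_at_top_neq_bot) auto
    finally show "Limsup (prime_powers_at_top {}) (\<lambda>q. ereal (?f q)) \<le> ereal (1 / 2)" .
  qed simp
  moreover have "\<not> asymptotically_transitive ?f"
    unfolding asymptotically_transitive_def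
  proof
    assume "has_asymptotic_ratio ?f 1"
    from bound[OF this] show False by simp
  qed
  ultimately show ?thesis by blast
qed

end
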